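(* Let $m\neq 0$ be an integer, let $g\in C^\infty([0,\pi])$ satisfy conditions (i)–(iii) of the context, let $G(x)=-\int_x^\pi g(t)\,dt$ for $x\in[0,\pi]$, and let $\varphi_1(r)=2\arctan(r^{|m|})$. Then the boundary value problem $$h''+\frac1r h'-\frac{m^2\sin h\cos h}{r^2}=g(h)\quad\text{on }(0,\infty),\qquad h(0)=0,\quad h(\infty)=\pi$$ has a solution $h$ with $0<h(r)<\pi$ for all $r\in(0,\infty)$ if and only if $$0<\int_0^\infty G(\varphi_1(r))\,r\,dr\le\infty .$$ Moreover, when this condition holds, there is such a solution which satisfies $h'(r)>0$ on $(0,\infty)$ and converges to $\pi$ exponentially as $r\to\infty$.
   Context: Conditions on $g$: (i) there exists $\xi\in(0,\pi)$ such that $g(0)=g(\xi)=g(\pi)=0$, $g(x)>0$ for $x\in(0,\xi)$ and $g(x)<0$ for $x\in(\xi,\pi)$; (ii) $\int_0^\pi g(x)\,dx>0$; (iii) $g'(\pi)>0$. Consequently $G(\pi)=0$, $G(0)<0$, and $G\ge 0$ on $[\xi,\pi]$, so that $\int_0^\infty G(\varphi_1(r))\,r\,dr$ is well defined in $(-\infty,+\infty]$. The unknown is a function $h:[0,\infty)\to\mathbb{R}$, continuous on $[0,\infty)$ and satisfying the differential equation classically on $(0,\infty)$; $h(\infty)=\pi$ means $\lim_{r\to\infty}h(r)=\pi$. "Converges to $\pi$ exponentially" means that there are constants $C,c>0$ with $|\pi-h(r)|\le Ce^{-cr}$ for all sufficiently large $r$. *)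

theory Defs
  imports "HOL-Analysis.Analysis"
begin

text \<open>
  Smoothness on a compact interval up to the boundary: derivatives of all orders exist,
  one-sided at the endpoints. Values outside the interval play no role.
\<close>
definition smooth_on_interval :: "(real \<Rightarrow> real) \<Rightarrow> real \<Rightarrow> real \<Rightarrow> bool" where
  "smooth_on_interval g a b \<longleftrightarrow>
     (\<exists>D :: nat \<Rightarrow> real \<Rightarrow> real. (\<forall>x\<in>{a..b}. D 0 x = g x) \<and>
        (\<forall>n. \<forall>x\<in>{a..b}. (D n has_real_derivative D (Suc n) x) (at x within {a..b})))"

definition cond_i :: "(real \<Rightarrow> real) \<Rightarrow> bool" where
  "cond_i g \<longleftrightarrow>
     (\<exists>\<xi>. 0 < \<xi> \<and> \<xi> < pi \<and> g 0 = 0 \<and> g \<xi> = 0 \<and> g pi = 0 \<and>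
        (\<forall>x. 0 < x \<and> x < \<xi> \<longrightarrow> g x > 0) \<and> (\<forall>x. \<xi> < x \<and> x < pi \<longrightarrow> g x < 0))"

definition cond_ii :: "(real \<Rightarrow> real) \<Rightarrow> bool" where
  "cond_ii g \<longleftrightarrow> integral {0..pi} g > 0"

definition cond_iii :: "(real \<Rightarrow> real) \<Rightarrow> bool" where
  "cond_iii g \<longleftrightarrow> (\<exists>d>0. (g has_real_derivative d) (at pi within {0..pi}))"

definition Gpot :: "(real \<Rightarrow> real) \<Rightarrow> real \<Rightarrow> real" where
  "Gpot g x = - integral {x..pi} g"

definition phi1 :: "int \<Rightarrow> real \<Rightarrow> real" where
  "phi1 m r = 2 * arctan (r ^ nat \<bar>m\<bar>)"

text \<open>
  The Lebesgue integral with values in the extended reals: integral of the positive part minus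
  integral of the negative part. It is meaningful when at least one of the two is finite; below
  the negative part is always finite, since the integrand is continuous and eventually nonnegative.
\<close>
definition ext_integral :: "real set \<Rightarrow> (real \<Rightarrow> real) \<Rightarrow> ereal" where
  "ext_integral A f =
     enn2ereal (\<integral>\<^sup>+r\<in>A. ennreal (f r) \<partial>lborel) - enn2ereal (\<integral>\<^sup>+r\<in>A. ennreal (- f r) \<partial>lborel)"

definition solves_ode :: "int \<Rightarrow> (real \<Rightarrow> real) \<Rightarrow> (real \<Rightarrow> real) \<Rightarrow> bool" where
  "solves_ode m g h \<longleftrightarrow>
     (\<forall>r>0. h differentiable (at r) \<and> deriv h differentiable (at r) \<and>
        deriv (deriv h) r + (1 / r) * deriv h r
          - (real_of_int m)\<^sup>2 * sin (h r) * cos (h r) / r\<^sup>2 = g (h r))"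

definition bvp_solution :: "int \<Rightarrow> (real \<Rightarrow> real) \<Rightarrow> (real \<Rightarrow> real) \<Rightarrow> bool" where
  "bvp_solution m g h \<longleftrightarrow>
     continuous_on {0..} h \<and> solves_ode m g h \<and> h 0 = 0 \<and> (h \<longlongrightarrow> pi) at_top \<and>
     (\<forall>r>0. 0 < h r \<and> h r < pi)"

definition converges_exponentially_to_pi :: "(real \<Rightarrow> real) \<Rightarrow> bool" where
  "converges_exponentially_to_pi h \<longleftrightarrow>
     (\<exists>C>0. \<exists>c>0. \<forall>\<^sub>F r in at_top. \<bar>pi - h r\<bar> \<le> C * exp (- c * r))"

end

(*
  Put k = |m| and t = ln r, so that the equation becomes h'' = k^2 sin h cos h + lam e^(2t) g(h) with
  lam = 1; translations in t change lam. With lam = 0 the profile phi(t) = 2 arctan(e^(kt)) is a solution,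
  and the solution with h ~ phi at t = -oo is a contraction fixed point for h - phi in a weighted sup norm,
  depending continuously on lam. Let w = h' - k sin h and E = ((h')^2 - k^2 sin^2 h) / 2, so that
  E' = lam e^(2t) g(h) h'. Integration by parts gives the Pohozaev identity
  E = lam (e^(2t) G(h) - int_0^r 2 s G(h) ds).

  As long as w > 0, the quantity ln tan(h/2) - kt increases, so h crosses a translate of phi exactly once;
  if this happens at the height xi then G(h) <= G(phi) everywhere, and the Pohozaev identity at the
  (possibly infinite) first zero of w makes int G(phi) r dr positive.

  Conversely shoot in lam. For large lam the potential difference -G(0) > 0 makes h overshoot pi with w > 0;
  for small lam the orbit follows phi and the Pohozaev identity gives E < 0, i.e. w < 0, before h
  reaches pi. Both events are open in lam, so for some lam neither happens, and then w > 0 and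
  0 < h < pi for all times. For such h, E >= lam e^(2t) G(h) and G is quadratic at pi, which gives the
  exponential rate.
*)
theory Submission
  imports Defs
begin

text \<open>On the lam = 0 profile w and E vanish identically, so closeness to it does not decide
  what happens for small lam. The Pohozaev identity removes this degeneracy: E / lam extends
  continuously to lam = 0, where its value depends on phi alone. This is why the integral of G(phi)
  governs the problem, and why one shoots in lam with the behaviour at t = -oo kept fixed.

  An orbit may leave [0, pi], so g is continued to a Lipschitz function on the whole line; one
  contraction then gives orbits for all t and all lam in [0, Lam], and no maximal interval of
  existence has to be tracked.

  A given solution of the boundary value problem is not known to be monotone. It is followed only
  while w > 0, and what makes the comparison with phi favourable on both sides of the crossing is
  that G increases up to xi and decreases afterwards.

  Openness of the two exits rests on transversality: at pi by uniqueness against the constant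
  solution, at a zero of w because w' = lam e^(2t) g(h) < 0 above xi.\<close>

lemma continuous_on_atLeast_0_if_dominated:
  fixes f u :: "real \<Rightarrow> real"
  assumes f: "continuous_on {0<..} f" and u: "continuous_on {0..} u" "u 0 = 0"
    and le: "\<And>r. 0 \<le> r \<Longrightarrow> \<bar>f r\<bar> \<le> u r"
  shows "continuous_on {0..} f"
  unfolding continuous_on_eq_continuous_within
proof
  fix x :: real assume x: "x \<in> {0..}"
  show "continuous (at x within {0..}) f"
  proof (cases "x = 0")
    case True
    have f0: "f 0 = 0" using le[of 0] u(2) by simp
    have "(u \<longlongrightarrow> 0) (at 0 within {0..})"
      using u unfolding continuous_on_def by (metis atLeast_iff order_refl)
    then have "(f \<longlongrightarrow> 0) (at 0 within {0..})"
      by (rule Lim_null_comparison[rotated])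
        (use le in \<open>auto simp: eventually_at_filter intro!: always_eventually\<close>)
    then show ?thesis using True f0 by (simp add: continuous_within)
  next
    case False
    then have "isCont f x" using f x continuous_on_eq_continuous_at[of "{0<..}" f] by auto
    then show ?thesis by (rule continuous_at_imp_continuous_at_within)
  qed
qed

lemma abs_integral_le_antiderivative:
  fixes f u X :: "real \<Rightarrow> real"
  assumes "0 \<le> r" and f: "continuous_on {0..r} f"
    and le: "\<And>x. 0 \<le> x \<Longrightarrow> x \<le> r \<Longrightarrow> \<bar>f x\<bar> \<le> u x"
    and X: "\<And>x. 0 \<le> x \<Longrightarrow> x \<le> r \<Longrightarrow> (X has_real_derivative u x) (at x)" and "X 0 = 0"
  shows "\<bar>integral {0..r} f\<bar> \<le> X r"
proof -
  have "(u has_integral (X r - X 0)) {0..r}"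
    using assms(1) X
    by (intro fundamental_theorem_of_calculus)
      (auto simp: has_real_derivative_iff_has_vector_derivative[symmetric] intro: has_field_derivative_at_within)
  then show ?thesis
    using integral_norm_bound_integral[OF integrable_continuous_real[OF f], of u] le \<open>X 0 = 0\<close>
    by (auto simp: integral_unique)
qed

lemma integral_from_0_has_real_derivative:
  fixes f :: "real \<Rightarrow> real"
  assumes "continuous_on {0..} f" "0 < r"
  shows "((\<lambda>x. integral {0..x} f) has_real_derivative f r) (at r)"
proof -
  have "((\<lambda>x. integral {0..x} f) has_real_derivative f r) (at r within {0..r+1})"
    using assms by (intro integral_has_real_derivative) (auto intro: continuous_on_subset)
  then show ?thesis using assms(2) by (simp add: at_within_Icc_at)
qed

lemma abs_sin_diff_le: "\<bar>sin x - sin y\<bar> \<le> \<bar>x - y\<bar>" for x y :: real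
proof -
  have "\<bar>sin x - sin y\<bar> = 2 * \<bar>sin ((x - y) / 2)\<bar> * \<bar>cos ((x + y) / 2)\<bar>"
    by (simp add: sin_diff_sin abs_mult)
  also have "\<dots> \<le> 2 * \<bar>(x - y) / 2\<bar> * 1"
    by (intro mult_mono abs_sin_x_le_abs_x) auto
  finally show ?thesis by simp
qed

section \<open>The singular initial value problem\<close>

text \<open>\<open>om\<close> is the weight of the fixed point argument; \<open>om1\<close> and \<open>om2\<close> are its iterated images under \<open>r d/dr\<close>.
  The factor \<open>exp (b r\<^sup>2)\<close> absorbs the term \<open>lam r\<^sup>2 g\<close>, so that the contraction holds on all of \<open>(0, \<infinity>)\<close>.\<close>

definition om :: "nat \<Rightarrow> real \<Rightarrow> real \<Rightarrow> real" where
  "om n b r = r ^ (n + 1) * exp (b * r\<^sup>2)"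

definition om1 :: "nat \<Rightarrow> real \<Rightarrow> real \<Rightarrow> real" where
  "om1 n b r = (real n + 1 + 2 * b * r\<^sup>2) * om n b r"

definition om2 :: "nat \<Rightarrow> real \<Rightarrow> real \<Rightarrow> real" where
  "om2 n b r = ((real n + 1 + 2 * b * r\<^sup>2)\<^sup>2 + 4 * b * r\<^sup>2) * om n b r"

lemma om_0 [simp]: "om n b 0 = 0" "om1 n b 0 = 0" "om2 n b 0 = 0"
  by (simp_all add: om_def om1_def om2_def)

lemma om_pos: "0 < r \<Longrightarrow> 0 < om n b r"
  by (simp add: om_def)

lemma om_divide: "om n b r / r = r ^ n * exp (b * r\<^sup>2)" if "0 < n"
proof -
  obtain k where "n = Suc k" using \<open>0 < n\<close> gr0_implies_Suc by blast
  then show ?thesis by (cases "r = 0") (simp_all add: om_def)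
qed

lemma om_has_derivative:
  assumes "0 < n"
  shows "(om n b has_real_derivative om1 n b r / r) (at r)"
proof -
  have "((\<lambda>r. r ^ (n + 1) * exp (b * r\<^sup>2)) has_real_derivative
      (real n + 1 + 2 * b * r\<^sup>2) * (r ^ n * exp (b * r\<^sup>2))) (at r)"
    using assms by (auto intro!: derivative_eq_intros simp: algebra_simps power2_eq_square power_minus_mult simp flip: power_Suc)
  moreover have "om1 n b r / r = (real n + 1 + 2 * b * r\<^sup>2) * (r ^ n * exp (b * r\<^sup>2))"
    using om_divide[OF assms, of b r] by (simp add: om1_def flip: times_divide_eq_right)
  ultimately show ?thesis by (simp add: om_def[abs_def])
qed

lemma om1_has_derivative:
  assumes "0 < n"
  shows "(om1 n b has_real_derivative om2 n b r / r) (at r)"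
proof -
  have "((\<lambda>r. (real n + 1 + 2 * b * r\<^sup>2) * om n b r) has_real_derivative
      (4 * b * r) * om n b r + (real n + 1 + 2 * b * r\<^sup>2) * (om1 n b r / r)) (at r)"
    by (auto intro!: derivative_eq_intros om_has_derivative[OF assms] simp: algebra_simps)
  moreover have "om2 n b r / r = (4 * b * r) * om n b r + (real n + 1 + 2 * b * r\<^sup>2) * (om1 n b r / r)"
    by (cases "r = 0") (auto simp: om1_def om2_def field_simps power2_eq_square)
  ultimately show ?thesis unfolding om1_def[abs_def] by metis
qed

lemma continuous_on_om:
  assumes "0 < n"
  shows "continuous_on S (om n b)" "continuous_on S (\<lambda>r. om1 n b r / r)" "continuous_on S (\<lambda>r. om2 n b r / r)"
proof -
  show "continuous_on S (om n b)"
    unfolding om_def[abs_def] by (intro continuous_intros)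
  have *: "(\<lambda>r. om1 n b r / r) = (\<lambda>r. (real n + 1 + 2 * b * r\<^sup>2) * (r ^ n * exp (b * r\<^sup>2)))"
    using om_divide[OF assms, of b] by (auto simp: om1_def simp flip: times_divide_eq_right)
  have **: "(\<lambda>r. om2 n b r / r) = (\<lambda>r. ((real n + 1 + 2 * b * r\<^sup>2)\<^sup>2 + 4 * b * r\<^sup>2) * (r ^ n * exp (b * r\<^sup>2)))"
    using om_divide[OF assms, of b] by (auto simp: om2_def simp flip: times_divide_eq_right)
  show "continuous_on S (\<lambda>r. om1 n b r / r)" unfolding * by (intro continuous_intros)
  show "continuous_on S (\<lambda>r. om2 n b r / r)" unfolding ** by (intro continuous_intros)
qed

text \<open>At \<open>\<rho> = 0\<close> the integrand is \<open>0\<close> by the convention on division, which is also its limit in all uses below.\<close>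

definition J_int :: "(real \<Rightarrow> real) \<Rightarrow> real \<Rightarrow> real" where
  "J_int N r = integral {0..r} (\<lambda>\<rho>. N \<rho> / \<rho>)"

text \<open>\<open>J_int\<close> inverts r d/dr. Comparing with an exact antiderivative of the
  majorant loses no constant, which matters because the same computation later supplies a
  contraction factor below 1.\<close>

lemma J_int_dominated:
  assumes N: "continuous_on {0<..} N" and u: "continuous_on {0..} u" "u 0 = 0"
    and X: "\<And>r. 0 \<le> r \<Longrightarrow> (X has_real_derivative u r) (at r)" "X 0 = 0"
    and le: "\<And>r. 0 < r \<Longrightarrow> \<bar>N r\<bar> / r \<le> u r"
  shows "continuous_on {0..} (\<lambda>r. N r / r)"
    and "0 \<le> r \<Longrightarrow> \<bar>J_int N r\<bar> \<le> X r"
    and "0 < r \<Longrightarrow> (J_int N has_real_derivative N r / r) (at r)"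
proof -
  have le': "\<bar>N r / r\<bar> \<le> u r" if "0 \<le> r" for r
    using le[of r] that u(2) by (cases "r = 0") auto
  show c: "continuous_on {0..} (\<lambda>r. N r / r)"
    by (rule continuous_on_atLeast_0_if_dominated[OF _ u le'])
      (auto intro!: continuous_intros N)
  show "\<bar>J_int N r\<bar> \<le> X r" if "0 \<le> r"
    unfolding J_int_def
    by (rule abs_integral_le_antiderivative[OF that, where u=u])
      (use c le' X in \<open>auto intro: continuous_on_subset\<close>)
  show "(J_int N has_real_derivative N r / r) (at r)" if "0 < r"
    using integral_from_0_has_real_derivative[OF c that] by (simp add: J_int_def[abs_def])
qed

lemma
  assumes n: "0 < n" and N: "continuous_on {0<..} N" and le: "\<And>r. 0 < r \<Longrightarrow> \<bar>N r\<bar> \<le> D * om2 n b r"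
  shows J_int_om2_continuous: "continuous_on {0..} (\<lambda>r. N r / r)"
    and J_int_om2_le: "0 \<le> r \<Longrightarrow> \<bar>J_int N r\<bar> \<le> D * om1 n b r"
    and J_int_om2_deriv: "0 < r \<Longrightarrow> (J_int N has_real_derivative N r / r) (at r)"
proof -
  have u: "continuous_on {0..} (\<lambda>r. D * (om2 n b r / r))" "D * (om2 n b 0 / 0) = 0"
    using continuous_on_mult_left[OF continuous_on_om(3)[OF n]] by auto
  have X: "((\<lambda>r. D * om1 n b r) has_real_derivative D * (om2 n b r / r)) (at r)" for r
    by (intro DERIV_cmult om1_has_derivative n)
  have le': "\<bar>N r\<bar> / r \<le> D * (om2 n b r / r)" if "0 < r" for r
    using le[OF that] that by (simp add: divide_right_mono)
  note * = J_int_dominated[OF N u X _ le']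
  show "continuous_on {0..} (\<lambda>r. N r / r)" "0 \<le> r \<Longrightarrow> \<bar>J_int N r\<bar> \<le> D * om1 n b r"
    "0 < r \<Longrightarrow> (J_int N has_real_derivative N r / r) (at r)"
    using * by auto
qed

lemma
  assumes n: "0 < n" and N: "continuous_on {0<..} N" and le: "\<And>r. 0 < r \<Longrightarrow> \<bar>N r\<bar> \<le> D * om1 n b r"
  shows J_int_om1_continuous: "continuous_on {0..} (\<lambda>r. N r / r)"
    and J_int_om1_le: "0 \<le> r \<Longrightarrow> \<bar>J_int N r\<bar> \<le> D * om n b r"
    and J_int_om1_deriv: "0 < r \<Longrightarrow> (J_int N has_real_derivative N r / r) (at r)"
proof -
  have u: "continuous_on {0..} (\<lambda>r. D * (om1 n b r / r))" "D * (om1 n b 0 / 0) = 0"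
    using continuous_on_mult_left[OF continuous_on_om(2)[OF n]] by auto
  have X: "((\<lambda>r. D * om n b r) has_real_derivative D * (om1 n b r / r)) (at r)" for r
    by (intro DERIV_cmult om_has_derivative n)
  have le': "\<bar>N r\<bar> / r \<le> D * (om1 n b r / r)" if "0 < r" for r
    using le[OF that] that by (simp add: divide_right_mono)
  note * = J_int_dominated[OF N u X _ le']
  show "continuous_on {0..} (\<lambda>r. N r / r)" "0 \<le> r \<Longrightarrow> \<bar>J_int N r\<bar> \<le> D * om n b r"
    "0 < r \<Longrightarrow> (J_int N has_real_derivative N r / r) (at r)"
    using * by auto
qed

lemma J_int_diff:
  assumes "continuous_on {0..} (\<lambda>r. N r / r)" "continuous_on {0..} (\<lambda>r. M r / r)"
  shows "J_int (\<lambda>r. N r - M r) r = J_int N r - J_int M r"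
  unfolding J_int_def diff_divide_distrib
  by (intro integral_diff integrable_continuous_real continuous_on_subset[OF assms(1)]
      continuous_on_subset[OF assms(2)]) auto

lemma om2_eq: "om2 n b r = ((real n + 1)\<^sup>2 + 4 * b * (real n + 2) * r\<^sup>2 + 4 * b\<^sup>2 * r ^ 4) * om n b r"
proof -
  have "(real n + 1 + 2 * b * r\<^sup>2)\<^sup>2 + 4 * b * r\<^sup>2 = (real n + 1)\<^sup>2 + 4 * b * (real n + 2) * r\<^sup>2 + 4 * b\<^sup>2 * r ^ 4"
    by algebra
  then show ?thesis unfolding om2_def by simp
qed

text \<open>The first bound drops the r^4 term; the other two dominate the two parts of the
  lam-dependence in \<open>nonl_parameter\<close>.\<close>

lemma om2_ge:
  assumes "0 < n" "0 < r" "1 \<le> b"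
  shows "((real n + 1)\<^sup>2 + 4 * b * (real n + 2) * r\<^sup>2) * om n b r \<le> om2 n b r"
    and "r\<^sup>2 * om n b r \<le> om2 n b r"
    and "r ^ (n + 2) \<le> om2 n b r"
proof -
  have om: "0 < om n b r" using assms om_pos by blast
  have p: "0 \<le> 4 * b\<^sup>2 * r ^ 4" using assms by simp
  show 1: "((real n + 1)\<^sup>2 + 4 * b * (real n + 2) * r\<^sup>2) * om n b r \<le> om2 n b r"
    unfolding om2_eq using om p by (intro mult_right_mono) auto
  have "1 * 1 \<le> b * (real n + 2)" using assms by (intro mult_mono) auto
  then have "1 * r\<^sup>2 \<le> 4 * (b * (real n + 2)) * r\<^sup>2" by (intro mult_right_mono) auto
  then have 2: "r\<^sup>2 \<le> 4 * b * (real n + 2) * r\<^sup>2" by (simp add: mult.assoc)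
  have 3: "1 \<le> (real n + 1)\<^sup>2" by simp
  have 4: "r\<^sup>2 \<le> (real n + 1)\<^sup>2 + 4 * b * (real n + 2) * r\<^sup>2" using 2 3 by linarith
  have 5: "1 + r\<^sup>2 \<le> (real n + 1)\<^sup>2 + 4 * b * (real n + 2) * r\<^sup>2" using 2 3 by linarith
  have "r\<^sup>2 * om n b r \<le> ((real n + 1)\<^sup>2 + 4 * b * (real n + 2) * r\<^sup>2) * om n b r"
    using om 4 by (intro mult_right_mono) auto
  with 1 show "r\<^sup>2 * om n b r \<le> om2 n b r" by linarith
  have "r \<le> 1 + r\<^sup>2" using zero_le_power2[of "r - 1"] assms(2) by (simp add: power2_diff)
  have "r ^ (n + 2) = r * (r ^ (n + 1) * 1)" by simp
  also have "\<dots> \<le> (1 + r\<^sup>2) * om n b r"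
    unfolding om_def using assms \<open>r \<le> 1 + r\<^sup>2\<close> by (intro mult_mono) auto
  also have "\<dots> \<le> ((real n + 1)\<^sup>2 + 4 * b * (real n + 2) * r\<^sup>2) * om n b r"
    using om 5 by (intro mult_right_mono) auto
  finally show "r ^ (n + 2) \<le> om2 n b r" using 1 by linarith
qed

text \<open>Near r = 0 the Lipschitz constant of the nonlinearity is n^2, while (r d/dr)^2
  multiplies r^(n+1) by (n+1)^2. The extra power of r in \<open>om\<close> is what makes the
  quotient less than 1.\<close>

definition contr :: "nat \<Rightarrow> real" where
  "contr n = (real n / (real n + 1))\<^sup>2"

lemma contr_bounds: "0 \<le> contr n" "contr n < 1"
  by (auto simp: contr_def power_less_one_iff abs_square_less_1)

text \<open>The r^2 term costs nothing: for n >= 1 the factor \<open>contr n\<close> is at least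
  1/4, so the coefficient 4 b (n + 2) from \<open>om2\<close> still dominates c after multiplication
  by it.\<close>

lemma om2_contr:
  assumes "0 < n" "0 < r" "1 \<le> b" "c \<le> b"
  shows "((real n)\<^sup>2 + c * r\<^sup>2) * om n b r \<le> contr n * om2 n b r"
proof -
  have om: "0 < om n b r" using assms om_pos by blast
  have "1 / 2 \<le> real n / (real n + 1)" using assms(1) by (simp add: field_simps)
  then have "(1 / 2)\<^sup>2 \<le> contr n" unfolding contr_def by (intro power_mono) auto
  then have "1 / 4 \<le> contr n" by (simp add: power2_eq_square)
  then have "1 / 4 * 1 \<le> contr n * (real n + 2)" by (intro mult_mono) auto
  then have "b * (1/4) \<le> b * (contr n * (real n + 2))" using assms by (intro mult_left_mono) auto
  then have "c \<le> contr n * (4 * b * (real n + 2))" using assms(4) by (simp add: algebra_simps)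
  then have "c * r\<^sup>2 \<le> contr n * (4 * b * (real n + 2)) * r\<^sup>2" by (intro mult_right_mono) auto
  moreover have "contr n * (real n + 1)\<^sup>2 = (real n)\<^sup>2" by (simp add: contr_def power_divide)
  ultimately have "(real n)\<^sup>2 + c * r\<^sup>2 \<le> contr n * ((real n + 1)\<^sup>2 + 4 * b * (real n + 2) * r\<^sup>2)"
    by (simp add: algebra_simps)
  then have "((real n)\<^sup>2 + c * r\<^sup>2) * om n b r \<le> contr n * ((real n + 1)\<^sup>2 + 4 * b * (real n + 2) * r\<^sup>2) * om n b r"
    using om by (intro mult_right_mono) auto
  also have "\<dots> \<le> contr n * om2 n b r"
    using om2_ge(1)[OF assms(1-3)] contr_bounds(1)[of n] by (simp add: mult.assoc mult_left_mono)
  finally show ?thesis .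
qed

section \<open>The profile and the nonlinearity in the variable t\<close>

lemma sin_2_arctan: "sin (2 * arctan x) = 2 * x / (1 + x\<^sup>2)"
  by (simp add: sin_double sin_arctan cos_arctan)

text \<open>The profile \<open>phi1\<close> in the variable \<open>t = ln r\<close>.\<close>

definition phit :: "nat \<Rightarrow> real \<Rightarrow> real" where
  "phit n t = 2 * arctan (exp (real n * t))"

lemma phit_bounds: "0 < phit n t" "phit n t < pi"
  using arctan_ubound[of "exp (real n * t)"] by (auto simp: phit_def)

lemma phit_le: "phit n t \<le> 2 * exp (real n * t)"
  by (simp add: phit_def arctan_le_self)

lemma phit_has_derivative:
  "(phit n has_real_derivative real n * sin (phit n t)) (at t)"
proof -
  have "(phit n has_real_derivative 2 * (real n * exp (real n * t) / (1 + (exp (real n * t))\<^sup>2))) (at t)"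
    unfolding phit_def[abs_def]
    by (auto intro!: derivative_eq_intros simp: field_simps)
  then show ?thesis
    by (simp add: phit_def sin_2_arctan mult.left_commute)
qed

text \<open>With \<open>H = h - phit\<close> the equation in \<open>t = ln r\<close> reads \<open>H'' = nonl n g lam (exp t) H\<close>.\<close>

definition nonl :: "nat \<Rightarrow> (real \<Rightarrow> real) \<Rightarrow> real \<Rightarrow> real \<Rightarrow> real \<Rightarrow> real" where
  "nonl n g lam r H = (real n)\<^sup>2 / 2 * (sin (2 * (phit n (ln r) + H)) - sin (2 * phit n (ln r)))
     + lam * r\<^sup>2 * g (phit n (ln r) + H)"

text \<open>With sin cos written as half the sine of the double angle, the constant at r = 0 is n^2,
  as \<open>contr\<close> requires; estimating the two factors separately would double it.\<close>

lemma nonl_lipschitz: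
  assumes "\<And>x y. \<bar>g x - g y\<bar> \<le> L * \<bar>x - y\<bar>" "0 \<le> lam"
  shows "\<bar>nonl n g lam r H - nonl n g lam r K\<bar> \<le> ((real n)\<^sup>2 + lam * L * r\<^sup>2) * \<bar>H - K\<bar>"
proof -
  let ?p = "phit n (ln r)"
  have "\<bar>sin (2 * (?p + H)) - sin (2 * (?p + K))\<bar> \<le> \<bar>2 * (?p + H) - 2 * (?p + K)\<bar>"
    by (rule abs_sin_diff_le)
  also have "2 * (?p + H) - 2 * (?p + K) = 2 * (H - K)" by (simp add: algebra_simps)
  finally have 1: "\<bar>sin (2 * (?p + H)) - sin (2 * (?p + K))\<bar> \<le> 2 * \<bar>H - K\<bar>"
    unfolding abs_mult by simp
  have 2: "\<bar>g (?p + H) - g (?p + K)\<bar> \<le> L * \<bar>H - K\<bar>" using assms(1)[of "?p + H" "?p + K"] by simp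
  have "nonl n g lam r H - nonl n g lam r K = (real n)\<^sup>2 / 2 * (sin (2 * (?p + H)) - sin (2 * (?p + K)))
    + lam * r\<^sup>2 * (g (?p + H) - g (?p + K))"
    unfolding nonl_def by (simp add: algebra_simps)
  also have "\<bar>\<dots>\<bar> \<le> (real n)\<^sup>2 / 2 * \<bar>sin (2 * (?p + H)) - sin (2 * (?p + K))\<bar>
    + lam * r\<^sup>2 * \<bar>g (?p + H) - g (?p + K)\<bar>"
    using assms(2) by (intro order_trans[OF abs_triangle_ineq]) (simp add: abs_mult)
  also have "\<dots> \<le> (real n)\<^sup>2 / 2 * (2 * \<bar>H - K\<bar>) + lam * r\<^sup>2 * (L * \<bar>H - K\<bar>)"
    using 1 2 assms(2) by (intro add_mono mult_left_mono) auto
  finally show ?thesis by (simp add: algebra_simps)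
qed

text \<open>Because g(0) = 0, the value g (phit + H) is of size r^n + |H|, so the forcing is of
  order r^(n+2) + r^2 |H| and fits under \<open>om2\<close>.\<close>

lemma nonl_parameter:
  assumes "\<And>x y. \<bar>g x - g y\<bar> \<le> L * \<bar>x - y\<bar>" "g 0 = 0" "0 < r" "0 \<le> L"
  shows "\<bar>nonl n g lam r H - nonl n g mu r H\<bar> \<le> \<bar>lam - mu\<bar> * L * (2 * r ^ (n + 2) + r\<^sup>2 * \<bar>H\<bar>)"
proof -
  let ?p = "phit n (ln r)"
  have "exp (real n * ln r) = r ^ n"
    using assms(3) by (simp add: exp_of_nat_mult)
  then have "\<bar>?p + H\<bar> \<le> 2 * r ^ n + \<bar>H\<bar>"
    using phit_le[of n "ln r"] phit_bounds[of n "ln r"] by simp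
  then have "\<bar>g (?p + H)\<bar> \<le> L * (2 * r ^ n + \<bar>H\<bar>)"
    using assms(1)[of "?p + H" 0] assms(2) assms(4)
    by (smt (verit) mult_left_mono)
  moreover have "nonl n g lam r H - nonl n g mu r H = (lam - mu) * r\<^sup>2 * g (?p + H)"
    unfolding nonl_def by (simp add: algebra_simps)
  ultimately have "\<bar>nonl n g lam r H - nonl n g mu r H\<bar> \<le> \<bar>lam - mu\<bar> * r\<^sup>2 * (L * (2 * r ^ n + \<bar>H\<bar>))"
    by (simp add: abs_mult mult_left_mono)
  then show ?thesis by (simp add: algebra_simps power_add power2_eq_square)
qed

text \<open>The unknown is v = (h - phit) / om, a bounded continuous function of t on the whole
  line, and the map applies \<open>J_int\<close> twice to \<open>nonl\<close>. The last two
  conclusions are Lipschitz bounds in lam whose weights are bounded on every half-line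
  (-\<infinity>, t]; the shooting argument uses this uniformity.\<close>

lemma singular_ivp_family:
  fixes g :: "real \<Rightarrow> real" and n :: nat and Lam L :: real
  assumes n: "0 < n" and Lam: "0 \<le> Lam" and L: "0 \<le> L"
    and lip: "\<And>x y. \<bar>g x - g y\<bar> \<le> L * \<bar>x - y\<bar>" and g0: "g 0 = 0"
  obtains h y :: "real \<Rightarrow> real \<Rightarrow> real" and C b :: real where "0 \<le> C" "1 \<le> b" "h 0 = phit n"
    and "\<And>lam t. 0 \<le> lam \<Longrightarrow> lam \<le> Lam \<Longrightarrow> (h lam has_real_derivative y lam t) (at t)"
    and "\<And>lam t. 0 \<le> lam \<Longrightarrow> lam \<le> Lam \<Longrightarrow> (y lam has_real_derivative
          (real n)\<^sup>2 * sin (h lam t) * cos (h lam t) + lam * exp (2 * t) * g (h lam t)) (at t)"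
    and "\<And>lam mu t. 0 \<le> lam \<Longrightarrow> lam \<le> Lam \<Longrightarrow> 0 \<le> mu \<Longrightarrow> mu \<le> Lam \<Longrightarrow>
          \<bar>h lam t - h mu t\<bar> \<le> C * \<bar>lam - mu\<bar> * om n b (exp t)"
    and "\<And>lam mu t. 0 \<le> lam \<Longrightarrow> lam \<le> Lam \<Longrightarrow> 0 \<le> mu \<Longrightarrow> mu \<le> Lam \<Longrightarrow>
          \<bar>y lam t - y mu t\<bar> \<le> C * \<bar>lam - mu\<bar> * om1 n b (exp t)"
proof -
  \<comment> \<open>This b dominates lam * L for every lam in [0, Lam], so that one weight and one
    contraction factor serve the whole family.\<close>
  define b where "b = Lam * L + 1"
  have b: "1 \<le> b" "Lam * L \<le> b" using Lam L by (auto simp: b_def)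
  let ?q = "contr n"
  have q: "0 \<le> ?q" "?q < 1" using contr_bounds by auto
  define F where "F lam v r = nonl n g lam r (om n b r * apply_bcontfun v (ln r))"
    for lam v r
  have "L-lipschitz_on UNIV g"
    using lip L by (intro lipschitz_onI) (auto simp: dist_real_def)
  then have gc: "continuous_on S g" for S
    using lipschitz_on_continuous_on continuous_on_subset by blast
  have cF: "continuous_on {0<..} (F lam v)" for lam v
    unfolding F_def nonl_def phit_def
    by (intro continuous_intros continuous_on_compose2[OF gc[of UNIV]]
        continuous_on_compose2[OF continuous_on_apply_bcontfun[of UNIV]] continuous_on_om[OF n]) auto
  \<comment> \<open>Pass from v to u at fixed lam, which produces the contraction factor, and then
    from lam to mu at fixed u, where only the size of u enters.\<close>
  have F_diff: "\<bar>F lam v r - F mu u r\<bar> \<le> (?q * dist v u + \<bar>lam - mu\<bar> * L * (2 + norm u)) * om2 n b r"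
    if "0 \<le> lam" "lam \<le> Lam" "0 < r" for lam mu v u r
  proof -
    have om: "0 < om n b r" using that om_pos by blast
    have "\<bar>F lam v r - F lam u r\<bar> \<le> ((real n)\<^sup>2 + lam * L * r\<^sup>2) *
        \<bar>om n b r * apply_bcontfun v (ln r) - om n b r * apply_bcontfun u (ln r)\<bar>"
      unfolding F_def using that by (intro nonl_lipschitz lip)
    also have "\<dots> = ((real n)\<^sup>2 + lam * L * r\<^sup>2) * om n b r * dist (apply_bcontfun v (ln r)) (apply_bcontfun u (ln r))"
      using om by (simp add: dist_real_def abs_mult flip: right_diff_distrib)
    also have "\<dots> \<le> ((real n)\<^sup>2 + lam * L * r\<^sup>2) * om n b r * dist v u"
      using om that L by (intro mult_left_mono dist_bounded) auto
    also have "\<dots> \<le> ?q * om2 n b r * dist v u"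
      using that b L by (intro mult_right_mono om2_contr n)
        (auto intro: order_trans[OF mult_right_mono])
    finally have 1: "\<bar>F lam v r - F lam u r\<bar> \<le> ?q * dist v u * om2 n b r"
      by (simp add: algebra_simps)
    have "\<bar>F lam u r - F mu u r\<bar> \<le> \<bar>lam - mu\<bar> * L * (2 * r ^ (n + 2) + r\<^sup>2 * \<bar>om n b r * apply_bcontfun u (ln r)\<bar>)"
      unfolding F_def using that by (intro nonl_parameter lip L g0)
    also have "\<dots> \<le> \<bar>lam - mu\<bar> * L * (2 * om2 n b r + r\<^sup>2 * om n b r * norm u)"
      using L om om2_ge(3)[OF n that(3) b(1)] norm_bounded[of u "ln r"]
      by (intro mult_left_mono add_mono) (auto simp: abs_mult mult.assoc intro!: mult_left_mono)
    also have "\<dots> \<le> \<bar>lam - mu\<bar> * L * (2 * om2 n b r + om2 n b r * norm u)"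
      using L om2_ge(2)[OF n that(3) b(1)]
      by (intro mult_left_mono add_mono mult_right_mono) auto
    finally have 2: "\<bar>F lam u r - F mu u r\<bar> \<le> \<bar>lam - mu\<bar> * L * (2 + norm u) * om2 n b r"
      by (simp add: algebra_simps)
    show ?thesis using 1 2 by (simp add: algebra_simps)
  qed
  have F0: "F 0 0 r = 0" for r by (simp add: F_def nonl_def)
  have F_le: "\<bar>F lam v r\<bar> \<le> (?q * norm v + lam * L * 2) * om2 n b r"
    if "0 \<le> lam" "lam \<le> Lam" "0 < r" for lam v r
    using F_diff[OF that, of v 0 0] that by (simp add: F0)
  define J where "J lam v = J_int (F lam v)" for lam v
  define K where "K lam v = J_int (J lam v)" for lam v
  note J1 = J_int_om2_continuous[OF n cF F_le]
  have J2: "\<bar>J lam v r\<bar> \<le> (?q * norm v + lam * L * 2) * om1 n b r" if "0 \<le> lam" "lam \<le> Lam" "0 \<le> r" for lam v r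
    using J_int_om2_le[OF n cF F_le] that unfolding J_def by blast
  have J3: "(J lam v has_real_derivative F lam v r / r) (at r)" if "0 \<le> lam" "lam \<le> Lam" "0 < r" for lam v r
    using J_int_om2_deriv[OF n cF F_le] that unfolding J_def by blast
  have cJ: "continuous_on {0<..} (J lam v)" if "0 \<le> lam" "lam \<le> Lam" for lam v
    using J3[OF that] by (auto intro!: continuous_at_imp_continuous_on DERIV_isCont)
  have K1: "continuous_on {0..} (\<lambda>r. J lam v r / r)" if "0 \<le> lam" "lam \<le> Lam" for lam v
    using J_int_om1_continuous[OF n cJ J2] that by simp
  have K2: "\<bar>K lam v r\<bar> \<le> (?q * norm v + lam * L * 2) * om n b r" if "0 \<le> lam" "lam \<le> Lam" "0 \<le> r" for lam v r
    using J_int_om1_le[OF n cJ J2] that unfolding K_def by simp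
  have K3: "(K lam v has_real_derivative J lam v r / r) (at r)" if "0 \<le> lam" "lam \<le> Lam" "0 < r" for lam v r
    using J_int_om1_deriv[OF n cJ J2] that unfolding K_def by simp
  have J_diff: "\<bar>J lam v r - J mu u r\<bar> \<le> (?q * dist v u + \<bar>lam - mu\<bar> * L * (2 + norm u)) * om1 n b r"
    if "0 \<le> lam" "lam \<le> Lam" "0 \<le> mu" "mu \<le> Lam" "0 \<le> r" for lam mu v u r
  proof -
    have "J lam v r - J mu u r = J_int (\<lambda>r. F lam v r - F mu u r) r"
      unfolding J_def using J1 that by (intro J_int_diff[symmetric]) auto
    then show ?thesis
      using J_int_om2_le[OF n continuous_on_diff[OF cF cF] F_diff] that by simp
  qed
  have K_diff: "\<bar>K lam v r - K mu u r\<bar> \<le> (?q * dist v u + \<bar>lam - mu\<bar> * L * (2 + norm u)) * om n b r"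
    if "0 \<le> lam" "lam \<le> Lam" "0 \<le> mu" "mu \<le> Lam" "0 \<le> r" for lam mu v u r
  proof -
    have "K lam v r - K mu u r = J_int (\<lambda>r. J lam v r - J mu u r) r"
      unfolding K_def using K1 that by (intro J_int_diff[symmetric]) auto
    then show ?thesis
      using J_int_om1_le[OF n continuous_on_diff[OF cJ cJ] J_diff] that by simp
  qed
  define T where "T lam v = Bcontfun (\<lambda>t. K lam v (exp t) / om n b (exp t))" for lam v
  have T: "apply_bcontfun (T lam v) t = K lam v (exp t) / om n b (exp t)"
    if "0 \<le> lam" "lam \<le> Lam" for lam v t
  proof -
    have "continuous_on {0<..} (K lam v)"
      using K3[OF that] by (auto intro!: continuous_at_imp_continuous_on DERIV_isCont)
    then have "continuous_on UNIV (\<lambda>t. K lam v (exp t))"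
      by (rule continuous_on_compose2[OF _ continuous_on_exp[OF continuous_on_id]]) auto
    moreover have "continuous_on UNIV (\<lambda>t. om n b (exp t))"
      by (rule continuous_on_compose2[OF continuous_on_om(1)[OF n, of UNIV] continuous_on_exp[OF continuous_on_id]]) auto
    moreover have "om n b (exp t) \<noteq> 0" for t by (simp add: om_def)
    ultimately have "continuous_on UNIV (\<lambda>t. K lam v (exp t) / om n b (exp t))"
      by (intro continuous_on_divide) auto
    moreover have "norm (K lam v (exp t) / om n b (exp t)) \<le> ?q * norm v + lam * L * 2" for t
      using K2[OF that, of "exp t" v] om_pos[of "exp t" n b] by (simp add: pos_divide_le_eq)
    ultimately have "(\<lambda>t. K lam v (exp t) / om n b (exp t)) \<in> bcontfun"
      by (rule bcontfun_normI)
    then show ?thesis unfolding T_def by (simp add: Bcontfun_inverse)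
  qed
  have T_dist: "dist (T lam v) (T mu u) \<le> ?q * dist v u + \<bar>lam - mu\<bar> * L * (2 + norm u)"
    if "0 \<le> lam" "lam \<le> Lam" "0 \<le> mu" "mu \<le> Lam" for lam mu v u
  proof (rule dist_bound)
    fix t
    have "\<bar>K lam v (exp t) - K mu u (exp t)\<bar> / om n b (exp t) \<le> ?q * dist v u + \<bar>lam - mu\<bar> * L * (2 + norm u)"
      using K_diff[OF that, of "exp t" v u] om_pos[of "exp t" n b] by (simp add: pos_divide_le_eq)
    then show "dist (apply_bcontfun (T lam v) t) (apply_bcontfun (T mu u) t) \<le>
        ?q * dist v u + \<bar>lam - mu\<bar> * L * (2 + norm u)"
      using om_pos[of "exp t" n b] by (simp add: T that dist_real_def flip: diff_divide_distrib)
  qed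
  have "\<exists>!v. T lam v = v" if "0 \<le> lam" "lam \<le> Lam" for lam
    using T_dist[OF that that] q by (intro banach_fix_type[of ?q]) auto
  then obtain V where V: "\<And>lam. 0 \<le> lam \<Longrightarrow> lam \<le> Lam \<Longrightarrow> T lam (V lam) = V lam"
    and V_unique: "\<And>lam v. 0 \<le> lam \<Longrightarrow> lam \<le> Lam \<Longrightarrow> T lam v = v \<Longrightarrow> v = V lam"
    by metis
  have "apply_bcontfun (T 0 0) t = 0" for t
    by (simp add: T Lam K_def J_def J_int_def F0)
  then have V0: "V 0 = 0"
    using V_unique[of 0 0] Lam by (simp add: bcontfun_eqI)
  \<comment> \<open>From \<open>norm v\<close> <= q * \<open>norm v\<close> + 2 * lam * L, valid for
    a fixed point v by comparison with the fixed point 0 at lam = 0.\<close>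
  define B where "B = 2 * Lam * L / (1 - ?q)"
  have B: "norm (V lam) \<le> B" if "0 \<le> lam" "lam \<le> Lam" for lam
  proof -
    have "norm (V lam) \<le> ?q * norm (V lam) + lam * L * 2"
      using T_dist[of lam 0 "V lam" "V 0"] that Lam V[of 0] by (simp add: V V0)
    then have "norm (V lam) * (1 - ?q) \<le> lam * L * 2" by (simp add: algebra_simps)
    also have "\<dots> \<le> Lam * L * 2" using that L by (intro mult_right_mono) auto
    finally show ?thesis using q by (simp add: B_def field_simps)
  qed
  \<comment> \<open>C solves q * C + L * (2 + B) = C, the balance in the distance estimate between
    the fixed points for lam and mu.\<close>
  define C where "C = L * (2 + B) / (1 - ?q)"
  have B0: "0 \<le> B" using Lam L q by (simp add: B_def)
  have C0: "0 \<le> C" using B0 L q by (simp add: C_def)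
  have C: "?q * C + L * (2 + B) = C" using q by (simp add: C_def field_simps)
  have V_par: "?q * dist (V lam) (V mu) + \<bar>lam - mu\<bar> * L * (2 + norm (V mu)) \<le> C * \<bar>lam - mu\<bar>"
    if "0 \<le> lam" "lam \<le> Lam" "0 \<le> mu" "mu \<le> Lam" for lam mu
  proof -
    have *: "\<bar>lam - mu\<bar> * L * (2 + norm (V mu)) \<le> \<bar>lam - mu\<bar> * L * (2 + B)"
      using B that L by (intro mult_left_mono add_mono) auto
    have "dist (V lam) (V mu) \<le> ?q * dist (V lam) (V mu) + \<bar>lam - mu\<bar> * L * (2 + norm (V mu))"
      using T_dist[OF that, of "V lam" "V mu"] that by (simp add: V)
    with * have "dist (V lam) (V mu) * (1 - ?q) \<le> \<bar>lam - mu\<bar> * L * (2 + B)" by (simp add: algebra_simps)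
    then have "dist (V lam) (V mu) \<le> C * \<bar>lam - mu\<bar>" using q by (simp add: C_def field_simps)
    then have "?q * dist (V lam) (V mu) \<le> ?q * (C * \<bar>lam - mu\<bar>)" using q by (intro mult_left_mono) auto
    with * have "?q * dist (V lam) (V mu) + \<bar>lam - mu\<bar> * L * (2 + norm (V mu)) \<le> (?q * C + L * (2 + B)) * \<bar>lam - mu\<bar>"
      by (simp add: algebra_simps)
    then show ?thesis by (simp add: C)
  qed
  have KV: "K lam (V lam) (exp t) = om n b (exp t) * apply_bcontfun (V lam) t" if "0 \<le> lam" "lam \<le> Lam" for lam t
    using T[OF that, of "V lam" t] V[OF that] om_pos[of "exp t" n b] by (simp add: field_simps)
  define h where "h lam t = phit n t + om n b (exp t) * apply_bcontfun (V lam) t" for lam t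
  define y where "y lam t = real n * sin (phit n t) + J lam (V lam) (exp t)" for lam t
  have h_eq: "h lam t = phit n t + K lam (V lam) (exp t)" if "0 \<le> lam" "lam \<le> Lam" for lam t
    using KV[OF that] by (simp add: h_def)
  show ?thesis
  proof (rule that[OF C0 b(1), of h y])
    show "h 0 = phit n" by (auto simp: h_def V0)
    fix lam t :: real assume lam: "0 \<le> lam" "lam \<le> Lam"
    have "((\<lambda>t. phit n t + K lam (V lam) (exp t)) has_real_derivative
      real n * sin (phit n t) + J lam (V lam) (exp t) / exp t * exp t) (at t)"
      by (intro DERIV_add phit_has_derivative DERIV_chain2[OF K3[OF lam]] DERIV_exp) auto
    moreover have "h lam = (\<lambda>t. phit n t + K lam (V lam) (exp t))" using h_eq[OF lam] by auto
    ultimately show "(h lam has_real_derivative y lam t) (at t)" by (simp add: y_def)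
    have "((\<lambda>t. real n * sin (phit n t) + J lam (V lam) (exp t)) has_real_derivative
      real n * (cos (phit n t) * (real n * sin (phit n t))) + F lam (V lam) (exp t) / exp t * exp t) (at t)"
      by (intro DERIV_add DERIV_cmult DERIV_fun_sin phit_has_derivative DERIV_chain2[OF J3[OF lam]] DERIV_exp) auto
    moreover have "real n * (cos (phit n t) * (real n * sin (phit n t))) + F lam (V lam) (exp t) / exp t * exp t
      = (real n)\<^sup>2 * sin (h lam t) * cos (h lam t) + lam * exp (2 * t) * g (h lam t)"
    proof -
      have "F lam (V lam) (exp t) / exp t * exp t = F lam (V lam) (exp t)" by simp
      also have "\<dots> = (real n)\<^sup>2 / 2 * (sin (2 * h lam t) - sin (2 * phit n t)) + lam * exp (2 * t) * g (h lam t)"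
        by (simp add: F_def nonl_def h_def exp_double)
      finally show ?thesis unfolding sin_double by (simp add: algebra_simps power2_eq_square)
    qed
    ultimately show "(y lam has_real_derivative
          (real n)\<^sup>2 * sin (h lam t) * cos (h lam t) + lam * exp (2 * t) * g (h lam t)) (at t)"
      by (simp add: y_def[abs_def])
  next
    fix lam mu t :: real assume *: "0 \<le> lam" "lam \<le> Lam" "0 \<le> mu" "mu \<le> Lam"
    have "\<bar>h lam t - h mu t\<bar> \<le> (?q * dist (V lam) (V mu) + \<bar>lam - mu\<bar> * L * (2 + norm (V mu))) * om n b (exp t)"
      using K_diff[OF *, of "exp t"] h_eq * by simp
    also have "\<dots> \<le> C * \<bar>lam - mu\<bar> * om n b (exp t)"
      using om_pos[of "exp t" n b] by (intro mult_right_mono V_par *) auto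
    finally show "\<bar>h lam t - h mu t\<bar> \<le> C * \<bar>lam - mu\<bar> * om n b (exp t)" .
    have "\<bar>y lam t - y mu t\<bar> \<le> (?q * dist (V lam) (V mu) + \<bar>lam - mu\<bar> * L * (2 + norm (V mu))) * om1 n b (exp t)"
      using J_diff[OF *, of "exp t"] by (simp add: y_def)
    also have "\<dots> \<le> C * \<bar>lam - mu\<bar> * om1 n b (exp t)"
      using om_pos[of "exp t" n b] b by (intro mult_right_mono V_par *) (auto simp: om1_def)
    finally show "\<bar>y lam t - y mu t\<bar> \<le> C * \<bar>lam - mu\<bar> * om1 n b (exp t)" .
  qed
qed

section \<open>Orbits in logarithmic time\<close>

lemma nonneg_of_pos_left:
  fixes f :: "real \<Rightarrow> real"
  assumes "isCont f t" "\<And>s. s < t \<Longrightarrow> 0 < f s"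
  shows "0 \<le> f t"
proof (rule tendsto_lowerbound)
  show "(f \<longlongrightarrow> f t) (at_left t)"
    using assms(1) by (simp add: isCont_def filterlim_at_split)
  show "\<forall>\<^sub>F s in at_left t. 0 \<le> f s"
    using assms(2) by (auto simp: eventually_at_filter less_imp_le)
qed simp

lemma increasing_if_deriv_pos:
  fixes f f' :: "real \<Rightarrow> real"
  assumes "a < b" "\<And>s. (f has_real_derivative f' s) (at s)" "\<And>s. a < s \<Longrightarrow> s < b \<Longrightarrow> 0 < f' s"
  shows "f a < f b"
proof (rule DERIV_pos_imp_increasing_open[OF assms(1)])
  show "continuous_on {a..b} f"
    using DERIV_isCont[OF assms(2)] by (simp add: continuous_at_imp_continuous_on)
qed (use assms in blast)

lemma nondecreasing_if_deriv_nonneg: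
  fixes f f' :: "real \<Rightarrow> real"
  assumes "a \<le> b" "\<And>s. (f has_real_derivative f' s) (at s)" "\<And>s. a \<le> s \<Longrightarrow> s \<le> b \<Longrightarrow> 0 \<le> f' s"
  shows "f a \<le> f b"
  by (rule DERIV_nonneg_imp_nondecreasing[OF assms(1)]) (use assms in blast)

lemma nonincreasing_if_deriv_nonpos:
  fixes f f' :: "real \<Rightarrow> real"
  assumes "a \<le> b" "\<And>s. (f has_real_derivative f' s) (at s)" "\<And>s. a \<le> s \<Longrightarrow> s \<le> b \<Longrightarrow> f' s \<le> 0"
  shows "f b \<le> f a"
  by (rule DERIV_nonpos_imp_nonincreasing[OF assms(1)]) (use assms in blast)

lemma sin_ge_min:
  assumes "0 \<le> a" "a \<le> x" "x \<le> b" "b \<le> pi"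
  shows "min (sin a) (sin b) \<le> sin x"
proof (cases "x \<le> pi / 2")
  case True
  then have "sin a \<le> sin x" using assms by (intro sin_monotone_2pi_le) auto
  then show ?thesis by simp
next
  case False
  then have "sin (pi - b) \<le> sin (pi - x)" using assms by (intro sin_monotone_2pi_le) auto
  then show ?thesis by simp
qed

text \<open>Here g lives on the whole line: it will be the given function continued constantly
  outside [0, pi], so that an orbit can be followed past pi. \<open>G_quadratic\<close> is the form
  in which the positive derivative at pi is used.\<close>

locale profile =
  fixes k :: nat and g G :: "real \<Rightarrow> real" and xi L :: real
  assumes k_pos: "0 < k" and L_pos: "0 < L"
    and lip: "\<And>x y. \<bar>g x - g y\<bar> \<le> L * \<bar>x - y\<bar>"
    and g_zeros: "g 0 = 0" "g xi = 0" "g pi = 0"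
    and xi: "0 < xi" "xi < pi"
    and g_pos: "\<And>x. 0 < x \<Longrightarrow> x < xi \<Longrightarrow> 0 < g x"
    and g_neg: "\<And>x. xi < x \<Longrightarrow> x < pi \<Longrightarrow> g x < 0"
    and G_deriv: "\<And>x. 0 < x \<Longrightarrow> x < pi \<Longrightarrow> (G has_real_derivative g x) (at x)"
    and G_cont: "continuous_on {0..pi} G"
    and G_ends: "G pi = 0" "G 0 < 0"
    and G_quadratic: "\<exists>c>0. \<exists>x0<pi. \<forall>x. x0 \<le> x \<and> x < pi \<longrightarrow> (c * (pi - x))\<^sup>2 \<le> 2 * G x"
begin

lemma g_le: "\<bar>g x\<bar> \<le> L * \<bar>x\<bar>"
  using lip[of x 0] g_zeros by simp

lemma g_le_pi: "\<bar>g x\<bar> \<le> L * \<bar>pi - x\<bar>"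
  using lip[of x pi] g_zeros by (simp add: abs_minus_commute)

lemma G_mono:
  assumes "0 \<le> x" "x < x'" "x' \<le> xi"
  shows "G x < G x'"
proof (rule DERIV_pos_imp_increasing_open[OF assms(2)])
  show "continuous_on {x..x'} G" by (rule continuous_on_subset[OF G_cont]) (use assms xi in auto)
  show "\<exists>D. (G has_real_derivative D) (at u) \<and> 0 < D" if "x < u" "u < x'" for u
    using assms xi that by (intro exI[of _ "g u"] conjI G_deriv g_pos) auto
qed

lemma G_antimono:
  assumes "xi \<le> x" "x < x'" "x' \<le> pi"
  shows "G x' < G x"
proof (rule DERIV_neg_imp_decreasing_open[OF assms(2)])
  show "continuous_on {x..x'} G" by (rule continuous_on_subset[OF G_cont]) (use assms xi in auto)
  show "\<exists>D. (G has_real_derivative D) (at u) \<and> D < 0" if "x < u" "u < x'" for u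
    using assms xi that by (intro exI[of _ "g u"] conjI G_deriv g_neg) auto
qed

lemma G_nonneg: "xi \<le> x \<Longrightarrow> x \<le> pi \<Longrightarrow> 0 \<le> G x"
  using G_antimono[of x pi] G_ends by (cases "x = pi") auto

end

text \<open>The behaviour at -\<infinity> is prescribed without a rate, so that an arbitrary
  solution of the boundary value problem (with lam = 1) is an orbit, as are the members of the
  shooting family.\<close>

locale orbit = profile +
  fixes lam :: real and h y :: "real \<Rightarrow> real"
  assumes lam: "0 < lam"
    and h_deriv: "\<And>t. (h has_real_derivative y t) (at t)"
    and y_deriv: "\<And>t. (y has_real_derivative
          (real k)\<^sup>2 * sin (h t) * cos (h t) + lam * exp (2 * t) * g (h t)) (at t)"
    and h_at_bot: "(h \<longlongrightarrow> 0) at_bot"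
    and h_pos_at_bot: "\<forall>\<^sub>F t in at_bot. 0 < h t"
begin

text \<open>The defect in the first-order equation phi' = k sin phi that the lam = 0 profile
  satisfies.\<close>

definition w :: "real \<Rightarrow> real" where "w t = y t - k * sin (h t)"

definition E :: "real \<Rightarrow> real" where "E t = ((y t)\<^sup>2 - (k * sin (h t))\<^sup>2) / 2"

lemma E_eq: "E t = w t * (w t + 2 * k * sin (h t)) / 2"
  unfolding E_def w_def by (simp add: algebra_simps power2_eq_square)

lemma isCont_h [simp]: "isCont h t" and isCont_y [simp]: "isCont y t"
  by (rule DERIV_isCont[OF h_deriv], rule DERIV_isCont[OF y_deriv])

lemma isCont_w [simp]: "isCont w t" and isCont_E [simp]: "isCont E t"
  unfolding w_def[abs_def] E_def[abs_def] by (auto intro!: continuous_intros)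

lemma E_deriv: "(E has_real_derivative lam * exp (2 * t) * g (h t) * y t) (at t)"
proof -
  have "(E has_real_derivative
      (2 * y t * ((real k)\<^sup>2 * sin (h t) * cos (h t) + lam * exp (2 * t) * g (h t))
        - 2 * (k * sin (h t)) * (k * (cos (h t) * y t))) / 2) (at t)"
    unfolding E_def[abs_def]
    by (auto intro!: derivative_eq_intros h_deriv y_deriv simp: algebra_simps power2_eq_square)
  moreover have "(2 * y t * ((real k)\<^sup>2 * sin (h t) * cos (h t) + lam * exp (2 * t) * g (h t))
        - 2 * (k * sin (h t)) * (k * (cos (h t) * y t))) / 2 = lam * exp (2 * t) * g (h t) * y t"
    by (simp add: algebra_simps power2_eq_square)
  ultimately show ?thesis by simp
qed

lemma E_pos_if: "0 < w t \<Longrightarrow> 0 \<le> sin (h t) \<Longrightarrow> 0 < E t"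
  unfolding E_eq using k_pos by (intro divide_pos_pos mult_pos_pos add_pos_nonneg) auto

lemma w_pos_if: assumes "0 < E t" "0 \<le> y t" shows "0 < w t"
proof -
  have "(k * sin (h t))\<^sup>2 < (y t)\<^sup>2" using assms(1) by (simp add: E_def)
  then show ?thesis using assms(2) power_less_imp_less_base[of "k * sin (h t)" 2 "y t"] by (auto simp: w_def)
qed

lemma small_start: "\<exists>T. \<forall>t\<le>T. 0 < h t \<and> h t < xi \<and> h t < pi / 2"
proof -
  have "\<forall>\<^sub>F t in at_bot. h t < min xi (pi / 2)"
    by (rule order_tendstoD(2)[OF h_at_bot]) (use xi in auto)
  with h_pos_at_bot have "\<forall>\<^sub>F t in at_bot. 0 < h t \<and> h t < xi \<and> h t < pi / 2"
    by eventually_elim auto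
  then show ?thesis by (simp add: eventually_at_bot_linorder)
qed

lemma y_increasing_start:
  assumes T: "\<forall>t\<le>T. 0 < h t \<and> h t < xi \<and> h t < pi / 2" and st: "s < t" "t \<le> T"
  shows "y s < y t"
proof (rule increasing_if_deriv_pos[OF st(1) y_deriv])
  fix u assume "s < u" "u < t"
  then have "0 < h u" "h u < xi" "h u < pi / 2" using T st by auto
  then show "0 < (real k)\<^sup>2 * sin (h u) * cos (h u) + lam * exp (2 * u) * g (h u)"
    using k_pos lam g_pos sin_gt_zero[of "h u"] cos_gt_zero[of "h u"]
    by (intro add_pos_pos mult_pos_pos) auto
qed

text \<open>If y were nonpositive at t, it would be so at all earlier times, since y increases
  there. Then h would be nonincreasing on (-\<infinity>, t] and its limit at -\<infinity> would be
  at least h t > 0.\<close>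

lemma y_pos_start:
  assumes T: "\<forall>t\<le>T. 0 < h t \<and> h t < xi \<and> h t < pi / 2" and t: "t \<le> T"
  shows "0 < y t"
proof (rule ccontr)
  assume "\<not> 0 < y t"
  then have y: "y s \<le> 0" if "s \<le> t" for s
    using y_increasing_start[OF T _ t, of s] that by (cases "s = t") auto
  have "h t \<le> h s" if "s \<le> t" for s
    by (rule nonincreasing_if_deriv_nonpos[OF that h_deriv]) (use y in auto)
  then have "\<forall>\<^sub>F s in at_bot. h t \<le> h s"
    by (auto intro: eventually_at_bot_linorderI)
  then have "h t \<le> 0"
    by (intro tendsto_lowerbound[OF h_at_bot]) auto
  then show False using T t by force
qed

text \<open>Near -\<infinity> the velocity is positive and increasing, so it suffices that it takes
  arbitrarily small values; otherwise h would fall below 0 in finite backward time.\<close>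

lemma y_at_bot: "(y \<longlongrightarrow> 0) at_bot"
proof -
  obtain T where T: "\<forall>t\<le>T. 0 < h t \<and> h t < xi \<and> h t < pi / 2" using small_start by blast
  have "\<exists>t\<le>T. y t < e" if "0 < e" for e
  proof (rule ccontr)
    assume "\<not> (\<exists>t\<le>T. y t < e)"
    then have y: "e \<le> y t" if "t \<le> T" for t using that by force
    \<comment> \<open>The time at which the line of slope e through (T, h T) reaches 0.\<close>
    define t where "t = T - h T / e"
    have "0 < h T" using T by auto
    then have "t \<le> T" using that by (simp add: t_def)
    have "((\<lambda>s. h s - e * s) has_real_derivative y s - e) (at s)" for s
      by (auto intro!: derivative_eq_intros h_deriv)
    then have "h t - e * t \<le> h T - e * T"
      by (rule nondecreasing_if_deriv_nonneg[OF \<open>t \<le> T\<close>]) (use y in auto)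
    moreover have "e * T - e * t = h T" using that by (simp add: t_def field_simps)
    ultimately have "h t \<le> 0" by simp
    then show False using T \<open>t \<le> T\<close> by force
  qed
  then have "\<forall>\<^sub>F t in at_bot. \<bar>y t\<bar> < e" if e: "0 < e" for e
  proof -
    obtain t0 where t0: "t0 \<le> T" "y t0 < e" using \<open>\<And>e. 0 < e \<Longrightarrow> \<exists>t\<le>T. y t < e\<close> e by blast
    have "\<bar>y t\<bar> < e" if "t \<le> t0" for t
      using y_pos_start[OF T, of t] y_increasing_start[OF T, of t t0] t0 that by (cases "t = t0") auto
    then show ?thesis by (rule eventually_at_bot_linorderI)
  qed
  then show ?thesis by (auto simp: tendsto_iff dist_real_def)
qed

lemma E_at_bot: "(E \<longlongrightarrow> 0) at_bot"
proof -
  have "(E \<longlongrightarrow> (0\<^sup>2 - (k * sin 0)\<^sup>2) / 2) at_bot"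
    unfolding E_def[abs_def] by (intro tendsto_intros y_at_bot h_at_bot) auto
  then show ?thesis by simp
qed

lemma h_increasing:
  assumes "\<And>s. s < t \<Longrightarrow> 0 < y s" "s < s'" "s' \<le> t"
  shows "h s < h s'"
  using assms by (intro increasing_if_deriv_pos[OF _ h_deriv]) auto

lemma h_pos_if:
  assumes "\<And>s. s < t \<Longrightarrow> 0 < y s"
  shows "0 < h t"
proof -
  obtain T where T: "\<And>s. s \<le> T \<Longrightarrow> 0 < h s" using small_start by blast
  show ?thesis using T[of "min T (t - 1)"] h_increasing[of t "min T (t - 1)" t] assms by force
qed

text \<open>E starts from the limit 0 and increases because g (h) and y are positive. The limit
  alone gives 0 <= E (t - 1); the remaining unit of time makes the inequality strict.\<close>

lemma E_pos_below_xi: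
  assumes y: "\<And>s. s < t \<Longrightarrow> 0 < y s" and t: "h t \<le> xi"
  shows "0 < E t"
proof -
  have "0 < lam * exp (2 * s) * g (h s) * y s" if "s < t" for s
    using lam y[OF that] h_pos_if[of s] h_increasing[OF y that] t y that
    by (intro mult_pos_pos g_pos) force+
  then have inc: "E s < E s'" if "s < s'" "s' \<le> t" for s s'
    using that by (intro increasing_if_deriv_pos[OF _ E_deriv]) auto
  have "\<forall>\<^sub>F s in at_bot. E s \<le> E (t - 1)"
    using inc by (intro eventually_at_bot_linorderI[of "t - 2"]) (auto intro!: less_imp_le)
  then have "0 \<le> E (t - 1)" by (intro tendsto_upperbound[OF E_at_bot]) auto
  also have "\<dots> < E t" by (rule inc) auto
  finally show ?thesis .
qed

lemma w_pos_below_xi: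
  assumes y: "\<And>s. s < t \<Longrightarrow> 0 < y s" and t: "h t \<le> xi"
  shows "0 < w t"
  using w_pos_if[OF E_pos_below_xi[OF assms] nonneg_of_pos_left[OF isCont_y y]] .

text \<open>The constant \<open>pi\<close> also solves the equation, so an orbit can only reach it transversally.\<close>

lemma y_nonzero_at_pi:
  assumes t1: "h t1 = pi" and t: "t < t1" "h t \<noteq> pi"
  shows "y t1 \<noteq> 0"
proof
  assume y0: "y t1 = 0"
  \<comment> \<open>A backward Gronwall argument: M is chosen so that V' >= - M * V up to t1, whence
    V t1 = 0 forces V = 0 earlier. The summand 1 comes from the coupling term pi - h, the others
    from the two terms of the equation, which are Lipschitz and vanish at pi.\<close>
  define M where "M = 1 + (real k)\<^sup>2 + lam * exp (2 * t1) * L"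
  define V where "V s = (pi - h s)\<^sup>2 + (y s)\<^sup>2" for s
  define A where "A s = (real k)\<^sup>2 * sin (h s) * cos (h s) + lam * exp (2 * s) * g (h s)" for s
  have V': "((\<lambda>s. V s * exp (M * s)) has_real_derivative
     (2 * y s * (A s - (pi - h s)) + M * V s) * exp (M * s)) (at s)" for s
    unfolding V_def A_def
    by (auto intro!: derivative_eq_intros h_deriv y_deriv simp: algebra_simps power2_eq_square)
  have pos: "0 \<le> 2 * y s * (A s - (pi - h s)) + M * V s" if "s \<le> t1" for s
  proof -
    let ?d = "\<bar>pi - h s\<bar>"
    have "\<bar>sin (h s)\<bar> \<le> ?d" using abs_sin_x_le_abs_x[of "pi - h s"] by simp
    then have "\<bar>(real k)\<^sup>2 * sin (h s) * cos (h s)\<bar> \<le> (real k)\<^sup>2 * ?d * 1"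
      unfolding abs_mult by (intro mult_mono) auto
    moreover have "\<bar>lam * exp (2 * s) * g (h s)\<bar> \<le> lam * exp (2 * t1) * (L * ?d)"
      unfolding abs_mult using lam that g_le_pi by (intro mult_mono) auto
    ultimately have "\<bar>A s - (pi - h s)\<bar> \<le> M * ?d"
      unfolding A_def M_def by (simp add: algebra_simps)
    then have "\<bar>2 * y s * (A s - (pi - h s))\<bar> \<le> 2 * \<bar>y s\<bar> * (M * ?d)"
      unfolding abs_mult by (intro mult_mono) auto
    also have "\<dots> = M * (2 * \<bar>y s\<bar> * ?d)" by simp
    also have "\<dots> \<le> M * V s"
    proof (rule mult_left_mono)
      have "0 \<le> (\<bar>y s\<bar> - ?d)\<^sup>2" by simp
      then show "2 * \<bar>y s\<bar> * ?d \<le> V s" unfolding V_def using power2_diff[of "\<bar>y s\<bar>" ?d] by simp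
      show "0 \<le> M" using lam L_pos by (simp add: M_def)
    qed
    finally show ?thesis by linarith
  qed
  have "V t * exp (M * t) \<le> V t1 * exp (M * t1)"
    by (rule nondecreasing_if_deriv_nonneg[OF less_imp_le[OF t(1)] V']) (use pos in auto)
  also have "V t1 = 0" using t1 y0 by (simp add: V_def)
  finally have "V t \<le> 0" by (simp add: mult_le_0_iff)
  then have "pi - h t = 0" unfolding V_def by (smt (verit) zero_eq_power2 zero_le_power2)
  then show False using t by simp
qed

section \<open>The region of increasing motion and the exits from it\<close>

definition good :: "real \<Rightarrow> bool" where
  "good t \<longleftrightarrow> 0 < w t \<and> 0 < h t \<and> h t < pi"

lemma good_y: "good t \<Longrightarrow> 0 < y t"
  using sin_gt_zero[of "h t"] by (auto simp: good_def w_def intro!: order.strict_trans1[of 0 "k * sin (h t)"])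

lemma good_E: "good t \<Longrightarrow> 0 < E t"
  using sin_gt_zero[of "h t"] by (intro E_pos_if) (auto simp: good_def)

lemma good_start:
  assumes T: "\<forall>t\<le>T. 0 < h t \<and> h t < xi \<and> h t < pi / 2" and t: "t \<le> T"
  shows "good t"
proof -
  have "0 < w t" using T t y_pos_start[OF T] by (intro w_pos_below_xi) (auto simp: less_imp_le)
  then show ?thesis using T t xi by (auto simp: good_def)
qed

text \<open>The set of bad times is closed and bounded below, so it has a first element t1.
  Monotonicity up to t1 keeps h positive, uniqueness makes an arrival at pi transversal, and E > 0
  up to height xi keeps w from vanishing there.\<close>

lemma exit_cases:
  obtains (forever) "\<And>t. good t"
  | (exit) t1 where "\<And>s. s < t1 \<Longrightarrow> good s"
      "h t1 = pi \<and> 0 < y t1 \<or> xi < h t1 \<and> h t1 < pi \<and> w t1 = 0"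
proof (cases "\<exists>t. \<not> good t")
  case True
  define B where "B = {t. \<not> good t}"
  have B_eq: "B = {t. w t \<le> 0} \<union> {t. h t \<le> 0} \<union> {t. pi \<le> h t}"
    by (auto simp: B_def good_def)
  have ch: "continuous_on UNIV h" "continuous_on UNIV w" by (auto intro!: continuous_at_imp_continuous_on)
  have "closed B"
    unfolding B_eq by (intro closed_Un closed_Collect_le ch continuous_on_const)
  obtain T where T: "\<forall>t\<le>T. 0 < h t \<and> h t < xi \<and> h t < pi / 2" using small_start by blast
  have "bdd_below B"
    using good_start[OF T] by (intro bdd_belowI[of _ T]) (use le_cases in \<open>auto simp: B_def\<close>)
  define t1 where "t1 = Inf B"
  have "t1 \<in> B" unfolding t1_def using True \<open>bdd_below B\<close> \<open>closed B\<close>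
    by (intro closed_contains_Inf) (auto simp: B_def)
  have good: "good s" if "s < t1" for s
    using cInf_lower[of s B] \<open>bdd_below B\<close> that by (auto simp: t1_def B_def)
  then have y: "0 < y s" if "s < t1" for s using good_y that by blast
  have h0: "0 < h t1" by (rule h_pos_if[OF y])
  have "0 \<le> pi - h t1" by (rule nonneg_of_pos_left) (use good in \<open>auto simp: good_def\<close>)
  moreover have w0: "0 \<le> w t1" by (rule nonneg_of_pos_left) (use good in \<open>auto simp: good_def\<close>)
  ultimately consider "h t1 = pi" | "h t1 < pi" "w t1 = 0"
    using \<open>t1 \<in> B\<close> h0 by (force simp: B_def good_def)
  then have "h t1 = pi \<and> 0 < y t1 \<or> xi < h t1 \<and> h t1 < pi \<and> w t1 = 0"
  proof cases
    case 1
    have "y t1 \<noteq> 0" using 1 good[of "t1 - 1"] by (intro y_nonzero_at_pi[of _ "t1 - 1"]) (auto simp: good_def)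
    then show ?thesis using 1 w0 by (auto simp: w_def)
  next
    case 2
    have "xi < h t1" using w_pos_below_xi[OF y, of t1] 2 by force
    then show ?thesis using 2 by auto
  qed
  then show ?thesis using exit[OF good] by blast
qed (use forever in auto)

section \<open>Orbits that stay in the region for all time\<close>

context
  assumes forever: "\<And>t. good t"
begin

lemma forever_h_mono: "s < t \<Longrightarrow> h s < h t"
  using h_increasing[of t s t] good_y forever by auto

text \<open>If h stayed below some a < pi, then y >= k sin h would be bounded below by a positive
  constant for t >= 0, and h would grow linearly.\<close>

lemma forever_h_tendsto: "(h \<longlongrightarrow> pi) at_top"
proof (rule order_tendstoI)
  fix a :: real assume a: "a < pi"
  have "\<exists>t. a < h t"
  proof (rule ccontr)
    assume "\<nexists>t. a < h t"
    then have le: "h t \<le> a" for t by (meson not_le)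
    define c where "c = min (sin (h 0)) (sin a)"
    have h0: "0 < h 0" "h 0 < pi" "h 0 \<le> a" using forever[of 0] le[of 0] by (auto simp: good_def)
    then have "0 < c" using a by (auto simp: c_def intro!: sin_gt_zero)
    have y: "k * c \<le> y t" if "0 \<le> t" for t
    proof -
      have "h 0 \<le> h t" using forever_h_mono[of 0 t] that by (cases "t = 0") auto
      then have "c \<le> sin (h t)" unfolding c_def using h0 a le by (intro sin_ge_min) auto
      then have "k * c \<le> k * sin (h t)" by (simp add: mult_left_mono)
      also have "\<dots> \<le> y t" using forever[of t] by (simp add: good_def w_def)
      finally show ?thesis .
    qed
    \<comment> \<open>By this time a motion of speed k * c has covered the distance a; since h
      starts from h 0 > 0, it has passed a.\<close>
    define t where "t = a / (k * c)"
    have "0 \<le> t" using h0 \<open>0 < c\<close> k_pos by (simp add: t_def)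
    have "((\<lambda>s. h s - k * c * s) has_real_derivative y s - k * c) (at s)" for s
      by (auto intro!: derivative_eq_intros h_deriv)
    then have "h 0 - k * c * 0 \<le> h t - k * c * t"
      by (rule nondecreasing_if_deriv_nonneg[OF \<open>0 \<le> t\<close>]) (use y in auto)
    moreover have "k * c * t = a" using \<open>0 < c\<close> k_pos by (simp add: t_def)
    ultimately show False using h0 le[of t] by linarith
  qed
  then obtain t0 where "a < h t0" by blast
  then have "a < h t" if "t0 \<le> t" for t
    using forever_h_mono[of t0 t] that by (cases "t0 = t") auto
  then show "\<forall>\<^sub>F t in at_top. a < h t" by (rule eventually_at_top_linorderI)
next
  fix a :: real assume "pi < a"
  then show "\<forall>\<^sub>F t in at_top. h t < a"
    using forever less_trans[OF _ \<open>pi < a\<close>] unfolding good_def by (intro always_eventually) blast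
qed

text \<open>Freeze the factor exp (2 s) at s = t. Above xi one has g <= 0, so \<Phi> is
  nonincreasing after t; it is bounded below by - lam * exp (2 t) * G (h s), which tends to 0
  because h tends to pi and G pi = 0.\<close>

lemma forever_E_ge:
  assumes t: "xi \<le> h t"
  shows "lam * exp (2 * t) * G (h t) \<le> E t"
proof -
  define \<Phi> where "\<Phi> s = E s - lam * exp (2 * t) * G (h s)" for s
  have \<Phi>: "(\<Phi> has_real_derivative lam * (exp (2 * s) - exp (2 * t)) * (g (h s) * y s)) (at s)" for s
  proof -
    have "((\<lambda>s. G (h s)) has_real_derivative g (h s) * y s) (at s)"
      using forever by (intro DERIV_chain2[OF G_deriv] h_deriv) (auto simp: good_def)
    from DERIV_diff[OF E_deriv DERIV_cmult[OF this, of "lam * exp (2 * t)"]] show ?thesis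
      by (simp add: \<Phi>_def[abs_def] algebra_simps)
  qed
  have dec: "\<Phi> s \<le> \<Phi> t" if "t \<le> s" for s
  proof (rule nonincreasing_if_deriv_nonpos[OF that \<Phi>])
    fix u assume u: "t \<le> u" "u \<le> s"
    have "xi \<le> h u" using forever_h_mono[of t u] u t by (cases "t = u") auto
    then have "g (h u) \<le> 0" using g_neg[of "h u"] g_zeros forever[of u] by (cases "h u = xi") (auto simp: good_def)
    then have "g (h u) * y u \<le> 0" using good_y[OF forever[of u]] by (simp add: mult_nonpos_nonneg)
    then show "lam * (exp (2 * u) - exp (2 * t)) * (g (h u) * y u) \<le> 0"
      using lam u by (intro mult_nonneg_nonpos[of "lam * (exp (2 * u) - exp (2 * t))"]) auto
  qed
  have "- (lam * exp (2 * t) * G (h s)) \<le> \<Phi> t" if "t \<le> s" for s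
    using dec[OF that] good_E[OF forever[of s]] by (simp add: \<Phi>_def)
  then have "\<forall>\<^sub>F s in at_top. - (lam * exp (2 * t) * G (h s)) \<le> \<Phi> t"
    by (rule eventually_at_top_linorderI)
  moreover have "((\<lambda>s. G (h s)) \<longlongrightarrow> G pi) at_top"
    by (rule continuous_on_tendsto_compose[OF G_cont forever_h_tendsto])
      (use forever in \<open>auto simp: good_def intro!: always_eventually less_imp_le\<close>)
  then have "((\<lambda>s. - (lam * exp (2 * t) * G (h s))) \<longlongrightarrow> - (lam * exp (2 * t) * G pi)) at_top"
    by (intro tendsto_intros)
  ultimately have "- (lam * exp (2 * t) * G pi) \<le> \<Phi> t"
    by (intro tendsto_upperbound) auto
  then show ?thesis using G_ends by (simp add: \<Phi>_def)
qed

text \<open>Since E is at most half of y^2, the lower bound on E and the quadratic bound on G give y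
  >= c * sqrt lam * exp t * (pi - h). In the variable r = exp t this is a linear differential
  inequality with constant coefficient, hence a decay exponential in r.\<close>

lemma forever_exponential:
  "\<exists>C>0. \<exists>c>0. \<forall>\<^sub>F t in at_top. pi - h t \<le> C * exp (- c * (sqrt lam * exp t))"
proof -
  obtain c x0 where c: "0 < c" "x0 < pi" and quad: "\<And>x. x0 \<le> x \<Longrightarrow> x < pi \<Longrightarrow> (c * (pi - x))\<^sup>2 \<le> 2 * G x"
    using G_quadratic by blast
  have "\<forall>\<^sub>F t in at_top. max x0 xi < h t"
    by (rule order_tendstoD(1)[OF forever_h_tendsto]) (use c xi in auto)
  then obtain T where T: "\<And>t. T \<le> t \<Longrightarrow> max x0 xi < h t"
    by (auto simp: eventually_at_top_linorder)
  let ?s = "sqrt lam"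
  have y: "c * (?s * exp t) * (pi - h t) \<le> y t" if "T \<le> t" for t
  proof (rule power2_le_imp_le)
    have "(c * (?s * exp t) * (pi - h t))\<^sup>2 = lam * exp (2 * t) * (c * (pi - h t))\<^sup>2"
      using lam by (simp add: power_mult_distrib exp_double)
    also have "\<dots> \<le> lam * exp (2 * t) * (2 * G (h t))"
      using lam quad[of "h t"] T[OF that] forever[of t] by (intro mult_left_mono) (auto simp: good_def)
    also have "\<dots> \<le> 2 * E t" using forever_E_ge[of t] T[OF that] by simp
    also have "\<dots> \<le> (y t)\<^sup>2" by (simp add: E_def)
    finally show "(c * (?s * exp t) * (pi - h t))\<^sup>2 \<le> (y t)\<^sup>2" .
    show "0 \<le> y t" using good_y[OF forever[of t]] by simp
  qed
  define D where "D t = (pi - h t) * exp (c * (?s * exp t))" for t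
  have D: "(D has_real_derivative exp (c * (?s * exp t)) * (c * (?s * exp t) * (pi - h t) - y t)) (at t)" for t
    unfolding D_def[abs_def] by (auto intro!: derivative_eq_intros h_deriv simp: algebra_simps)
  have dec: "D t \<le> D T" if "T \<le> t" for t
  proof (rule nonincreasing_if_deriv_nonpos[OF that D])
    fix u assume "T \<le> u" "u \<le> t"
    then show "exp (c * (?s * exp u)) * (c * (?s * exp u) * (pi - h u) - y u) \<le> 0"
      using y[of u] by (intro mult_nonneg_nonpos) auto
  qed
  have "pi - h t \<le> D T * exp (- c * (?s * exp t))" if "T \<le> t" for t
    using mult_right_mono[OF dec[OF that], of "exp (- c * (?s * exp t))"]
    by (simp add: D_def mult.assoc flip: exp_add)
  moreover have "0 < D T" using forever[of T] by (auto simp: D_def good_def)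
  ultimately show ?thesis using c(1)
    by (intro exI[of _ "D T"] conjI exI[of _ c]) (auto intro: eventually_at_top_linorderI)
qed

end

end

section \<open>The Pohozaev identity\<close>

lemma zero_if_deriv_zero_at_bot:
  fixes f :: "real \<Rightarrow> real"
  assumes "\<And>s. s < T \<Longrightarrow> (f has_real_derivative 0) (at s)" "(f \<longlongrightarrow> 0) at_bot" "t < T"
  shows "f t = 0"
proof -
  obtain c where c: "\<And>s. s < T \<Longrightarrow> f s = c"
    using has_field_derivative_zero_constant[of "{..<T}" f] assms(1)
    by (auto intro: has_field_derivative_at_within)
  have "\<forall>\<^sub>F s in at_bot. f s = c"
    using c assms(3) by (intro eventually_at_bot_linorderI[of t]) auto
  then have "(f \<longlongrightarrow> c) at_bot" by (simp add: tendsto_eventually)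
  then have "c = 0" using assms(2) tendsto_unique[of at_bot f c 0] by simp
  then show ?thesis using c assms(3) by simp
qed

section \<open>Weighted integrals of the potential along a curve\<close>

context profile
begin

text \<open>Integrating over r instead of t makes the interval compact; at r = 0 the factor r
  annihilates the conventional value of \<open>ln 0\<close>.\<close>

definition IG :: "(real \<Rightarrow> real) \<Rightarrow> real \<Rightarrow> real" where
  "IG u t = integral {0..exp t} (\<lambda>r. 2 * r * G (u (ln r)))"

lemma G_bounded: obtains M where "0 < M" "\<And>x. 0 \<le> x \<Longrightarrow> x \<le> pi \<Longrightarrow> \<bar>G x\<bar> \<le> M"
proof -
  have "bounded (G ` {0..pi})" by (intro compact_imp_bounded compact_continuous_image G_cont) simp
  then obtain M where "0 < M" "\<And>x. x \<in> G ` {0..pi} \<Longrightarrow> norm x \<le> M" by (auto simp: bounded_pos)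
  then show ?thesis using that by force
qed

text \<open>Replacing t by \<open>min t T\<close> keeps the argument of G in (0, pi) everywhere. The
  truncated integrand is dominated by 2 r M, which gives continuity at r = 0 whatever u does at
  -\<infinity>.\<close>

lemma IG_integrand_continuous:
  assumes u: "continuous_on UNIV u" "\<And>t. t \<le> T \<Longrightarrow> 0 < u t \<and> u t < pi"
  shows "continuous_on {0..exp T} (\<lambda>r. 2 * r * G (u (ln r)))"
proof -
  obtain M where M: "0 < M" "\<And>x. 0 \<le> x \<Longrightarrow> x \<le> pi \<Longrightarrow> \<bar>G x\<bar> \<le> M" using G_bounded by blast
  have *: "0 < u (min t T) \<and> u (min t T) < pi" for t using u(2)[of "min t T"] by simp
  have "continuous_on {0<..} (\<lambda>r. u (min (ln r) T))"
    by (intro continuous_on_compose2[OF u(1)] continuous_intros) auto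
  then have "continuous_on {0<..} (\<lambda>r. G (u (min (ln r) T)))"
    by (rule continuous_on_compose2[OF G_cont]) (use less_imp_le[OF conjunct1[OF *]] less_imp_le[OF conjunct2[OF *]] in auto)
  then have 1: "continuous_on {0<..} (\<lambda>r. 2 * r * G (u (min (ln r) T)))"
    by (intro continuous_intros)
  have 2: "\<bar>2 * r * G (u (min (ln r) T))\<bar> \<le> 2 * r * M" if "0 \<le> r" for r
    unfolding abs_mult using that M(2)[of "u (min (ln r) T)"] *[of "ln r"] by (intro mult_mono) auto
  have 3: "continuous_on {0..} (\<lambda>r. 2 * r * M)" by (intro continuous_intros)
  have "continuous_on {0..} (\<lambda>r. 2 * r * G (u (min (ln r) T)))"
    by (rule continuous_on_atLeast_0_if_dominated[OF 1 3 _ 2]) simp_all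
  then have "continuous_on {0..exp T} (\<lambda>r. 2 * r * G (u (min (ln r) T)))"
    by (rule continuous_on_subset) auto
  then show ?thesis
  proof (rule iffD1[OF continuous_on_cong, rotated 2])
    fix r assume r: "r \<in> {0..exp T}"
    show "2 * r * G (u (min (ln r) T)) = 2 * r * G (u (ln r))"
    proof (cases "r = 0")
      case False
      then have "exp (ln r) \<le> exp T" using r by simp
      then have "ln r \<le> T" by (simp only: exp_le_cancel_iff)
      then show ?thesis by simp
    qed simp
  qed simp
qed

lemma IG_deriv:
  assumes u: "continuous_on UNIV u" "\<And>t. t \<le> T \<Longrightarrow> 0 < u t \<and> u t < pi" and t: "t < T"
  shows "(IG u has_real_derivative 2 * exp (2 * t) * G (u t)) (at t)"
proof -
  have "((\<lambda>r. integral {0..r} (\<lambda>r. 2 * r * G (u (ln r)))) has_real_derivative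
      2 * exp t * G (u (ln (exp t)))) (at (exp t) within {0..exp T})"
    using t by (intro integral_has_real_derivative IG_integrand_continuous u) auto
  moreover have "at (exp t) within {0..exp T} = at (exp t)"
    using t by (intro at_within_Icc_at) auto
  ultimately have "((\<lambda>r. integral {0..r} (\<lambda>r. 2 * r * G (u (ln r)))) has_real_derivative
      2 * exp t * G (u t)) (at (exp t))" by simp
  from DERIV_chain2[OF this DERIV_exp]
  have "(IG u has_real_derivative 2 * exp t * G (u t) * exp t) (at t)" by (simp add: IG_def[abs_def])
  moreover have "2 * exp t * G (u t) * exp t = 2 * exp (2 * t) * G (u t)"
    unfolding exp_double by (simp add: power2_eq_square)
  ultimately show ?thesis by metis
qed

lemma IG_at_bot:
  assumes u: "continuous_on UNIV u" "\<And>t. t \<le> T \<Longrightarrow> 0 < u t \<and> u t < pi"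
  shows "(IG u \<longlongrightarrow> 0) at_bot"
proof -
  obtain M where M: "0 < M" "\<And>x. 0 \<le> x \<Longrightarrow> x \<le> pi \<Longrightarrow> \<bar>G x\<bar> \<le> M" using G_bounded by blast
  have le: "\<bar>IG u t\<bar> \<le> M * (exp t)\<^sup>2" if t: "t \<le> T" for t
    unfolding IG_def
  proof (rule abs_integral_le_antiderivative[where u="\<lambda>r. 2 * r * M" and X="\<lambda>r. M * r\<^sup>2"])
    show "continuous_on {0..exp t} (\<lambda>r. 2 * r * G (u (ln r)))"
      using u t by (intro IG_integrand_continuous) auto
    fix r :: real assume r: "0 \<le> r" "r \<le> exp t"
    show "((\<lambda>r. M * r\<^sup>2) has_real_derivative 2 * r * M) (at r)"
      by (auto intro!: derivative_eq_intros)
    show "\<bar>2 * r * G (u (ln r))\<bar> \<le> 2 * r * M"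
    proof (cases "r = 0")
      case False
      then have "ln r \<le> ln (exp t)" using r by (subst ln_le_cancel_iff) auto
      then have "0 < u (ln r) \<and> u (ln r) < pi" using u(2)[of "ln r"] t by simp
      then show ?thesis unfolding abs_mult using r M(2)[of "u (ln r)"] by (intro mult_mono) auto
    qed simp
  qed auto
  have "((\<lambda>t. M * (exp t)\<^sup>2) \<longlongrightarrow> M * 0\<^sup>2) at_bot"
    by (intro tendsto_intros exp_at_bot)
  then have "((\<lambda>t. M * (exp t)\<^sup>2) \<longlongrightarrow> 0) at_bot" by simp
  then show ?thesis
    by (rule Lim_null_comparison[rotated]) (use le in \<open>auto intro: eventually_at_bot_linorderI\<close>)
qed

lemma isCont_phit: "isCont (phit k) t"
  by (rule DERIV_isCont[OF phit_has_derivative])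

lemma phit_continuous: "continuous_on UNIV (phit k)"
  using isCont_phit by (simp add: continuous_at_imp_continuous_on)

lemma phit_mono: "s < t \<Longrightarrow> phit k s < phit k t"
  using k_pos by (simp add: phit_def arctan_monotone)

lemma phit_surj:
  assumes "0 < x" "x < pi"
  shows "phit k (ln (tan (x / 2)) / k) = x"
proof -
  have "0 < tan (x / 2)" using assms by (intro tan_gt_zero) auto
  then show ?thesis using assms k_pos by (simp add: phit_def arctan_tan)
qed

text \<open>The function \<open>ln (tan (x / 2))\<close> is a primitive of 1 / sin x, so this
  substitution turns phi' = k sin phi into motion at the constant speed k.\<close>

lemma ln_tan_deriv:
  assumes "(h has_real_derivative y) (at t)" "0 < h t" "h t < pi"
  shows "((\<lambda>t. ln (tan (h t / 2))) has_real_derivative y / sin (h t)) (at t)"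
proof -
  have *: "0 < tan (h t / 2)" "0 < cos (h t / 2)" "0 < sin (h t / 2)"
    using assms by (auto intro: tan_gt_zero cos_gt_zero sin_gt_zero)
  have "((\<lambda>t. ln (tan (h t / 2))) has_real_derivative
    inverse (tan (h t / 2)) * (inverse ((cos (h t / 2))\<^sup>2) * (y / 2))) (at t)"
    using * by (intro DERIV_chain2[OF DERIV_ln] DERIV_chain2[OF DERIV_tan] DERIV_cdivide assms(1)) auto
  moreover have "inverse (tan (h t / 2)) * (inverse ((cos (h t / 2))\<^sup>2) * (y / 2)) = y / sin (2 * (h t / 2))"
    unfolding sin_double using * by (simp add: tan_def power2_eq_square field_simps)
  ultimately show ?thesis by simp
qed

end

section \<open>The identity along orbits and the necessity of the integral condition\<close>

context orbit
begin

lemma h_continuous: "continuous_on UNIV h"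
  by (simp add: continuous_at_imp_continuous_on)

text \<open>The difference of the two sides has derivative 0 and tends to 0 at -\<infinity>. As it
  rests on 0 < h < pi up to T alone, the identity can be used to determine the sign of w.\<close>

lemma pohozaev:
  assumes T: "\<And>s. s \<le> T \<Longrightarrow> 0 < h s \<and> h s < pi" and t: "t < T"
  shows "E t = lam * (exp (2 * t) * G (h t) - IG h t)"
proof -
  obtain M where M: "0 < M" "\<And>x. 0 \<le> x \<Longrightarrow> x \<le> pi \<Longrightarrow> \<bar>G x\<bar> \<le> M" using G_bounded by blast
  define f where "f t = E t - lam * (exp (2 * t) * G (h t) - IG h t)" for t
  have "(f has_real_derivative 0) (at s)" if s: "s < T" for s
  proof -
    have "((\<lambda>s. G (h s)) has_real_derivative g (h s) * y s) (at s)"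
      using T[of s] s by (intro DERIV_chain2[OF G_deriv] h_deriv) auto
    then show ?thesis
      unfolding f_def[abs_def]
      by (auto intro!: derivative_eq_intros E_deriv IG_deriv[OF h_continuous T s] simp: algebra_simps)
  qed
  moreover have "(f \<longlongrightarrow> 0) at_bot"
  proof -
    have "((\<lambda>t. exp (2 * t) * G (h t)) \<longlongrightarrow> 0) at_bot"
    proof (rule Lim_null_comparison)
      have "\<bar>exp (2 * t) * G (h t)\<bar> \<le> M * (exp t)\<^sup>2" if "t \<le> T" for t
        unfolding exp_double abs_mult using M(2)[of "h t"] T[OF that]
        by (subst mult.commute) (auto intro: mult_right_mono)
      then show "\<forall>\<^sub>F t in at_bot. norm (exp (2 * t) * G (h t)) \<le> M * (exp t)\<^sup>2"
        by (auto intro: eventually_at_bot_linorderI)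
      have "((\<lambda>t. M * (exp t)\<^sup>2) \<longlongrightarrow> M * 0\<^sup>2) at_bot"
        by (intro tendsto_intros exp_at_bot)
      then show "((\<lambda>t. M * (exp t)\<^sup>2) \<longlongrightarrow> 0) at_bot" by simp
    qed
    then have "(f \<longlongrightarrow> 0 - lam * (0 - 0)) at_bot"
      unfolding f_def[abs_def] by (intro tendsto_intros E_at_bot IG_at_bot[OF h_continuous T])
    then show ?thesis by simp
  qed
  ultimately have "f t = 0" using t by (rule zero_if_deriv_zero_at_bot)
  then show ?thesis by (simp add: f_def)
qed

text \<open>This treats a finite and an infinite first zero of w alike. At a finite zero E vanishes
  by its factorisation; if there is none, E >= e would give y >= sqrt (2 e) forever and drive h past
  pi.\<close>

lemma E_small_before_exit:
  assumes lt_pi: "\<And>t. h t < pi" and h_pi: "(h \<longlongrightarrow> pi) at_top"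
  obtains t0 where "h t0 = xi" "good t0"
    and "\<And>e. 0 < e \<Longrightarrow> \<exists>t>t0. (\<forall>s\<le>t. good s) \<and> E t < e"
proof (cases rule: exit_cases)
  case forever
  have "\<forall>\<^sub>F t in at_top. xi < h t" using order_tendstoD(1)[OF h_pi] xi by simp
  then obtain t2 where t2: "xi < h t2" by (auto simp: eventually_at_top_linorder)
  obtain T where T: "\<forall>t\<le>T. 0 < h t \<and> h t < xi \<and> h t < pi / 2" using small_start by blast
  have "T < t2" using T t2 by (meson not_le order.asym)
  then obtain t0 where t0: "h t0 = xi"
    using IVT[of h T xi t2] T t2 by (auto simp: less_imp_le)
  show ?thesis
  proof (rule that[OF t0 forever])
    fix e :: real assume e: "0 < e"
    show "\<exists>t>t0. (\<forall>s\<le>t. good s) \<and> E t < e"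
    proof (rule ccontr)
      assume "\<not> ?thesis"
      then have E: "e \<le> E t" if "t0 < t" for t using that forever by (meson not_le)
      have y: "sqrt (2 * e) \<le> y t" if "t0 < t" for t
      proof (rule power2_le_imp_le)
        have "2 * e \<le> 2 * E t" using E[OF that] by simp
        also have "\<dots> \<le> (y t)\<^sup>2" by (simp add: E_def)
        finally show "(sqrt (2 * e))\<^sup>2 \<le> (y t)\<^sup>2" using e by simp
        show "0 \<le> y t" using good_y[OF forever[of t]] by simp
      qed
      define s where "s = t0 + 1" define t where "t = s + pi / sqrt (2 * e)"
      have "s \<le> t" using e by (simp add: t_def)
      have "((\<lambda>t. h t - sqrt (2 * e) * t) has_real_derivative y t - sqrt (2 * e)) (at t)" for t
        by (auto intro!: derivative_eq_intros h_deriv)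
      then have "h s - sqrt (2 * e) * s \<le> h t - sqrt (2 * e) * t"
        by (rule nondecreasing_if_deriv_nonneg[OF \<open>s \<le> t\<close>]) (use y in \<open>auto simp: s_def\<close>)
      moreover have "sqrt (2 * e) * t = sqrt (2 * e) * s + pi" using e by (simp add: t_def algebra_simps)
      ultimately show False using lt_pi[of t] forever[of s] by (simp add: good_def)
    qed
  qed
next
  case (exit t1)
  then have t1: "xi < h t1" "w t1 = 0" using lt_pi[of t1] by auto
  obtain T where T: "\<forall>t\<le>T. 0 < h t \<and> h t < xi \<and> h t < pi / 2" using small_start by blast
  have "T < t1" using T t1 by (meson not_le order.asym)
  then obtain t0 where t0: "T \<le> t0" "t0 \<le> t1" "h t0 = xi"
    using IVT[of h T xi t1] T t1 by (auto simp: less_imp_le)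
  then have "t0 < t1" using t1 by (cases "t0 = t1") auto
  show ?thesis
  proof (rule that[OF t0(3) exit(1)[OF \<open>t0 < t1\<close>]])
    fix e :: real assume e: "0 < e"
    have "(E \<longlongrightarrow> E t1) (at_left t1)"
      using isCont_E[of t1] by (simp add: isCont_def filterlim_at_split)
    then have "\<forall>\<^sub>F t in at_left t1. E t < e"
      by (rule order_tendstoD(2)) (use e t1 in \<open>simp add: E_eq\<close>)
    moreover have "\<forall>\<^sub>F t in at_left t1. t0 < t \<and> t < t1"
      using \<open>t0 < t1\<close> by (auto simp: eventually_at_left)
    ultimately have "\<forall>\<^sub>F t in at_left t1. E t < e \<and> t0 < t \<and> t < t1" by eventually_elim auto
    then obtain t where "E t < e" "t0 < t" "t < t1"
      using eventually_happens'[of "at_left t1"] by (force simp: trivial_limit_at_left_real)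
    then show "\<exists>t>t0. (\<forall>s\<le>t. good s) \<and> E t < e" using exit(1) by (intro exI[of _ t]) auto
  qed
qed

text \<open>The integral of G along h, subtracted from that along the translated profile, leaves a
  positive amount that does not shrink with time. The Pohozaev identity bounds - lam *
  \<open>IG h t\<close> by E t, and E t can be made smaller than lam times that amount.\<close>

lemma necessity:
  assumes lt_pi: "\<And>t. h t < pi" and h_pi: "(h \<longlongrightarrow> pi) at_top"
  obtains t where "xi < phit k t" "0 < IG (phit k) t"
proof -
  obtain t0 where t0: "h t0 = xi" "good t0"
    and small: "\<And>e. 0 < e \<Longrightarrow> \<exists>t>t0. (\<forall>s\<le>t. good s) \<and> E t < e"
    using E_small_before_exit[OF assms] by blast
  \<comment> \<open>The crossing is placed at xi, the maximum point of G. The translated profile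
    then lies between h and xi both before and after t0, so G is larger on it.\<close>
  define a where "a = ln (tan (xi / 2)) / k - t0"
  have a: "phit k (t0 + a) = xi" using phit_surj[OF xi] by (simp add: a_def)
  define X where "X t = ln (tan (h t / 2)) - k * (t + a)" for t
  have X0: "X t0 = 0" using t0 k_pos by (simp add: X_def a_def)
  have X: "(X has_real_derivative w t / sin (h t)) (at t)" "0 < w t / sin (h t)" if "good t" for t
  proof -
    have *: "0 < h t" "h t < pi" "0 < w t" "0 < sin (h t)" using that by (auto simp: good_def intro: sin_gt_zero)
    then show "0 < w t / sin (h t)" by simp
    have "(X has_real_derivative y t / sin (h t) - k * 1) (at t)"
      unfolding X_def[abs_def]
      by (intro DERIV_diff ln_tan_deriv h_deriv DERIV_cmult) (use * in \<open>auto intro!: derivative_eq_intros\<close>)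
    moreover have "y t / sin (h t) - k * 1 = w t / sin (h t)" using * by (simp add: w_def diff_divide_distrib)
    ultimately show "(X has_real_derivative w t / sin (h t)) (at t)" by simp
  qed
  have X_mono: "X s < X s'" if "s < s'" "\<And>u. u \<le> s' \<Longrightarrow> good u" for s s'
    using X that by (intro DERIV_pos_imp_increasing[OF that(1)]) blast
  have h_X: "h t = phit k (t + a + X t / k)" if "good t" for t
  proof -
    have "h t = phit k (ln (tan (h t / 2)) / k)" using phit_surj[of "h t"] that by (simp add: good_def)
    moreover have "ln (tan (h t / 2)) / k = t + a + X t / k" using k_pos by (simp add: X_def field_simps)
    ultimately show ?thesis by simp
  qed
  have cmp1: "G (h s) < G (phit k (s + a))" if "s < t0" "\<And>u. u \<le> t0 \<Longrightarrow> good u" for s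
  proof -
    have "good s" using that by simp
    have "X s < 0" using X_mono[OF that(1)] that(2) X0 by simp
    then have "X s / k < 0" using k_pos by (simp add: divide_neg_pos)
    then have "h s < phit k (s + a)" using h_X[OF \<open>good s\<close>] phit_mono[of "s + a + X s / k" "s + a"] by simp
    moreover have "phit k (s + a) < xi" using phit_mono[of "s + a" "t0 + a"] that a by simp
    ultimately show ?thesis using \<open>good s\<close> by (intro G_mono) (auto simp: good_def)
  qed
  have cmp2: "G (h s) < G (phit k (s + a))" if "t0 < s" "\<And>u. u \<le> s \<Longrightarrow> good u" for s
  proof -
    have "good s" using that by simp
    have "0 < X s" using X_mono[OF that(1)] that(2) X0 by simp
    then have "0 < X s / k" using k_pos by simp
    then have "phit k (s + a) < h s" using h_X[OF \<open>good s\<close>] phit_mono[of "s + a" "s + a + X s / k"] by simp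
    moreover have "xi < phit k (s + a)" using phit_mono[of "t0 + a" "s + a"] that a by simp
    ultimately show ?thesis using \<open>good s\<close> by (intro G_antimono) (auto simp: good_def)
  qed
  \<comment> \<open>The factor exp (- 2 a) undoes the translation: both integrands of D carry the
    same weight 2 * exp (2 t).\<close>
  define D where "D t = exp (- 2 * a) * IG (phit k) (t + a) - IG h t" for t
  obtain T where T: "t0 < T" "\<And>s. s \<le> T \<Longrightarrow> good s" using small[of 1] by auto
  have D: "(D has_real_derivative 2 * exp (2 * t) * (G (phit k (t + a)) - G (h t))) (at t)"
    if "t < T'" "\<And>s. s \<le> T' \<Longrightarrow> good s" for t T'
  proof -
    have 1: "(IG h has_real_derivative 2 * exp (2 * t) * G (h t)) (at t)"
      using that by (intro IG_deriv[OF h_continuous _ that(1)]) (auto simp: good_def)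
    have "(IG (phit k) has_real_derivative 2 * exp (2 * (t + a)) * G (phit k (t + a))) (at (t + a))"
      by (rule IG_deriv[OF phit_continuous, of "t + a + 1"]) (auto simp: phit_bounds)
    then have "((\<lambda>t. IG (phit k) (t + a)) has_real_derivative 2 * exp (2 * (t + a)) * G (phit k (t + a))) (at t)"
      by (simp add: DERIV_shift)
    from DERIV_diff[OF DERIV_cmult[OF this, of "exp (- 2 * a)"] 1]
    have "(D has_real_derivative exp (- 2 * a) * (2 * exp (2 * (t + a)) * G (phit k (t + a))) - 2 * exp (2 * t) * G (h t)) (at t)"
      by (simp add: D_def[abs_def])
    moreover have "exp (- 2 * a) * exp (2 * (t + a)) = exp (2 * t)"
      by (simp add: algebra_simps flip: exp_add)
    then have "exp (- 2 * a) * (2 * exp (2 * (t + a)) * G (phit k (t + a))) = 2 * exp (2 * t) * G (phit k (t + a))"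
      by simp
    then have "exp (- 2 * a) * (2 * exp (2 * (t + a)) * G (phit k (t + a))) - 2 * exp (2 * t) * G (h t)
        = 2 * exp (2 * t) * (G (phit k (t + a)) - G (h t))"
      unfolding right_diff_distrib by (rule arg_cong)
    ultimately show ?thesis by metis
  qed
  have "(D \<longlongrightarrow> exp (- 2 * a) * 0 - 0) at_bot"
    unfolding D_def[abs_def]
  proof (intro tendsto_intros)
    have *: "(IG (phit k) \<longlongrightarrow> 0) at_bot" by (rule IG_at_bot[OF phit_continuous, of 0]) (auto simp: phit_bounds)
    have "filterlim (\<lambda>t. t + a) at_bot (at_bot :: real filter)"
      unfolding filterlim_at_bot
    proof
      fix Z :: real
      show "\<forall>\<^sub>F t in at_bot. t + a \<le> Z" by (rule eventually_at_bot_linorderI[of "Z - a"]) simp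
    qed
    then show "((\<lambda>t. IG (phit k) (t + a)) \<longlongrightarrow> 0) at_bot" by (rule filterlim_compose[OF *])
    show "(IG h \<longlongrightarrow> 0) at_bot" using T by (intro IG_at_bot[OF h_continuous, of T]) (auto simp: good_def)
  qed
  then have "(D \<longlongrightarrow> 0) at_bot" by simp
  \<comment> \<open>At t0 itself the two potentials agree, so the strict gain is recorded one unit
    earlier. It is fixed before the time at which E is small is chosen.\<close>
  then have D_pos: "0 < D (t0 - 1)"
  proof (rule DERIV_pos_imp_increasing_at_bot[where f=D, rotated])
    fix s assume s: "s \<le> t0 - 1"
    have "G (h s) < G (phit k (s + a))" using s T by (intro cmp1) auto
    then have "0 < 2 * exp (2 * s) * (G (phit k (s + a)) - G (h s))" by simp
    then show "\<exists>y. (D has_real_derivative y) (at s) \<and> 0 < y" using D[of s T] T s by force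
  qed
  obtain t2 where t2: "t0 < t2" "\<And>s. s \<le> t2 \<Longrightarrow> good s" "E t2 < lam * D (t0 - 1)"
    using small[of "lam * D (t0 - 1)"] lam D_pos by auto
  \<comment> \<open>Step back from t2, because \<open>pohozaev\<close> and the derivative of D at t
    rely on bounds at times slightly later than t.\<close>
  obtain t where t: "t0 < t" "t < t2" "E t < lam * D (t0 - 1)"
  proof -
    have "(E \<longlongrightarrow> E t2) (at_left t2)"
      using isCont_E[of t2] by (simp add: isCont_def filterlim_at_split)
    then have "\<forall>\<^sub>F t in at_left t2. E t < lam * D (t0 - 1)"
      by (rule order_tendstoD(2)) (use t2 in simp)
    moreover have "\<forall>\<^sub>F t in at_left t2. t0 < t \<and> t < t2"
      using \<open>t0 < t2\<close> by (auto simp: eventually_at_left)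
    ultimately have "\<forall>\<^sub>F t in at_left t2. E t < lam * D (t0 - 1) \<and> t0 < t \<and> t < t2" by eventually_elim auto
    then show ?thesis
      using that eventually_happens'[of "at_left t2"] by (force simp: trivial_limit_at_left_real)
  qed
  have "D (t0 - 1) \<le> D t"
  proof (rule DERIV_nonneg_imp_nondecreasing[where f=D])
    fix s assume s: "t0 - 1 \<le> s" "s \<le> t"
    have "G (h s) \<le> G (phit k (s + a))"
      using cmp1[of s] cmp2[of s] t2 s t a t0 by (cases s t0 rule: linorder_cases) (auto simp: less_imp_le)
    then have "0 \<le> 2 * exp (2 * s) * (G (phit k (s + a)) - G (h s))" by simp
    then show "\<exists>y. (D has_real_derivative y) (at s) \<and> 0 \<le> y" using D[of s t2] t2 s t by force
  qed (use t in simp)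
  have good: "good t" using t2 t by simp
  have "0 < h t" "h t < pi" "xi < h t"
    using good h_increasing[of t t0 t] good_y t2 t t0 by (auto simp: good_def)
  then have "0 \<le> exp (2 * t) * G (h t)" using G_nonneg[of "h t"] by simp
  moreover have "E t = lam * (exp (2 * t) * G (h t) - IG h t)"
    using t2 by (intro pohozaev[OF _ t(2)]) (auto simp: good_def)
  ultimately have "- (lam * IG h t) \<le> E t" using lam by (simp add: right_diff_distrib)
  then have "- (lam * IG h t) < lam * D t"
    using t(3) \<open>D (t0 - 1) \<le> D t\<close> lam by (smt (verit) mult_left_mono)
  then have "0 < lam * (exp (- 2 * a) * IG (phit k) (t + a))" by (simp add: D_def right_diff_distrib)
  then have "0 < IG (phit k) (t + a)" using lam by (simp add: zero_less_mult_iff)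
  moreover have "xi < phit k (t + a)" using phit_mono[of "t0 + a" "t + a"] t a by simp
  ultimately show ?thesis using that by blast
qed

end

section \<open>Shooting\<close>

context orbit
begin

text \<open>The weight \<open>\<psi>\<close> is a supersolution of the linearisation at \<open>0\<close>, so a Wronskian argument applies.\<close>

lemma growth_bound:
  assumes norm: "\<forall>\<^sub>F s in at_bot. h s \<le> 3 * exp (real k * s)" and h: "\<And>s. s \<le> t \<Longrightarrow> 0 \<le> h s"
  shows "h t \<le> 3 * exp (real k * t + lam * L / 4 * exp (2 * t))"
proof -
  \<comment> \<open>With 4 * \<beta> = lam * L, the second derivative of \<psi> is at least (k^2 +
    lam * L * exp (2 s)) * \<psi>, and this coefficient dominates the right-hand side for h.\<close>
  define \<beta> where "\<beta> = lam * L / 4"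
  have \<beta>: "0 < \<beta>" using lam L_pos by (simp add: \<beta>_def)
  define \<psi> where "\<psi> s = exp (real k * s + \<beta> * exp (2 * s))" for s
  define q where "q s = real k + 2 * \<beta> * exp (2 * s)" for s
  have \<psi>_pos: "0 < \<psi> s" for s by (simp add: \<psi>_def)
  have \<psi>': "(\<psi> has_real_derivative q s * \<psi> s) (at s)" for s
    unfolding \<psi>_def[abs_def] q_def by (auto intro!: derivative_eq_intros simp: algebra_simps)
  have q': "(q has_real_derivative 4 * \<beta> * exp (2 * s)) (at s)" for s
    unfolding q_def[abs_def] by (auto intro!: derivative_eq_intros)
  \<comment> \<open>The Wronskian of h and \<psi> is nonincreasing with limit 0 at -\<infinity>,
    hence nonpositive, so h / \<psi> is nonincreasing.\<close>
  define W where "W s = y s * \<psi> s - h s * (q s * \<psi> s)" for s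
  define A where "A s = (real k)\<^sup>2 * sin (h s) * cos (h s) + lam * exp (2 * s) * g (h s)" for s
  have W': "(W has_real_derivative (A s - h s * ((q s)\<^sup>2 + 4 * \<beta> * exp (2 * s))) * \<psi> s) (at s)" for s
    unfolding W_def[abs_def] A_def
    by (auto intro!: derivative_eq_intros h_deriv y_deriv \<psi>' q' simp: algebra_simps power2_eq_square)
  have W'_neg: "(A s - h s * ((q s)\<^sup>2 + 4 * \<beta> * exp (2 * s))) * \<psi> s \<le> 0" if "s \<le> t" for s
  proof -
    have h0: "0 \<le> h s" using h that by simp
    have "sin (h s) * cos (h s) \<le> h s"
      using sin_x_le_x[of "2 * h s"] h0 by (simp add: sin_double)
    then have "(real k)\<^sup>2 * (sin (h s) * cos (h s)) \<le> (real k)\<^sup>2 * h s" by (rule mult_left_mono) simp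
    moreover have "lam * exp (2 * s) * g (h s) \<le> lam * exp (2 * s) * (L * h s)"
      using g_le[of "h s"] h0 lam by (intro mult_left_mono) auto
    ultimately have "A s \<le> h s * ((real k)\<^sup>2 + 4 * \<beta> * exp (2 * s))"
      by (simp add: A_def \<beta>_def algebra_simps)
    also have "\<dots> \<le> h s * ((q s)\<^sup>2 + 4 * \<beta> * exp (2 * s))"
      using h0 \<beta> by (intro mult_left_mono add_mono power_mono) (auto simp: q_def)
    finally show ?thesis using \<psi>_pos[of s] by (simp add: mult_le_0_iff)
  qed
  have W_dec: "W s' \<le> W s" if "s \<le> s'" "s' \<le> t" for s s'
    by (rule nonincreasing_if_deriv_nonpos[OF that(1) W']) (use W'_neg that in auto)
  have \<psi>_0: "(\<psi> \<longlongrightarrow> 0) at_bot"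
  proof (rule Lim_null_comparison)
    have "\<bar>\<psi> s\<bar> \<le> exp \<beta> * exp s" if "s \<le> 0" for s
    proof -
      have "exp (2 * s) \<le> 1" using that by simp
      then have "\<beta> * exp (2 * s) \<le> \<beta> * 1" using \<beta> by (intro mult_left_mono) auto
      moreover have "real k * s \<le> 1 * s" using that k_pos by (intro mult_right_mono_neg) auto
      ultimately show ?thesis by (simp add: \<psi>_def flip: exp_add)
    qed
    then show "\<forall>\<^sub>F s in at_bot. norm (\<psi> s) \<le> exp \<beta> * exp s" by (auto intro: eventually_at_bot_linorderI)
    show "((\<lambda>s. exp \<beta> * exp s) \<longlongrightarrow> 0) at_bot"
      using tendsto_mult_left[OF exp_at_bot, of "exp \<beta>"] by simp
  qed
  have "((\<lambda>s. exp (2 * s)) \<longlongrightarrow> (0::real)) at_bot"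
    using tendsto_power[OF exp_at_bot, of 2] by (simp add: exp_double)
  then have q_lim: "(q \<longlongrightarrow> real k + 2 * \<beta> * 0) at_bot"
    unfolding q_def[abs_def] by (intro tendsto_intros)
  have "(W \<longlongrightarrow> 0 * 0 - 0 * ((real k + 2 * \<beta> * 0) * 0)) at_bot"
    unfolding W_def[abs_def] by (intro tendsto_diff tendsto_mult y_at_bot h_at_bot \<psi>_0 q_lim)
  then have W_lim: "(W \<longlongrightarrow> 0) at_bot" by simp
  have W_neg: "W s \<le> 0" if "s \<le> t" for s
  proof (rule tendsto_lowerbound[OF W_lim])
    show "\<forall>\<^sub>F u in at_bot. W s \<le> W u" using W_dec that by (auto intro: eventually_at_bot_linorderI)
  qed simp
  have r: "((\<lambda>s. h s / \<psi> s) has_real_derivative W s / (\<psi> s)\<^sup>2) (at s)" for s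
  proof -
    have "((\<lambda>s. h s / \<psi> s) has_real_derivative (y s * \<psi> s - h s * (q s * \<psi> s)) / (\<psi> s * \<psi> s)) (at s)"
      using \<psi>_pos[of s] by (intro DERIV_divide h_deriv \<psi>') simp
    then show ?thesis by (simp add: W_def power2_eq_square)
  qed
  have r_dec: "h t / \<psi> t \<le> h s / \<psi> s" if "s \<le> t" for s
    by (rule nonincreasing_if_deriv_nonpos[OF that r]) (use W_neg in \<open>simp add: divide_nonpos_nonneg\<close>)
  obtain N where N: "\<And>s. s \<le> N \<Longrightarrow> h s \<le> 3 * exp (real k * s)"
    using norm by (auto simp: eventually_at_bot_linorder)
  define s where "s = min N t"
  have "h s \<le> 3 * \<psi> s"
  proof -
    have "exp (real k * s) \<le> \<psi> s" using \<beta> by (simp add: \<psi>_def)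
    then show ?thesis using N[of s] by (simp add: s_def)
  qed
  then have "h s / \<psi> s \<le> 3" using \<psi>_pos[of s] by (simp add: divide_le_eq)
  then have "h t / \<psi> t \<le> 3" using r_dec[of s] by (simp add: s_def)
  then show ?thesis using \<psi>_pos[of t] by (simp add: divide_le_eq \<psi>_def \<beta>_def)
qed

lemma G_h_deriv: "good t \<Longrightarrow> ((\<lambda>s. G (h s)) has_real_derivative g (h t) * y t) (at t)"
  by (intro DERIV_chain2[OF G_deriv] h_deriv) (auto simp: good_def)

text \<open>The coefficient \<open>lam * exp (2 * s)\<close> is frozen at \<open>c\<close>.\<close>

lemma E_minus_G_mono:
  assumes "a < b" "\<And>s. s < b \<Longrightarrow> good s" "0 \<le> h b" "h b \<le> pi"
    and sign: "\<And>s. a < s \<Longrightarrow> s < b \<Longrightarrow> 0 \<le> (lam * exp (2 * s) - c) * g (h s)"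
  shows "E a - c * G (h a) \<le> E b - c * G (h b)"
proof (rule DERIV_nonneg_imp_increasing_open[where f="\<lambda>s. E s - c * G (h s)"])
  show "a \<le> b" using assms by simp
  have "0 \<le> h s \<and> h s \<le> pi" if "s \<le> b" for s
    using assms that by (cases "s = b") (auto simp: good_def less_imp_le)
  then have "continuous_on {a..b} (\<lambda>s. G (h s))"
    by (intro continuous_on_compose2[OF G_cont continuous_on_subset[OF h_continuous]]) auto
  then show "continuous_on {a..b} (\<lambda>s. E s - c * G (h s))"
    by (intro continuous_on_diff continuous_on_mult continuous_on_const continuous_at_imp_continuous_on[of _ E]) auto
  fix s assume s: "a < s" "s < b"
  have "((\<lambda>s. E s - c * G (h s)) has_real_derivative lam * exp (2 * s) * g (h s) * y s - c * (g (h s) * y s)) (at s)"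
    using assms(2)[OF s(2)] by (intro DERIV_diff E_deriv DERIV_cmult G_h_deriv)
  moreover have "lam * exp (2 * s) * g (h s) * y s - c * (g (h s) * y s) = (lam * exp (2 * s) - c) * g (h s) * y s"
    by (simp add: algebra_simps)
  moreover have "0 \<le> (lam * exp (2 * s) - c) * g (h s) * y s"
    using sign[OF s] good_y[OF assms(2)[OF s(2)]] by simp
  ultimately show "\<exists>y. ((\<lambda>s. E s - c * G (h s)) has_real_derivative y) (at s) \<and> 0 \<le> y" by metis
qed

text \<open>Freeze the coefficient at its smallest value while g > 0 (below xi) and at an upper
  bound while g < 0 (above xi). Because G (h t) >= 0, the gain is -G (h te), and the mismatch of the
  two coefficients costs \<delta> * G xi; so a short passage has positive energy when G (h te) <
  0.\<close>

lemma E_lower: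
  assumes good: "\<And>s. s < t \<Longrightarrow> good s" and t: "xi < h t" "h t \<le> pi" and te: "te < t" "h te < xi"
    and \<delta>: "0 \<le> \<delta>" "exp (2 * t) \<le> (1 + \<delta>) * exp (2 * te)"
  shows "lam * exp (2 * te) * (- G (h te) - \<delta> * G xi) \<le> E t"
proof -
  let ?K = "lam * exp (2 * te)"
  have K: "0 < ?K" using lam by simp
  obtain tx where tx: "te \<le> tx" "tx \<le> t" "h tx = xi"
    using IVT[of h te xi t] te t by auto
  then have tx': "te < tx" "tx < t" using te t by (cases "te = tx"; cases "tx = t"; simp)+
  have mono: "h s < h s'" if "s < s'" "s' \<le> t" for s s'
    using h_increasing[of t s s'] good good_y that by auto
  have "E te - ?K * G (h te) \<le> E tx - ?K * G (h tx)"
  proof (rule E_minus_G_mono[OF tx'(1)])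
    fix s assume s: "te < s" "s < tx"
    have "0 < g (h s)" using good[of s] mono[of s tx] s tx tx' by (intro g_pos) (auto simp: good_def)
    then show "0 \<le> (lam * exp (2 * s) - ?K) * g (h s)"
      using lam s by (intro mult_nonneg_nonneg) auto
  qed (use good tx tx' xi in auto)
  moreover have "E tx - (1 + \<delta>) * ?K * G (h tx) \<le> E t - (1 + \<delta>) * ?K * G (h t)"
  proof (rule E_minus_G_mono[OF tx'(2) good])
    fix s assume s: "tx < s" "s < t"
    have "g (h s) < 0" using good[of s] mono[of tx s] s tx tx' by (intro g_neg) (auto simp: good_def)
    moreover have "exp (2 * s) \<le> exp (2 * t)" using s by simp
    then have "exp (2 * s) \<le> (1 + \<delta>) * exp (2 * te)" using \<delta>(2) by (rule order_trans)
    then have "lam * exp (2 * s) \<le> lam * ((1 + \<delta>) * exp (2 * te))"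
      using lam by (intro mult_left_mono) auto
    then have "lam * exp (2 * s) - (1 + \<delta>) * ?K \<le> 0" by (simp add: mult.left_commute)
    ultimately show "0 \<le> (lam * exp (2 * s) - (1 + \<delta>) * ?K) * g (h s)"
      by (intro mult_nonpos_nonpos) auto
  qed (use t xi in auto)
  moreover have "0 \<le> (1 + \<delta>) * ?K * G (h t)" using K \<delta> G_nonneg[of "h t"] t by simp
  moreover have "0 < E te" using good_E good te by simp
  ultimately have "?K * G (h tx) - ?K * G (h te) - (1 + \<delta>) * ?K * G (h tx) \<le> E t" by linarith
  then show ?thesis unfolding tx(3) by (simp add: algebra_simps)
qed

lemma E_increasing_below_xi:
  assumes good: "\<And>s. s < t \<Longrightarrow> good s" and t: "te \<le> t" "h t \<le> xi"
  shows "E te \<le> E t"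
proof (rule DERIV_nonneg_imp_increasing_open[where f=E, OF t(1)])
  fix s assume s: "te < s" "s < t"
  have "h s < h t" using h_increasing[of t s t] good good_y s by auto
  then have "0 < lam * exp (2 * s) * g (h s) * y s"
    using good[OF s(2)] good_y[OF good[OF s(2)]] t lam by (intro mult_pos_pos g_pos) (auto simp: good_def)
  then show "\<exists>y. (E has_real_derivative y) (at s) \<and> 0 \<le> y" using E_deriv by (blast intro: less_imp_le)
qed (simp add: continuous_at_imp_continuous_on)

text \<open>Between the heights h te / 2 and h te the speed is at least k sin h >= sin (h te / 2).
  The passage therefore takes a bounded time, and the coefficient exp (2 s) was already comparable
  to exp (2 te) at its beginning.\<close>

lemma E_at_half:
  assumes good: "\<And>s. s \<le> te \<Longrightarrow> good s" and te: "h te < xi" "h te \<le> pi / 2"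
  shows "lam * exp (2 * te) * (exp (- h te / sin (h te / 2)) * (G (h te) - G (h te / 2))) \<le> E te"
proof -
  define e where "e = h te"
  have e: "0 < e" "e < xi" "e \<le> pi / 2" using good[of te] te by (auto simp: good_def e_def)
  have "\<forall>\<^sub>F s in at_bot. h s < e / 2 \<and> s \<le> te"
    using order_tendstoD(2)[OF h_at_bot, of "e / 2"] e eventually_le_at_bot[of te] by (auto intro: eventually_conj)
  then obtain s0 where s0: "h s0 < e / 2" "s0 \<le> te" by (auto simp: eventually_at_bot_linorder)
  then obtain tf where tf: "tf \<le> te" "h tf = e / 2"
    using IVT[of h s0 "e / 2" te] e by (auto simp: e_def)
  then have tf': "tf < te" using e by (cases "tf = te") (auto simp: e_def)
  have mono: "h s < h s'" if "s < s'" "s' \<le> te" for s s'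
    using h_increasing[of te s s'] good good_y that by auto
  define v where "v = sin (e / 2)"
  have v: "0 < v" using e by (auto simp: v_def intro!: sin_gt_zero)
  have y: "v \<le> y s" if "tf \<le> s" "s \<le> te" for s
  proof -
    have "e / 2 \<le> h s" "h s \<le> e" using mono[of tf s] mono[of s te] that tf
      by (cases "tf = s"; cases "s = te"; simp add: e_def)+
    then have "v \<le> sin (h s)" unfolding v_def using e by (intro sin_monotone_2pi_le) auto
    also have "\<dots> \<le> real k * sin (h s)" using k_pos calculation v by (simp add: mult_le_cancel_right1)
    also have "\<dots> \<le> y s" using good[of s] that by (auto simp: good_def w_def)
    finally show ?thesis .
  qed
  have "((\<lambda>s. h s - v * s) has_real_derivative y s - v) (at s)" for s
    by (auto intro!: derivative_eq_intros h_deriv)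
  then have "h tf - v * tf \<le> h te - v * te"
    by (rule nondecreasing_if_deriv_nonneg[OF tf(1)]) (use y in auto)
  then have "v * (te - tf) \<le> e / 2" using tf by (simp add: e_def algebra_simps)
  then have "2 * (te - tf) \<le> e / v" using v by (simp add: field_simps)
  then have "exp (2 * te) * exp (- e / v) \<le> exp (2 * tf)" by (simp flip: exp_add)
  then have 1: "lam * (exp (2 * te) * exp (- e / v)) \<le> lam * exp (2 * tf)" using lam by (intro mult_left_mono) auto
  have "E tf - lam * exp (2 * tf) * G (h tf) \<le> E te - lam * exp (2 * tf) * G (h te)"
  proof (rule E_minus_G_mono[OF tf'])
    fix s assume s: "tf < s" "s < te"
    have "0 < g (h s)" using good[of s] mono[of s te] s e by (intro g_pos) (auto simp: good_def e_def)
    then show "0 \<le> (lam * exp (2 * s) - lam * exp (2 * tf)) * g (h s)"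
      using lam s by (intro mult_nonneg_nonneg) auto
  qed (use good e xi in \<open>auto simp: e_def\<close>)
  moreover have "0 < E tf" using good_E good tf by simp
  ultimately have 2: "lam * exp (2 * tf) * (G e - G (e / 2)) \<le> E te"
    using tf by (simp add: e_def algebra_simps)
  have "0 \<le> G e - G (e / 2)" using G_mono[of "e / 2" e] e by simp
  from mult_right_mono[OF 1 this] 2 show ?thesis by (simp add: e_def v_def mult.assoc)
qed

end

section \<open>Large lam: crossing pi\<close>

context profile
begin

text \<open>Let te be the time at height e, where G e < 0. The growth bound makes lam * exp (2 te)
  at least K; during the next l units of time E >= c * K, so w cannot vanish and y >= pi / l. A good
  orbit would thus rise by pi within that time.\<close>

lemma overshoot:
  obtains lam0 where "0 < lam0"
    and "\<And>lam h y. orbit k g G xi L lam h y \<Longrightarrow> \<forall>\<^sub>F s in at_bot. h s \<le> 3 * exp (real k * s) \<Longrightarrow> lam0 \<le> lam \<Longrightarrow>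
      \<exists>t1. (\<forall>s<t1. orbit.good k h y s) \<and> h t1 = pi \<and> 0 < y t1"
proof -
  have "(G \<longlongrightarrow> G 0) (at 0 within {0..pi})" using G_cont by (simp add: continuous_on_def)
  then have "(G \<longlongrightarrow> G 0) (at_right 0)" by (simp add: at_within_Icc_at_right)
  then have "\<forall>\<^sub>F x in at_right 0. G x < 0" using G_ends by (intro order_tendstoD(2))
  moreover have "\<forall>\<^sub>F x in at_right 0. 0 < x \<and> x < min xi (pi / 2)"
    using xi by (auto simp: eventually_at_right intro!: exI[of _ "min xi (pi/2)"])
  ultimately have "\<forall>\<^sub>F x in at_right 0. G x < 0 \<and> 0 < x \<and> x < min xi (pi / 2)" by eventually_elim auto
  then obtain e where e: "G e < 0" "0 < e" "e < xi" "e < pi / 2"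
    using eventually_happens'[of "at_right (0::real)"] by (force simp: trivial_limit_at_right_real)
  \<comment> \<open>The constants are chosen backwards from this argument: \<delta> spends at most
    half of the gain -G e; c covers the cases h t > xi and h t <= xi; exp (2 l) = 1 + \<delta>; 2 *
    c * K = (pi / l)^2. \<open>Q * exp te\<close> bounds h te when te < 0 and lam * exp (2 te) <
    K.\<close>
  define \<delta> where "\<delta> = - G e / (2 * (G xi + 1))"
  have Gxi: "0 \<le> G xi" using G_nonneg[of xi] xi by simp
  have \<delta>: "0 < \<delta>" "\<delta> * G xi \<le> - G e / 2"
    using e Gxi by (auto simp: \<delta>_def field_simps mult_nonpos_nonneg intro!: divide_pos_pos)
  define c where "c = min (- G e / 2) (exp (- e / sin (e / 2)) * (G e - G (e / 2)))"
  have c: "0 < c" using e G_mono[of "e / 2" e] by (simp add: c_def)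
  define l where "l = ln (1 + \<delta>) / 2"
  have l: "0 < l" using \<delta> by (simp add: l_def)
  define K where "K = (pi / l)\<^sup>2 / (2 * c)"
  have K: "0 < K" using c l by (simp add: K_def)
  define Q where "Q = 3 * exp (L * K / 4)"
  define lam0 where "lam0 = K * (1 + (Q / e)\<^sup>2)"
  have lam0: "0 < lam0" unfolding lam0_def using K by (intro mult_pos_pos add_pos_nonneg) auto
  show ?thesis
  proof (rule that[OF lam0])
    fix lam :: real and h y :: "real \<Rightarrow> real"
    assume o: "orbit k g G xi L lam h y" and norm: "\<forall>\<^sub>F s in at_bot. h s \<le> 3 * exp (real k * s)" and le: "lam0 \<le> lam"
    interpret orbit k g G xi L lam h y by fact
    \<comment> \<open>The summand 1 in \<open>lam0\<close> forces te < 0 if the claim fails, so that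
      exp (k te) <= exp te; then e <= Q * exp te contradicts the summand (Q / e)^2.\<close>
    have K_le: "K \<le> lam * exp (2 * te)" if te: "h te = e" "\<And>s. s \<le> te \<Longrightarrow> 0 \<le> h s" for te
    proof (rule ccontr)
      assume "\<not> ?thesis"
      then have lt: "lam * exp (2 * te) < K" by simp
      have "K * 1 \<le> K * (1 + (Q / e)\<^sup>2)" using K by (intro mult_left_mono) auto
      then have "K \<le> lam" using le by (simp add: lam0_def)
      then have "exp (2 * te) < 1" using lt lam by (smt (verit) mult_le_cancel_left1)
      then have "te < 0" by simp
      have "e \<le> 3 * exp (real k * te + lam * L / 4 * exp (2 * te))"
        using growth_bound[OF norm, of te] te by auto
      also have "\<dots> \<le> 3 * exp (te + L * K / 4)"
      proof -
        have "real k * te \<le> 1 * te" using \<open>te < 0\<close> k_pos by (intro mult_right_mono_neg) auto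
        moreover have "L / 4 * (lam * exp (2 * te)) \<le> L / 4 * K" using lt L_pos by (intro mult_left_mono) auto
        ultimately show ?thesis by (simp add: algebra_simps)
      qed
      also have "\<dots> = Q * exp te" by (simp add: Q_def exp_add)
      finally have "e\<^sup>2 \<le> (Q * exp te)\<^sup>2" using e by (intro power_mono) auto
      then have "e\<^sup>2 \<le> Q\<^sup>2 * exp (2 * te)" by (simp add: power_mult_distrib exp_double)
      then have "lam * e\<^sup>2 \<le> Q\<^sup>2 * (lam * exp (2 * te))" using lam by (simp add: mult.left_commute)
      also have "\<dots> \<le> Q\<^sup>2 * K" using lt by (intro mult_left_mono) auto
      finally have "lam \<le> K * (Q / e)\<^sup>2" using e by (simp add: field_simps power_divide)
      then show False using le K by (simp add: lam0_def algebra_simps)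
    qed
    have E_ge: "c * (lam * exp (2 * te)) \<le> E t"
      if good: "\<And>s. s < t \<Longrightarrow> good s" and te: "te < t" "h te = e" and t: "h t \<le> pi" "t \<le> te + l" for t te
    proof (cases "h t \<le> xi")
      case True
      have "c * (lam * exp (2 * te)) \<le> lam * exp (2 * te) * (exp (- h te / sin (h te / 2)) * (G (h te) - G (h te / 2)))"
        using lam te by (subst mult.commute, intro mult_left_mono) (auto simp: c_def)
      also have "\<dots> \<le> E te" using good te e by (intro E_at_half) auto
      also have "\<dots> \<le> E t" using good te True by (intro E_increasing_below_xi) auto
      finally show ?thesis .
    next
      case False
      have "exp (2 * t) \<le> exp (2 * te + 2 * l)" using t by simp
      also have "\<dots> = (1 + \<delta>) * exp (2 * te)" using \<delta> by (simp add: exp_add l_def)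
      finally have "lam * exp (2 * te) * (- G (h te) - \<delta> * G xi) \<le> E t"
        using good te t False e \<delta> by (intro E_lower) auto
      moreover have "lam * exp (2 * te) * c \<le> lam * exp (2 * te) * (- G (h te) - \<delta> * G xi)"
        using lam te \<delta> by (intro mult_left_mono) (auto simp: c_def)
      ultimately show ?thesis by (simp add: mult.commute)
    qed
    have short: False if good: "\<And>s. s \<le> te + l \<Longrightarrow> good s" and te: "h te = e" for te
    proof -
      have KK: "K \<le> lam * exp (2 * te)" using good l by (intro K_le te) (auto simp: good_def less_imp_le)
      have y: "pi / l \<le> y t" if "te < t" "t \<le> te + l" for t
      proof (rule power2_le_imp_le)
        have "(pi / l)\<^sup>2 = 2 * (c * K)" using c by (simp add: K_def)
        also have "\<dots> \<le> 2 * (c * (lam * exp (2 * te)))" using KK c by simp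
        also have "\<dots> \<le> 2 * E t" using E_ge[OF _ that(1) te _ that(2)] good that by (auto simp: good_def less_imp_le)
        also have "\<dots> \<le> (y t)\<^sup>2" by (simp add: E_def)
        finally show "(pi / l)\<^sup>2 \<le> (y t)\<^sup>2" .
        show "0 \<le> y t" using good_y[OF good[of t]] that by simp
      qed
      have d: "((\<lambda>s. h s - pi / l * s) has_real_derivative y s - pi / l) (at s)" for s
        by (intro DERIV_diff h_deriv DERIV_cmult_Id)
      have "h te - pi / l * te \<le> h (te + l) - pi / l * (te + l)"
      proof (rule DERIV_nonneg_imp_increasing_open[where f="\<lambda>s. h s - pi / l * s"])
        show "continuous_on {te..te + l} (\<lambda>s. h s - pi / l * s)"
          using DERIV_isCont[OF d] by (simp add: continuous_at_imp_continuous_on)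
        fix t assume "te < t" "t < te + l"
        then have "0 \<le> y t - pi / l" using y[of t] by simp
        then show "\<exists>D. ((\<lambda>s. h s - pi / l * s) has_real_derivative D) (at t) \<and> 0 \<le> D" using d by blast
      qed (use l in simp)
      then have "h te + pi \<le> h (te + l)" using l by (simp add: distrib_left)
      then show False using good[of "te + l"] te e by (simp add: good_def)
    qed
    have cross: "\<exists>te<tx. h te = e" if "xi \<le> h tx" for tx
    proof -
      have "\<forall>\<^sub>F s in at_bot. h s < e \<and> s \<le> tx"
        using order_tendstoD(2)[OF h_at_bot, of e] e eventually_le_at_bot[of tx] by (auto intro: eventually_conj)
      then obtain s0 where s0: "h s0 < e" "s0 \<le> tx" by (auto simp: eventually_at_bot_linorder)
      then obtain te where "te \<le> tx" "h te = e"
        using IVT[of h s0 e tx] e(3) \<open>xi \<le> h tx\<close> by auto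
      then show ?thesis using that e by (cases "te = tx") (auto intro!: exI[of _ te])
    qed
    show "\<exists>t1. (\<forall>s<t1. good s) \<and> h t1 = pi \<and> 0 < y t1"
    proof (cases rule: exit_cases)
      case forever
      have "\<forall>\<^sub>F t in at_top. xi < h t" by (rule order_tendstoD(1)[OF forever_h_tendsto[OF forever]]) (rule xi)
      then obtain tx where "xi < h tx" by (auto simp: eventually_at_top_linorder)
      then obtain te where "h te = e" using cross[of tx] by auto
      then show ?thesis using short[OF forever] by blast
    next
      case (exit t1)
      show ?thesis
      proof (rule ccontr)
        assume "\<not> ?thesis"
        then have t1: "xi < h t1" "h t1 < pi" "w t1 = 0" using exit by auto
        then obtain te where te: "te < t1" "h te = e" using cross[of t1] by auto
        have "t1 \<le> te + l"
        proof (rule ccontr)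
          assume "\<not> t1 \<le> te + l"
          then show False using short[OF _ te(2)] exit(1) by simp
        qed
        then have "c * (lam * exp (2 * te)) \<le> E t1" using exit(1) te t1 by (intro E_ge) auto
        moreover have "0 < c * (lam * exp (2 * te))" using c lam by simp
        ultimately show False using t1 by (simp add: E_eq)
      qed
    qed
  qed
qed

\<comment> \<open>Estimates uniform in lam and stability of the exits\<close>
end

text \<open>On [0, 1] the derivative 2 / (1 + u^2) of 2 arctan u is at least 1. A perturbation
  smaller than exp (n t) therefore leaves the profile positive.\<close>

lemma exp_le_phit: "t \<le> 0 \<Longrightarrow> exp (real n * t) \<le> phit n t"
proof -
  assume t: "t \<le> 0"
  define x where "x = exp (real n * t)"
  have x: "0 < x" "x \<le> 1" using t by (auto simp: x_def mult_nonneg_nonpos)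
  have "2 * arctan 0 - 0 \<le> 2 * arctan x - x"
  proof (rule DERIV_nonneg_imp_nondecreasing[where f="\<lambda>x. 2 * arctan x - x"])
    fix u assume u: "0 \<le> u" "u \<le> x"
    have "u\<^sup>2 \<le> 1" using u x by (simp add: power_le_one)
    then have "0 \<le> 2 * inverse (1 + u\<^sup>2) - 1" by (simp add: field_simps add_pos_nonneg)
    then show "\<exists>D. ((\<lambda>x. 2 * arctan x - x) has_real_derivative D) (at u) \<and> 0 \<le> D"
      by (intro exI[of _ "2 * inverse (1 + u\<^sup>2) - 1"] conjI DERIV_diff DERIV_cmult DERIV_arctan DERIV_ident)
  qed (use x in simp)
  then show ?thesis by (simp add: phit_def x_def)
qed

lemma om_mono:
  assumes "0 \<le> r" "r \<le> r'" "0 \<le> b"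
  shows "om n b r \<le> om n b r'" "om1 n b r \<le> om1 n b r'"
proof -
  have sq: "r\<^sup>2 \<le> r'\<^sup>2" using assms by (intro power_mono) auto
  show 1: "om n b r \<le> om n b r'"
    unfolding om_def using assms sq by (intro mult_mono power_mono) (auto intro: mult_left_mono)
  have "2 * b * r\<^sup>2 \<le> 2 * b * r'\<^sup>2" using sq assms by (intro mult_left_mono) auto
  then show "om1 n b r \<le> om1 n b r'"
    unfolding om1_def using assms 1 by (intro mult_mono) (auto simp: om_def)
qed

lemma om_le_exp:
  assumes "t \<le> 0" "0 \<le> b"
  shows "om n b (exp t) \<le> exp b * (exp (real n * t) * exp t)"
proof -
  have "(exp t)\<^sup>2 \<le> 1" using assms by (simp add: power_le_one)
  then have "exp (b * (exp t)\<^sup>2) \<le> exp b" using assms by (simp add: mult_left_le)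
  moreover have "exp t ^ (n + 1) = exp (real n * t) * exp t"
    by (simp add: exp_of_nat_mult)
  ultimately show ?thesis unfolding om_def by (simp add: mult.commute)
qed

text \<open>The minimum over the compact interval is positive and absorbs the Lipschitz error;
  dividing by M + 1 also covers M = 0. This yields openness of the exit sets in lam.\<close>

lemma pos_on_interval_stable:
  fixes f :: "real \<Rightarrow> real \<Rightarrow> real"
  assumes "a \<le> b" and c: "continuous_on {a..b} (f l)" and pos: "\<And>s. a \<le> s \<Longrightarrow> s \<le> b \<Longrightarrow> 0 < f l s"
    and M: "0 \<le> M" "\<And>l' s. l' \<in> S \<Longrightarrow> a \<le> s \<Longrightarrow> s \<le> b \<Longrightarrow> \<bar>f l' s - f l s\<bar> \<le> M * \<bar>l' - l\<bar>"
  obtains e where "0 < e" "\<And>l' s. l' \<in> S \<Longrightarrow> \<bar>l' - l\<bar> < e \<Longrightarrow> a \<le> s \<Longrightarrow> s \<le> b \<Longrightarrow> 0 < f l' s"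
proof -
  obtain s0 where s0: "s0 \<in> {a..b}" "\<And>s. s \<in> {a..b} \<Longrightarrow> f l s0 \<le> f l s"
    using continuous_attains_inf[OF _ _ c] assms(1) by auto
  define e where "e = f l s0 / (M + 1)"
  have "0 < f l s0" using pos s0 by auto
  then have e: "0 < e" "e * (M + 1) = f l s0" using M(1) by (auto simp: e_def)
  have "0 < f l' s" if "l' \<in> S" "\<bar>l' - l\<bar> < e" "a \<le> s" "s \<le> b" for l' s
  proof -
    have "\<bar>f l' s - f l s\<bar> \<le> M * e" using M(2)[OF that(1,3,4)] mult_left_mono[of "\<bar>l' - l\<bar>" e M] that(2) M(1) by simp
    also have "\<dots> < f l s0" using e by (simp add: algebra_simps)
    also have "\<dots> \<le> f l s" using s0(2)[of s] that by simp
    finally show ?thesis by linarith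
  qed
  then show ?thesis using that e(1) by blast
qed

context orbit
begin

text \<open>At a zero of w only the term with g (h) survives, and it is negative above xi: w changes
  sign there.\<close>

lemma w_deriv: "(w has_real_derivative - (real k * cos (h t) * w t) + lam * exp (2 * t) * g (h t)) (at t)"
proof -
  have "(w has_real_derivative ((real k)\<^sup>2 * sin (h t) * cos (h t) + lam * exp (2 * t) * g (h t))
      - real k * (cos (h t) * y t)) (at t)"
    unfolding w_def[abs_def] by (intro DERIV_diff y_deriv DERIV_cmult DERIV_fun_sin h_deriv)
  moreover have "((real k)\<^sup>2 * sin (h t) * cos (h t) + lam * exp (2 * t) * g (h t))
      - real k * (cos (h t) * y t) = - (real k * cos (h t) * w t) + lam * exp (2 * t) * g (h t)"
    by (simp add: w_def algebra_simps power2_eq_square)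
  ultimately show ?thesis by simp
qed

lemma pos_near:
  assumes "isCont f t" "0 < f t"
  obtains d :: real where "0 < d" "\<And>s. \<bar>s - t\<bar> < d \<Longrightarrow> 0 < (f s :: real)"
proof -
  have "(f \<longlongrightarrow> f t) (at t)" using assms(1) by (simp add: isCont_def)
  then have "\<forall>\<^sub>F s in at t. 0 < f s" using assms(2) by (rule order_tendstoD(1))
  then obtain d where "0 < d" "\<And>s. s \<noteq> t \<Longrightarrow> \<bar>s - t\<bar> < d \<Longrightarrow> 0 < f s"
    by (auto simp: eventually_at dist_real_def)
  then show ?thesis using that assms(2) by metis
qed

text \<open>By transversality the orbit goes strictly beyond the boundary shortly after its first
  exit. The resulting strict inequalities on a compact time interval are stable under small changes
  of lam, unlike the equalities at the exit itself.\<close>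

lemma exit_strict:
  assumes T: "\<And>s. s \<le> T \<Longrightarrow> good s"
  shows "(\<forall>t. good t) \<or> (\<exists>t\<ge>T. pi < h t \<and> (\<forall>s. T \<le> s \<and> s \<le> t \<longrightarrow> 0 < w s))
    \<or> (\<exists>t\<ge>T. w t < 0 \<and> (\<forall>s. T \<le> s \<and> s \<le> t \<longrightarrow> h s < pi))"
proof (cases rule: exit_cases)
  case (exit t1)
  have T1: "T \<le> t1"
  proof (rule ccontr)
    assume "\<not> T \<le> t1"
    then have "good t1" using T by simp
    then show False using exit(2) by (auto simp: good_def)
  qed
  from exit(2) show ?thesis
  proof
    assume pi: "h t1 = pi \<and> 0 < y t1"
    then have "0 < w t1" by (simp add: w_def)
    then obtain d where d: "0 < d" "\<And>s. \<bar>s - t1\<bar> < d \<Longrightarrow> 0 < w s" using pos_near[OF isCont_w] by blast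
    obtain d' where d': "0 < d'" "\<And>s. \<bar>s - t1\<bar> < d' \<Longrightarrow> 0 < y s" using pos_near[OF isCont_y] pi by blast
    define t where "t = t1 + min d d' / 2"
    have t: "t1 < t" using d d' by (simp add: t_def)
    have "h t1 < h t" by (rule increasing_if_deriv_pos[OF t h_deriv]) (use d d' in \<open>auto simp: t_def\<close>)
    moreover have "0 < w s" if "s \<le> t" for s
      using exit(1)[of s] d(2)[of s] that d(1) d'(1) by (cases "s < t1") (auto simp: good_def t_def)
    ultimately show ?thesis using t T1 pi by (intro disjI2 disjI1 exI[of _ t]) auto
  next
    assume w: "xi < h t1 \<and> h t1 < pi \<and> w t1 = 0"
    then have "lam * exp (2 * t1) * g (h t1) < 0" using lam g_neg[of "h t1"] by (simp add: mult_pos_neg)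
    then have "(w has_real_derivative lam * exp (2 * t1) * g (h t1)) (at t1)" "lam * exp (2 * t1) * g (h t1) < 0"
      using w_deriv[of t1] w by auto
    then obtain d where d: "0 < d" "\<And>x. 0 < x \<Longrightarrow> x < d \<Longrightarrow> w (t1 + x) < w t1"
      using DERIV_neg_dec_right by blast
    have "isCont (\<lambda>s. pi - h s) t1" by simp
    then obtain d' where d': "0 < d'" "\<And>s. \<bar>s - t1\<bar> < d' \<Longrightarrow> 0 < pi - h s" using pos_near[OF \<open>isCont (\<lambda>s. pi - h s) t1\<close>] w by (smt (verit))
    define x where "x = min d d' / 2"
    have x: "0 < x" "x < d" "x < d'" using d d' by (auto simp: x_def)
    have "w (t1 + x) < 0" using d(2)[OF x(1,2)] w by simp
    moreover have "h s < pi" if "s \<le> t1 + x" for s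
      using exit(1)[of s] d'(2)[of s] that x by (cases "s < t1") (auto simp: good_def)
    ultimately show ?thesis using T1 x by (intro disjI2 exI[of _ "t1 + x"]) auto
  qed
qed blast

end

context profile
begin

text \<open>Otherwise the derivative of \<open>IG (phit k) t * exp (- (2 * t))\<close> would be
  nonnegative, which keeps G (phit k t) above a positive constant for t >= t0, although phit tends
  to pi and G pi = 0.\<close>

lemma G_phit_crossing:
  assumes t0: "0 < IG (phit k) t0"
  obtains t where "exp (2 * t) * G (phit k t) < IG (phit k) t"
proof -
  have "\<exists>t. exp (2 * t) * G (phit k t) < IG (phit k) t"
  proof (rule ccontr)
    assume "\<nexists>t. exp (2 * t) * G (phit k t) < IG (phit k) t"
    then have le: "IG (phit k) t \<le> exp (2 * t) * G (phit k t)" for t by (meson not_le)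
    define c where "c = IG (phit k) t0 * exp (- (2 * t0))"
    have c: "0 < c" using t0 by (simp add: c_def)
    have d: "(IG (phit k) has_real_derivative 2 * exp (2 * t) * G (phit k t)) (at t)" for t
      by (rule IG_deriv[OF phit_continuous, of "t + 1"]) (auto simp: phit_bounds)
    have "((\<lambda>t. IG (phit k) t * exp (- (2 * t))) has_real_derivative
       2 * (exp (2 * t) * G (phit k t) - IG (phit k) t) * exp (- (2 * t))) (at t)" for t
      by (auto intro!: derivative_eq_intros d simp: algebra_simps)
    then have inc: "c \<le> IG (phit k) t * exp (- (2 * t))" if "t0 \<le> t" for t
      unfolding c_def by (rule nondecreasing_if_deriv_nonneg[OF that]) (use le in simp)
    have "c \<le> G (phit k t)" if "t0 \<le> t" for t
    proof -
      have "c \<le> (exp (2 * t) * G (phit k t)) * exp (- (2 * t))"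
        by (rule order_trans[OF inc[OF that] mult_right_mono[OF le]]) simp
      then show ?thesis by (simp add: exp_minus field_simps)
    qed
    then have "\<forall>\<^sub>F t in at_top. c \<le> G (phit k t)" by (rule eventually_at_top_linorderI)
    moreover have "((\<lambda>t. G (phit k t)) \<longlongrightarrow> G pi) at_top"
    proof (rule continuous_on_tendsto_compose[OF G_cont])
      have "filterlim (\<lambda>t. real k * t) at_top at_top"
        using k_pos by (intro filterlim_tendsto_pos_mult_at_top[OF tendsto_const]) (auto intro: filterlim_ident)
      then have "filterlim (\<lambda>t. exp (real k * t)) at_top at_top" by (rule filterlim_compose[OF exp_at_top])
      then have "((\<lambda>t. arctan (exp (real k * t))) \<longlongrightarrow> pi / 2) at_top" by (rule filterlim_compose[OF tendsto_arctan_at_top])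
      then have "((\<lambda>t. 2 * arctan (exp (real k * t))) \<longlongrightarrow> 2 * (pi / 2)) at_top" by (intro tendsto_intros)
      then show "(phit k \<longlongrightarrow> pi) at_top" by (simp add: phit_def[abs_def])
    qed (auto simp: phit_bounds less_imp_le)
    ultimately have "c \<le> G pi" by (intro tendsto_lowerbound) auto
    then show False using c G_ends by simp
  qed
  then show ?thesis using that by blast
qed

lemma G_lipschitz:
  assumes "0 < x" "x < pi" "0 < x'" "x' < pi"
  shows "\<bar>G x - G x'\<bar> \<le> L * pi * \<bar>x - x'\<bar>"
proof -
  have "norm (G x - G x') \<le> L * pi * norm (x - x')"
  proof (rule field_differentiable_bound[of "{0<..<pi}" G g])
    fix z :: real assume z: "z \<in> {0<..<pi}"
    show "(G has_field_derivative g z) (at z within {0<..<pi})"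
      by (rule has_field_derivative_at_within[OF G_deriv]) (use z in auto)
    have "\<bar>g z\<bar> \<le> L * \<bar>z\<bar>" by (rule g_le)
    also have "\<dots> \<le> L * pi" using z L_pos by (intro mult_left_mono) auto
    finally show "norm (g z) \<le> L * pi" by simp
  qed (use assms in auto)
  then show ?thesis by simp
qed

lemma IG_close:
  assumes u: "continuous_on UNIV u" "\<And>t. t \<le> T \<Longrightarrow> 0 < u t \<and> u t < pi"
    and v: "continuous_on UNIV v" "\<And>t. t \<le> T \<Longrightarrow> 0 < v t \<and> v t < pi"
    and e: "\<And>t. t \<le> T \<Longrightarrow> \<bar>u t - v t\<bar> \<le> e"
  shows "\<bar>IG u T - IG v T\<bar> \<le> L * pi * e * exp (2 * T)"
proof -
  have cu: "continuous_on {0..exp T} (\<lambda>r. 2 * r * G (u (ln r)))" by (rule IG_integrand_continuous[OF u])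
  have cv: "continuous_on {0..exp T} (\<lambda>r. 2 * r * G (v (ln r)))" by (rule IG_integrand_continuous[OF v])
  have "IG u T - IG v T = integral {0..exp T} (\<lambda>r. 2 * r * G (u (ln r)) - 2 * r * G (v (ln r)))"
    unfolding IG_def by (intro integral_diff[symmetric] integrable_continuous_real cu cv)
  also have "\<bar>\<dots>\<bar> \<le> L * pi * e * (exp T)\<^sup>2"
  proof (rule abs_integral_le_antiderivative[where u="\<lambda>r. 2 * r * (L * pi * e)" and X="\<lambda>r. L * pi * e * r\<^sup>2"])
    fix r :: real assume r: "0 \<le> r" "r \<le> exp T"
    show "((\<lambda>r. L * pi * e * r\<^sup>2) has_real_derivative 2 * r * (L * pi * e)) (at r)"
      by (auto intro!: derivative_eq_intros)
    show "\<bar>2 * r * G (u (ln r)) - 2 * r * G (v (ln r))\<bar> \<le> 2 * r * (L * pi * e)"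
    proof (cases "r = 0")
      case False
      then have "ln r \<le> ln (exp T)" using r by (subst ln_le_cancel_iff) auto
      then have lr: "ln r \<le> T" by simp
      have "\<bar>G (u (ln r)) - G (v (ln r))\<bar> \<le> L * pi * \<bar>u (ln r) - v (ln r)\<bar>"
        using u(2)[OF lr] v(2)[OF lr] by (intro G_lipschitz) auto
      also have "\<dots> \<le> L * pi * e" using e[OF lr] L_pos by (intro mult_left_mono) auto
      finally show ?thesis
        unfolding right_diff_distrib[symmetric] abs_mult using r by (intro mult_mono) auto
    qed simp
  qed (use cu cv in \<open>auto intro: continuous_on_diff\<close>)
  finally show ?thesis by (simp add: exp_double)
qed

text \<open>Both exit sets are relatively open, they are disjoint, and each meets (0, Lam];
  connectedness leaves a parameter in neither. The starting time T serves all lam at once, so the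
  exits are compared on common time intervals.\<close>

lemma shooting:
  assumes "0 < IG (phit k) t0"
  obtains lam h y where "orbit k g G xi L lam h y" "\<And>t. orbit.good k h y t"
proof (rule overshoot)
  fix Lam
  assume Lam: "0 < Lam" and over: "\<And>lam h y. orbit k g G xi L lam h y \<Longrightarrow>
      \<forall>\<^sub>F s in at_bot. h s \<le> 3 * exp (real k * s) \<Longrightarrow> Lam \<le> lam \<Longrightarrow>
      \<exists>t1. (\<forall>s<t1. orbit.good k h y s) \<and> h t1 = pi \<and> 0 < y t1"
  show thesis
  proof (rule singular_ivp_family[OF k_pos less_imp_le[OF Lam] less_imp_le[OF L_pos] lip g_zeros(1)])
    fix h y C b
    assume C: "0 \<le> C" and b: "1 \<le> b" and h0: "h 0 = phit k"
      and hd: "\<And>lam t. 0 \<le> lam \<Longrightarrow> lam \<le> Lam \<Longrightarrow> (h lam has_real_derivative y lam t) (at t)"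
      and yd: "\<And>lam t. 0 \<le> lam \<Longrightarrow> lam \<le> Lam \<Longrightarrow> (y lam has_real_derivative
            (real k)\<^sup>2 * sin (h lam t) * cos (h lam t) + lam * exp (2 * t) * g (h lam t)) (at t)"
      and h_diff: "\<And>lam mu t. 0 \<le> lam \<Longrightarrow> lam \<le> Lam \<Longrightarrow> 0 \<le> mu \<Longrightarrow> mu \<le> Lam \<Longrightarrow>
            \<bar>h lam t - h mu t\<bar> \<le> C * \<bar>lam - mu\<bar> * om k b (exp t)"
      and y_diff: "\<And>lam mu t. 0 \<le> lam \<Longrightarrow> lam \<le> Lam \<Longrightarrow> 0 \<le> mu \<Longrightarrow> mu \<le> Lam \<Longrightarrow>
            \<bar>y lam t - y mu t\<bar> \<le> C * \<bar>lam - mu\<bar> * om1 k b (exp t)"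
    have h_phit: "\<bar>h lam t - phit k t\<bar> \<le> C * lam * om k b (exp t)" if "0 \<le> lam" "lam \<le> Lam" for lam t
      using h_diff[OF that, of 0] that by (simp add: h0)
    \<comment> \<open>Up to t = 0, the deviation from the profile is at most D * exp t * exp (k t)
      for all lam in [0, Lam]. The extra factor exp t makes it small relative to the
      profile.\<close>
    define D where "D = C * Lam * exp b"
    have D: "0 \<le> D" using C Lam by (simp add: D_def)
    have *: "((\<lambda>t. c * exp t) \<longlongrightarrow> 0) (at_bot :: real filter)" for c :: real
      using tendsto_mult_left[OF exp_at_bot, of c] by simp
    have "\<forall>\<^sub>F t in at_bot. D * exp t < 1" by (rule order_tendstoD(2)[OF *]) simp
    moreover have "\<forall>\<^sub>F t in at_bot. 3 * exp (t::real) < min xi (pi / 2)"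
      by (rule order_tendstoD(2)[OF *]) (use xi in simp)
    moreover have "\<forall>\<^sub>F t in at_bot. t \<le> (0::real)" by (rule eventually_le_at_bot)
    ultimately have "\<forall>\<^sub>F t in at_bot. D * exp t < 1 \<and> 3 * exp (t::real) < min xi (pi / 2) \<and> t \<le> 0"
      by eventually_elim auto
    then obtain T where T: "\<And>t. t \<le> T \<Longrightarrow> D * exp t < 1 \<and> 3 * exp t < min xi (pi / 2) \<and> t \<le> 0"
      by (auto simp: eventually_at_bot_linorder)
    have start: "0 < h lam t" "h lam t \<le> 3 * exp (real k * t)" "h lam t \<le> 3 * exp t" "h lam t < xi" "h lam t < pi / 2"
      if lam: "0 \<le> lam" "lam \<le> Lam" and t: "t \<le> T" for lam t
    proof -
      note Tt = T[OF t]
      have "C * lam * om k b (exp t) \<le> C * Lam * om k b (exp t)"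
        using C lam om_pos[of "exp t" k b] by (intro mult_right_mono mult_left_mono) auto
      also have "\<dots> \<le> C * Lam * (exp b * (exp (real k * t) * exp t))"
        using om_le_exp[of t b k] C Lam Tt b by (intro mult_left_mono) auto
      also have "\<dots> = D * exp t * exp (real k * t)" by (simp add: D_def)
      also have "\<dots> < 1 * exp (real k * t)" using Tt by (intro mult_strict_right_mono) auto
      finally have *: "\<bar>h lam t - phit k t\<bar> < exp (real k * t)" using h_phit[OF lam, of t] by simp
      show "0 < h lam t" using * exp_le_phit[of t k] Tt by linarith
      show 1: "h lam t \<le> 3 * exp (real k * t)" using * phit_le[of k t] by linarith
      have "real k * t \<le> 1 * t" using Tt k_pos by (intro mult_right_mono_neg) auto
      then have "exp (real k * t) \<le> exp t" by simp
      then show "h lam t \<le> 3 * exp t" using 1 by linarith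
      then show "h lam t < xi" "h lam t < pi / 2" using Tt by auto
    qed
    have orbit: "orbit k g G xi L lam (h lam) (y lam)" if lam: "0 < lam" "lam \<le> Lam" for lam
    proof (intro orbit.intro orbit_axioms.intro)
      show "profile k g G xi L" by (rule profile_axioms)
      show "(h lam \<longlongrightarrow> 0) at_bot"
      proof (rule Lim_null_comparison)
        show "\<forall>\<^sub>F t in at_bot. norm (h lam t) \<le> 3 * exp t"
          using start(1,3)[of lam] lam by (intro eventually_at_bot_linorderI[of T]) (simp add: less_imp_le)
        show "((\<lambda>t. 3 * exp t) \<longlongrightarrow> (0::real)) at_bot"
          using tendsto_mult_left[OF exp_at_bot, of "3::real"] by simp
      qed
      show "\<forall>\<^sub>F t in at_bot. 0 < h lam t"
        using start(1)[of lam] lam by (intro eventually_at_bot_linorderI[of T]) simp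
    qed (use lam hd yd in auto)
    have good_T: "orbit.good k (h lam) (y lam) t" if "0 < lam" "lam \<le> Lam" "t \<le> T" for lam t
      using that start by (intro orbit.good_start[OF orbit]) auto
    define w where "w lam t = y lam t - real k * sin (h lam t)" for lam t
    have w_eq: "orbit.w k (h lam) (y lam) t = w lam t" if "0 < lam" "lam \<le> Lam" for lam t
      by (simp add: w_def orbit.w_def[OF orbit[OF that]])
    have h_cont: "isCont (h lam) t" and w_cont: "isCont (w lam) t" if "0 < lam" "lam \<le> Lam" for lam t
    proof -
      have "orbit.w k (h lam) (y lam) = w lam" using w_eq[OF that] by auto
      then show "isCont (h lam) t" "isCont (w lam) t"
        using orbit.isCont_h[OF orbit[OF that]] orbit.isCont_w[OF orbit[OF that]] by auto
    qed
    \<comment> \<open>A collects the orbits that pass pi with w > 0, B those for which w becomes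
      negative below pi. They are disjoint because the earlier of two witnessing times violates the
      condition attached to the later one.\<close>
    define A where "A = {lam. \<exists>t\<ge>T. pi < h lam t \<and> (\<forall>s. T \<le> s \<and> s \<le> t \<longrightarrow> 0 < w lam s)}"
    define B where "B = {lam. \<exists>t\<ge>T. w lam t < 0 \<and> (\<forall>s. T \<le> s \<and> s \<le> t \<longrightarrow> h lam s < pi)}"
    have disj: "A \<inter> B = {}"
    proof -
      have False if "T \<le> t" "pi < h lam t" "\<forall>s. T \<le> s \<and> s \<le> t \<longrightarrow> 0 < w lam s"
         "T \<le> t'" "w lam t' < 0" "\<forall>s. T \<le> s \<and> s \<le> t' \<longrightarrow> h lam s < pi" for lam t t'
        using that by (cases "t \<le> t'") force+
      then show ?thesis unfolding A_def B_def by blast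
    qed
    have cover: "(\<forall>t. orbit.good k (h lam) (y lam) t) \<or> lam \<in> A \<or> lam \<in> B" if "0 < lam" "lam \<le> Lam" for lam
      using orbit.exit_strict[OF orbit[OF that] good_T[OF that]] by (simp add: A_def B_def w_eq[OF that])
    have w_diff: "\<bar>w lam t - w mu t\<bar> \<le> (C * om1 k b (exp t) + real k * (C * om k b (exp t))) * \<bar>lam - mu\<bar>"
      if "0 \<le> lam" "lam \<le> Lam" "0 \<le> mu" "mu \<le> Lam" for lam mu t
    proof -
      have "\<bar>real k * sin (h lam t) - real k * sin (h mu t)\<bar> \<le> real k * \<bar>h lam t - h mu t\<bar>"
        using abs_sin_diff_le[of "h lam t" "h mu t"] by (simp add: abs_mult mult_left_mono flip: right_diff_distrib)
      also have "\<dots> \<le> real k * (C * \<bar>lam - mu\<bar> * om k b (exp t))" using h_diff[OF that] by (intro mult_left_mono) auto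
      finally have "\<bar>real k * sin (h lam t) - real k * sin (h mu t)\<bar> \<le> real k * (C * \<bar>lam - mu\<bar> * om k b (exp t))" .
      with y_diff[OF that, of t] have "\<bar>w lam t - w mu t\<bar> \<le> C * \<bar>lam - mu\<bar> * om1 k b (exp t) + real k * (C * \<bar>lam - mu\<bar> * om k b (exp t))"
        unfolding w_def by linarith
      then show ?thesis by (simp add: algebra_simps)
    qed
    define M where "M t = C * om1 k b (exp t) + real k * (C * om k b (exp t)) + C * om k b (exp t)" for t
    have om_nonneg: "0 \<le> om k b (exp t)" "0 \<le> om1 k b (exp t)" for t
      using om_pos[of "exp t" k b] b by (auto simp: om1_def)
    have M_nonneg: "0 \<le> M t" for t using C om_nonneg by (simp add: M_def)
    have M: "\<bar>w lam s - w mu s\<bar> \<le> M t * \<bar>lam - mu\<bar>" "\<bar>h lam s - h mu s\<bar> \<le> M t * \<bar>lam - mu\<bar>"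
      if *: "0 \<le> lam" "lam \<le> Lam" "0 \<le> mu" "mu \<le> Lam" and "s \<le> t" for lam mu s t
    proof -
      have le: "om k b (exp s) \<le> om k b (exp t)" "om1 k b (exp s) \<le> om1 k b (exp t)"
        using that(5) b by (auto intro!: om_mono)
      have "C * om1 k b (exp s) + real k * (C * om k b (exp s)) \<le> M t"
        unfolding M_def using C om_nonneg[of t] mult_left_mono[OF le(1) C] mult_left_mono[OF le(2) C]
        by (intro add_increasing2[OF _ add_mono]) (auto intro: mult_left_mono)
      then show "\<bar>w lam s - w mu s\<bar> \<le> M t * \<bar>lam - mu\<bar>"
        by (intro order_trans[OF w_diff[OF *]] mult_right_mono) auto
      have "C * om k b (exp s) \<le> M t"
        unfolding M_def using C om_nonneg[of t] mult_left_mono[OF le(1) C]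
        by (intro add_increasing) auto
      from mult_right_mono[OF this, of "\<bar>lam - mu\<bar>"] h_diff[OF *, of s]
      show "\<bar>h lam s - h mu s\<bar> \<le> M t * \<bar>lam - mu\<bar>" by (simp add: algebra_simps)
    qed
    have open_A: "\<exists>e>0. \<forall>mu. 0 < mu \<and> mu \<le> Lam \<and> \<bar>mu - lam\<bar> < e \<longrightarrow> mu \<in> A" if lam: "0 < lam" "lam \<le> Lam" "lam \<in> A" for lam
    proof -
      obtain t where t: "T \<le> t" "pi < h lam t" "\<And>s. T \<le> s \<Longrightarrow> s \<le> t \<Longrightarrow> 0 < w lam s"
        using lam(3) by (auto simp: A_def)
      obtain e1 where e1: "0 < e1" "\<And>mu s. mu \<in> {0<..Lam} \<Longrightarrow> \<bar>mu - lam\<bar> < e1 \<Longrightarrow> T \<le> s \<Longrightarrow> s \<le> t \<Longrightarrow> 0 < w mu s"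
        by (rule pos_on_interval_stable[of T t w lam "M t" "{0<..Lam}"])
          (use lam t M M_nonneg w_cont in \<open>auto intro!: continuous_at_imp_continuous_on\<close>)
      obtain e2 where e2: "0 < e2" "\<And>mu s. mu \<in> {0<..Lam} \<Longrightarrow> \<bar>mu - lam\<bar> < e2 \<Longrightarrow> t \<le> s \<Longrightarrow> s \<le> t \<Longrightarrow> 0 < h mu s - pi"
        by (rule pos_on_interval_stable[of t t "\<lambda>mu s. h mu s - pi" lam "M t" "{0<..Lam}"])
          (use lam t M M_nonneg h_cont in \<open>auto intro!: continuous_at_imp_continuous_on\<close>)
      have "mu \<in> A" if "0 < mu" "mu \<le> Lam" "\<bar>mu - lam\<bar> < min e1 e2" for mu
        unfolding A_def using e1(2)[of mu] e2(2)[of mu t] that t by (auto intro!: exI[of _ t])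
      then show ?thesis using e1(1) e2(1) by (intro exI[of _ "min e1 e2"]) auto
    qed
    have open_B: "\<exists>e>0. \<forall>mu. 0 < mu \<and> mu \<le> Lam \<and> \<bar>mu - lam\<bar> < e \<longrightarrow> mu \<in> B" if lam: "0 < lam" "lam \<le> Lam" "lam \<in> B" for lam
    proof -
      obtain t where t: "T \<le> t" "w lam t < 0" "\<And>s. T \<le> s \<Longrightarrow> s \<le> t \<Longrightarrow> h lam s < pi"
        using lam(3) by (auto simp: B_def)
      obtain e1 where e1: "0 < e1" "\<And>mu s. mu \<in> {0<..Lam} \<Longrightarrow> \<bar>mu - lam\<bar> < e1 \<Longrightarrow> T \<le> s \<Longrightarrow> s \<le> t \<Longrightarrow> 0 < pi - h mu s"
        by (rule pos_on_interval_stable[of T t "\<lambda>mu s. pi - h mu s" lam "M t" "{0<..Lam}"])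
          (use lam t M M_nonneg h_cont in \<open>auto intro!: continuous_at_imp_continuous_on simp: abs_minus_commute\<close>)
      obtain e2 where e2: "0 < e2" "\<And>mu s. mu \<in> {0<..Lam} \<Longrightarrow> \<bar>mu - lam\<bar> < e2 \<Longrightarrow> t \<le> s \<Longrightarrow> s \<le> t \<Longrightarrow> 0 < - w mu s"
        by (rule pos_on_interval_stable[of t t "\<lambda>mu s. - w mu s" lam "M t" "{0<..Lam}"])
          (use lam t M M_nonneg w_cont in \<open>auto intro!: continuous_at_imp_continuous_on simp: abs_minus_commute\<close>)
      have "mu \<in> B" if "0 < mu" "mu \<le> Lam" "\<bar>mu - lam\<bar> < min e1 e2" for mu
        unfolding B_def using e1(2)[of mu] e2(2)[of mu t] that t by (auto intro!: exI[of _ t])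
      then show ?thesis using e1(1) e2(1) by (intro exI[of _ "min e1 e2"]) auto
    qed
    \<comment> \<open>The orbit is good until it reaches pi at t1, so a witness for B would have to
      come at or after t1, against h < pi up to that witness.\<close>
    have A_Lam: "Lam \<in> A"
    proof -
      interpret orbit k g G xi L Lam "h Lam" "y Lam" by (rule orbit) (use Lam in auto)
      have "\<forall>\<^sub>F s in at_bot. h Lam s \<le> 3 * exp (real k * s)"
        using start(2)[of Lam] Lam by (intro eventually_at_bot_linorderI[of T]) simp
      then obtain t1 where t1: "\<forall>s<t1. good s" "h Lam t1 = pi" "0 < y Lam t1"
        using over[OF orbit_axioms _ order_refl] by blast
      have "\<not> (\<forall>t. good t)" using t1(2) by (metis good_def less_irrefl)
      moreover have "Lam \<notin> B"
      proof
        assume "Lam \<in> B"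
        then obtain t where t: "T \<le> t" "w Lam t < 0" "\<And>s. T \<le> s \<Longrightarrow> s \<le> t \<Longrightarrow> h Lam s < pi" by (auto simp: B_def)
        have "T \<le> t1" using start(5)[of Lam t1] Lam t1(2) pi_gt_zero by linarith
        then have "t < t1" using t(3)[of t1] t1(2) by force
        then show False using t(2) t1(1) w_eq[of Lam t] Lam by (auto simp: good_def)
      qed
      ultimately show ?thesis using cover[of Lam] Lam by blast
    qed
    obtain ls where ls: "0 < ls" "ls \<le> Lam" "ls \<in> B"
    proof -
      obtain t where t: "exp (2 * t) * G (phit k t) < IG (phit k) t" using G_phit_crossing[OF assms] by blast
      define d where "d = IG (phit k) t - exp (2 * t) * G (phit k t)"
      define T' where "T' = max T t + 1"
      define N where "N = C * om k b (exp T')"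
      have N: "0 \<le> N" using C om_nonneg by (simp add: N_def)
      \<comment> \<open>The three bounds secure h > 0 between T and T', h < pi up to T', and a
        negative Pohozaev value at t. The 2 in the last one accounts for equal errors in G (h t) and
        in the integral.\<close>
      define q where "q = min (min (phit k T) (pi - phit k T')) (d / (2 * L * pi * exp (2 * t)))"
      have q: "0 < q" using phit_bounds[of k T] phit_bounds[of k T'] t L_pos by (simp add: q_def d_def)
      define ls where "ls = min Lam (q / (N + 1))"
      have ls: "0 < ls" "ls \<le> Lam" using q N Lam by (auto simp: ls_def)
      have "ls * (N + 1) \<le> q" using N by (simp add: ls_def pos_le_divide_eq[symmetric])
      then have lsN: "ls * N < q" using ls by (simp add: algebra_simps)
      then have lsN': "ls * N < phit k T" "ls * N < pi - phit k T'" "ls * N < d / (2 * L * pi * exp (2 * t))"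
        by (auto simp: q_def)
      have close: "\<bar>h ls s - phit k s\<bar> \<le> ls * N" if "s \<le> T'" for s
      proof -
        have "C * ls * om k b (exp s) \<le> C * ls * om k b (exp T')"
          using C ls that b by (intro mult_left_mono om_mono) auto
        then show ?thesis using h_phit[of ls s] ls by (simp add: N_def algebra_simps)
      qed
      have h_bd: "0 < h ls s \<and> h ls s < pi" if "s \<le> T'" for s
      proof
        have "phit k s \<le> phit k T'" using phit_mono[of s T'] that by (cases "s = T'") auto
        then show "h ls s < pi" using close[OF that] lsN' by linarith
        show "0 < h ls s"
        proof (cases "s \<le> T")
          case True then show ?thesis using start(1)[of ls s] ls by simp
        next
          case False
          then have "phit k T < phit k s" by (intro phit_mono) simp
          then show ?thesis using close[OF that] lsN' by linarith
        qed
      qed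
      interpret orbit k g G xi L ls "h ls" "y ls" by (rule orbit[OF ls])
      have tT: "t < T'" by (simp add: T'_def)
      have "\<bar>IG (h ls) t - IG (phit k) t\<bar> \<le> L * pi * (ls * N) * exp (2 * t)"
        using tT h_bd close by (intro IG_close h_continuous phit_continuous) (auto simp: phit_bounds)
      moreover have "\<bar>G (h ls t) - G (phit k t)\<bar> \<le> L * pi * \<bar>h ls t - phit k t\<bar>"
        using h_bd[of t] tT by (intro G_lipschitz) (auto simp: phit_bounds)
      moreover have "L * pi * \<bar>h ls t - phit k t\<bar> \<le> L * pi * (ls * N)"
        using close[of t] tT L_pos by (intro mult_left_mono) auto
      ultimately have IG_le: "\<bar>IG (h ls) t - IG (phit k) t\<bar> \<le> L * pi * (ls * N) * exp (2 * t)"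
        and "G (h ls t) - G (phit k t) \<le> L * pi * (ls * N)" by linarith+
      then have "exp (2 * t) * (G (h ls t) - G (phit k t)) \<le> exp (2 * t) * (L * pi * (ls * N))"
        by (intro mult_left_mono) auto
      then have "exp (2 * t) * G (h ls t) - exp (2 * t) * G (phit k t) \<le> L * pi * (ls * N) * exp (2 * t)"
        by (simp add: right_diff_distrib mult.commute)
      moreover have "(2 * L * pi * exp (2 * t)) * (ls * N) = 2 * (L * pi * (ls * N) * exp (2 * t))" by simp
      ultimately have 1: "exp (2 * t) * G (h ls t) - IG (h ls) t \<le> - d + (2 * L * pi * exp (2 * t)) * (ls * N)"
        using IG_le unfolding d_def by linarith
      from lsN'(3) have "(2 * L * pi * exp (2 * t)) * (ls * N) < d" using L_pos by (simp add: field_simps)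
      with 1 have "exp (2 * t) * G (h ls t) - IG (h ls) t < 0" by linarith
      \<comment> \<open>By the factorisation of E and sin (h t) >= 0, negative energy excludes both
        w > 0 and w = 0.\<close>
      then have "E t < 0" using pohozaev[OF h_bd tT] lam by (simp add: mult_pos_neg)
      then have nw: "\<not> 0 < w ls t" using E_pos_if[of t] h_bd[of t] tT w_eq[OF ls] by (auto intro: sin_ge_zero less_imp_le)
      have "w ls t \<noteq> 0" using \<open>E t < 0\<close> w_eq[OF ls, of t] E_eq[of t] by auto
      with nw have "w ls t < 0" by linarith
      moreover have "T \<le> t" using good_T[OF ls, of t] w_eq[OF ls, of t] nw le_cases[of t T] by (auto simp: good_def)
      ultimately have "ls \<in> B" unfolding B_def using h_bd tT by (auto intro!: exI[of _ t])
      then show ?thesis using that ls by blast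
    qed
    have "\<exists>lam\<in>{ls..Lam}. lam \<notin> A \<and> lam \<notin> B"
    proof (rule ccontr)
      assume "\<not> ?thesis"
      then have cov: "{ls..Lam} \<subseteq> ({ls..Lam} \<inter> A) \<union> ({ls..Lam} \<inter> B)" by blast
      have op: "openin (top_of_set {ls..Lam}) ({ls..Lam} \<inter> X)"
        if X: "\<And>lam. 0 < lam \<Longrightarrow> lam \<le> Lam \<Longrightarrow> lam \<in> X \<Longrightarrow>
          \<exists>e>0. \<forall>mu. 0 < mu \<and> mu \<le> Lam \<and> \<bar>mu - lam\<bar> < e \<longrightarrow> mu \<in> X" for X
        unfolding openin_euclidean_subtopology_iff dist_real_def
      proof (intro conjI ballI)
        fix lam assume lam: "lam \<in> {ls..Lam} \<inter> X"
        then obtain e where "0 < e" "\<forall>mu. 0 < mu \<and> mu \<le> Lam \<and> \<bar>mu - lam\<bar> < e \<longrightarrow> mu \<in> X"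
          using X[of lam] ls(1) by auto
        then show "\<exists>e>0. \<forall>mu\<in>{ls..Lam}. \<bar>mu - lam\<bar> < e \<longrightarrow> mu \<in> {ls..Lam} \<inter> X"
          using ls(1) by (intro exI[of _ e]) auto
      qed blast
      have "openin (top_of_set {ls..Lam}) ({ls..Lam} \<inter> A)" "openin (top_of_set {ls..Lam}) ({ls..Lam} \<inter> B)"
        using op[OF open_A] op[OF open_B] by blast+
      moreover have "connected {ls..Lam}" by simp
      moreover have "({ls..Lam} \<inter> A) \<inter> ({ls..Lam} \<inter> B) = {}" using disj by blast
      moreover have "Lam \<in> {ls..Lam} \<inter> A" "ls \<in> {ls..Lam} \<inter> B" using A_Lam ls by auto
      ultimately show False using cov unfolding connected_openin by blast
    qed
    then obtain lam where "lam \<in> {ls..Lam}" "lam \<notin> A" "lam \<notin> B" by blast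
    then have "0 < lam" "lam \<le> Lam" "lam \<notin> A" "lam \<notin> B" using ls(1) by auto
    then show thesis using that orbit[of lam] cover[of lam] by blast
  qed
qed

end

section \<open>The integral criterion\<close>

text \<open>After r0 the partial integrals F are nondecreasing. If some F R is positive, it bounds
  the extended integral from below, whether or not the latter is finite; if none is, F is bounded
  above by 0 and the extended integral is its finite limit.\<close>

lemma ext_integral_pos_iff:
  fixes f :: "real \<Rightarrow> real"
  assumes cont: "continuous_on {0..} f" and r0: "0 < r0"
    and neg: "\<And>r. 0 \<le> r \<Longrightarrow> r \<le> r0 \<Longrightarrow> f r \<le> 0" and pos: "\<And>r. r0 \<le> r \<Longrightarrow> 0 \<le> f r"
  shows "0 < ext_integral {0..} f \<longleftrightarrow> (\<exists>R\<ge>r0. 0 < integral {0..R} f)"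
proof -
  define F where "F R = integral {0..R} f" for R
  have int: "f integrable_on {a..b}" if "0 \<le> a" for a b
    using that by (intro integrable_continuous_real continuous_on_subset[OF cont]) auto
  have F: "(F has_real_derivative f R) (at R)" if "0 < R" for R
    unfolding F_def[abs_def] using integral_from_0_has_real_derivative[OF cont that] .
  have F_mono: "F R \<le> F R'" if "r0 \<le> R" "R \<le> R'" for R R'
    by (rule DERIV_nonneg_imp_nondecreasing[OF that(2)]) (use F pos r0 that in \<open>meson less_le_trans order_trans\<close>)
  have F0: "F r0 \<le> 0"
  proof -
    have "integral {0..r0} f \<le> integral {0..r0} (\<lambda>_. 0)"
      using neg by (intro integral_le int) auto
    then show ?thesis by (simp add: F_def)
  qed
  have "(\<integral>\<^sup>+r\<in>{0..}. ennreal (- f r) \<partial>lborel) = (\<integral>\<^sup>+r. ennreal (- f r) * indicator {0..r0} r \<partial>lborel)"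
    using pos by (intro nn_integral_cong) (auto simp: indicator_def ennreal_neg)
  also have "\<dots> = ennreal (- F r0)"
  proof (rule nn_integral_has_integral_lebesgue')
    show "((\<lambda>r. - f r) has_integral - F r0) {0..r0}"
      unfolding F_def using r0 by (intro has_integral_neg integrable_integral int) simp
  qed (use neg in auto)
  finally have N: "(\<integral>\<^sup>+r\<in>{0..}. ennreal (- f r) \<partial>lborel) = ennreal (- F r0)" .
  have P: "(\<integral>\<^sup>+r\<in>{0..}. ennreal (f r) \<partial>lborel) = (\<integral>\<^sup>+r. ennreal (f r) * indicator {r0..} r \<partial>lborel)"
    using neg r0 by (intro nn_integral_cong) (auto simp: indicator_def ennreal_neg)
  have I: "ext_integral {0..} f = enn2ereal (\<integral>\<^sup>+r. ennreal (f r) * indicator {r0..} r \<partial>lborel) - ereal (- F r0)"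
    unfolding ext_integral_def N P using F0 by (simp add: enn2ereal_ennreal)
  show ?thesis
  proof (cases "\<exists>R\<ge>r0. 0 < F R")
    case True
    then obtain R where R: "r0 \<le> R" "0 < F R" by blast
    have "(\<integral>\<^sup>+r. ennreal (f r) * indicator {r0..R} r \<partial>lborel) = ennreal (F R - F r0)"
    proof (rule nn_integral_has_integral_lebesgue')
      show "(f has_integral (F R - F r0)) {r0..R}"
        using F r0 R by (intro fundamental_theorem_of_calculus)
          (auto simp: has_real_derivative_iff_has_vector_derivative[symmetric] intro!: has_field_derivative_at_within[OF F])
    qed (use pos in auto)
    moreover have "(\<integral>\<^sup>+r. ennreal (f r) * indicator {r0..R} r \<partial>lborel) \<le> (\<integral>\<^sup>+r. ennreal (f r) * indicator {r0..} r \<partial>lborel)"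
      by (intro nn_integral_mono) (auto simp: indicator_def)
    ultimately have "enn2ereal (ennreal (F R - F r0)) \<le> enn2ereal (\<integral>\<^sup>+r. ennreal (f r) * indicator {r0..} r \<partial>lborel)"
      by (simp add: less_eq_ennreal.rep_eq)
    then have "ereal (F R - F r0) \<le> enn2ereal (\<integral>\<^sup>+r. ennreal (f r) * indicator {r0..} r \<partial>lborel)"
      using F_mono[OF order_refl R(1)] by (simp add: enn2ereal_ennreal)
    then have "ereal (F R - F r0) - ereal (- F r0) \<le> ext_integral {0..} f"
      unfolding I by (intro ereal_minus_mono) auto
    then have "ereal (F R) \<le> ext_integral {0..} f" by simp
    then have "0 < ext_integral {0..} f" using R(2) by (metis ereal_less(2) less_le_trans)
    then show ?thesis using True by (simp add: F_def)
  next
    case False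
    then have F_le: "F R \<le> 0" if "r0 \<le> R" for R using that by (meson not_le)
    define T where "T = Sup (F ` {r0..})"
    have bdd: "bdd_above (F ` {r0..})" using F_le by (intro bdd_aboveI[of _ 0]) auto
    have T_ge: "F R \<le> T" if "r0 \<le> R" for R unfolding T_def using that by (intro cSup_upper bdd) auto
    have T_le: "T \<le> 0" unfolding T_def using F_le by (intro cSup_least) auto
    have lim: "(F \<longlongrightarrow> T) at_top"
    proof (rule order_tendstoI)
      fix a assume "a < T"
      then obtain R where R: "r0 \<le> R" "a < F R"
        unfolding T_def using less_cSup_iff[OF _ bdd, of a] by auto
      then have "a < F R'" if "R \<le> R'" for R' using F_mono[OF R(1) that] by simp
      then show "\<forall>\<^sub>F R in at_top. a < F R" by (rule eventually_at_top_linorderI)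
    next
      fix a assume "T < a"
      then have "F R < a" if "r0 \<le> R" for R using T_ge[OF that] by simp
      then show "\<forall>\<^sub>F R in at_top. F R < a" by (rule eventually_at_top_linorderI)
    qed
    \<comment> \<open>Continuing f constantly to the left of 0 makes it Borel measurable on the line
      without changing the integral over {r0..}.\<close>
    have "continuous_on UNIV (\<lambda>x. f (max x 0))"
      by (intro continuous_on_compose2[OF cont] continuous_intros) auto
    then have meas: "(\<lambda>x. f (max x 0)) \<in> borel_measurable borel"
      by (rule borel_measurable_continuous_onI)
    have "(\<integral>\<^sup>+r. ennreal (f r) * indicator {r0..} r \<partial>lborel) = (\<integral>\<^sup>+r. ennreal (f (max r 0)) * indicator {r0..} r \<partial>lborel)"
      using r0 by (intro nn_integral_cong) (auto simp: indicator_def max_def)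
    also have "\<dots> = ennreal (T - F r0)"
    proof (rule nn_integral_FTC_atLeast[OF meas])
      fix x assume "r0 \<le> x"
      then show "(F has_real_derivative f (max x 0)) (at x)" "0 \<le> f (max x 0)"
        using F[of x] pos[of x] r0 by (auto simp: max_def)
    qed (rule lim)
    finally have "ext_integral {0..} f = ereal (T - F r0) - ereal (- F r0)"
      unfolding I using T_ge[of r0] by (simp add: enn2ereal_ennreal)
    then have "ext_integral {0..} f = ereal T" by simp
    then show ?thesis using T_le False by (simp add: F_def)
  qed
qed

text \<open>Clamping the argument to [0, pi] preserves the Lipschitz constant, and since g vanishes
  at both ends the continuation is 0 outside. \<open>Gpot g\<close> is kept as it is, as G is only
  evaluated on [0, pi].\<close>

lemma profile_of_conditions:
  fixes g :: "real \<Rightarrow> real"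
  assumes smooth: "smooth_on_interval g 0 pi" and i: "cond_i g" and ii: "cond_ii g" and iii: "cond_iii g"
    and k: "0 < k"
  obtains xi L where "profile k (\<lambda>x. g (max 0 (min pi x))) (Gpot g) xi L"
proof -
  obtain D where D: "\<And>x. x \<in> {0..pi} \<Longrightarrow> D 0 x = g x"
    "\<And>n x. x \<in> {0..pi} \<Longrightarrow> (D n has_real_derivative D (Suc n) x) (at x within {0..pi})"
    using smooth unfolding smooth_on_interval_def by blast
  have g': "(g has_real_derivative D 1 x) (at x within {0..pi})" if "x \<in> {0..pi}" for x
  proof (rule has_field_derivative_transform_within)
    show "(D 0 has_real_derivative D 1 x) (at x within {0..pi})" using D(2)[OF that, of 0] by simp
  qed (use D(1) that in \<open>auto intro: zero_less_one\<close>)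
  have cont_g: "continuous_on {0..pi} g"
    using g' by (intro DERIV_continuous_on) auto
  have "continuous_on {0..pi} (D 1)"
    using D(2)[of _ 1] by (intro DERIV_continuous_on) auto
  then have "bounded (D 1 ` {0..pi})" by (intro compact_imp_bounded compact_continuous_image) auto
  then obtain L where L: "0 < L" "\<And>x. x \<in> {0..pi} \<Longrightarrow> norm (D 1 x) \<le> L"
    unfolding bounded_pos by auto
  have lip: "\<bar>g x - g y\<bar> \<le> L * \<bar>x - y\<bar>" if "x \<in> {0..pi}" "y \<in> {0..pi}" for x y
    using field_differentiable_bound[of "{0..pi}" g "D 1" L x y] g' L that by auto
  obtain xi where xi: "0 < xi" "xi < pi" "g 0 = 0" "g xi = 0" "g pi = 0"
    "\<And>x. 0 < x \<Longrightarrow> x < xi \<Longrightarrow> 0 < g x" "\<And>x. xi < x \<Longrightarrow> x < pi \<Longrightarrow> g x < 0"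
    using i unfolding cond_i_def by blast
  have G': "(Gpot g has_real_derivative g x) (at x within {0..pi})" if "x \<in> {0..pi}" for x
    using DERIV_minus[OF integral_has_real_derivative'[OF cont_g that]] by (simp add: Gpot_def[abs_def])
  have G_at: "(Gpot g has_real_derivative g x) (at x)" if "0 < x" "x < pi" for x
    using G'[of x] that by (simp add: at_within_Icc_at)
  have cont_G: "continuous_on {0..pi} (Gpot g)" using G' by (intro DERIV_continuous_on) auto
  have G_pi: "Gpot g pi = 0" by (simp add: Gpot_def)
  obtain d where d: "0 < d" "(g has_real_derivative d) (at pi within {0..pi})"
    using iii unfolding cond_iii_def by blast
  have "((\<lambda>x. g x / (x - pi)) \<longlongrightarrow> d) (at pi within {0..pi})"
    using d(2) by (simp add: has_field_derivative_iff xi(5))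
  then have "\<forall>\<^sub>F x in at pi within {0..pi}. d / 2 < g x / (x - pi)"
    by (rule order_tendstoD(1)) (use d(1) in simp)
  then obtain e where e: "0 < e" "\<And>x. x \<in> {0..pi} \<Longrightarrow> x \<noteq> pi \<Longrightarrow> dist x pi < e \<Longrightarrow> d / 2 < g x / (x - pi)"
    unfolding eventually_at by blast
  define x0 where "x0 = max (pi / 2) (pi - e / 2)"
  have x0: "0 < x0" "x0 < pi" using e(1) by (auto simp: x0_def less_max_iff_disj)
  have g_le: "g x + d / 2 * (pi - x) \<le> 0" if "x0 \<le> x" "x < pi" for x
  proof -
    have "d / 2 < g x / (x - pi)" using that x0 e(1) by (intro e(2)) (auto simp: dist_real_def x0_def)
    then show ?thesis using that by (simp add: field_simps)
  qed
  have quad: "(sqrt (d / 2) * (pi - x))\<^sup>2 \<le> 2 * Gpot g x" if "x0 \<le> x" "x < pi" for x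
  proof -
    \<comment> \<open>Near pi one has g x <= - d / 2 * (pi - x), so Q is nonincreasing up to Q pi =
      0; hence G x >= d / 4 * (pi - x)^2.\<close>
    define Q where "Q x = Gpot g x - d / 4 * (pi - x)\<^sup>2" for x
    have "Q pi \<le> Q x"
    proof (rule DERIV_nonpos_imp_decreasing_open[where f=Q])
      show "continuous_on {x..pi} Q"
        unfolding Q_def using x0 that by (intro continuous_intros continuous_on_subset[OF cont_G]) auto
      fix u assume u: "x < u" "u < pi"
      have "(Q has_real_derivative g u - d / 4 * (2 * (pi - u) * (0 - 1))) (at u)"
        unfolding Q_def[abs_def] using u that x0
        by (intro DERIV_diff G_at DERIV_cmult) (auto intro!: derivative_eq_intros)
      moreover have "g u - d / 4 * (2 * (pi - u) * (0 - 1)) = g u + d / 2 * (pi - u)" by (simp add: field_simps)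
      then have "g u - d / 4 * (2 * (pi - u) * (0 - 1)) \<le> 0" using g_le[of u] u that by simp
      ultimately show "\<exists>y. (Q has_real_derivative y) (at u) \<and> y \<le> 0" by blast
    qed (use that in simp)
    then show ?thesis using d(1) by (simp add: Q_def G_pi power_mult_distrib)
  qed
  define gg where "gg x = g (max 0 (min pi x))" for x
  have gg: "gg x = g x" if "0 \<le> x" "x \<le> pi" for x using that by (simp add: gg_def)
  have "profile k gg (Gpot g) xi L"
  proof
    show "\<bar>gg x - gg y\<bar> \<le> L * \<bar>x - y\<bar>" for x y
    proof -
      have "\<bar>gg x - gg y\<bar> \<le> L * \<bar>max 0 (min pi x) - max 0 (min pi y)\<bar>" unfolding gg_def by (rule lip) auto
      also have "\<dots> \<le> L * \<bar>x - y\<bar>" using L(1) by (intro mult_left_mono) (auto simp: max_def min_def)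
      finally show ?thesis .
    qed
    show "Gpot g 0 < 0" using ii by (simp add: Gpot_def cond_ii_def)
    show "\<exists>c>0. \<exists>x0<pi. \<forall>x. x0 \<le> x \<and> x < pi \<longrightarrow> (c * (pi - x))\<^sup>2 \<le> 2 * Gpot g x"
      using quad x0 d(1) by (intro exI[of _ "sqrt (d / 2)"] conjI exI[of _ x0]) auto
  qed (use k L xi gg G_at cont_G G_pi in auto)
  then show ?thesis using that by (simp add: gg_def[abs_def])
qed

context profile
begin

text \<open>G increases from G 0 < 0 to G xi > 0 and stays nonnegative afterwards. The integrand of
  the criterion therefore changes sign once, as \<open>ext_integral_pos_iff\<close>
  requires.\<close>

lemma G_sign_change:
  obtains x where "0 < x" "x < xi" "\<And>u. 0 \<le> u \<Longrightarrow> u \<le> x \<Longrightarrow> G u \<le> 0" "\<And>u. x \<le> u \<Longrightarrow> u \<le> pi \<Longrightarrow> 0 \<le> G u"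
proof -
  have Gxi: "0 < G xi" using G_antimono[of xi pi] xi G_ends by simp
  have "continuous_on {0..xi} G" by (rule continuous_on_subset[OF G_cont]) (use xi in auto)
  then obtain x where x: "0 \<le> x" "x \<le> xi" "G x = 0"
    using IVT'[of G 0 0 xi] G_ends Gxi xi by auto
  have "x \<noteq> 0" "x \<noteq> xi" using x(3) G_ends Gxi by auto
  then have x': "0 < x" "x < xi" using x by auto
  show ?thesis
  proof (rule that[OF x'])
    show "G u \<le> 0" if "0 \<le> u" "u \<le> x" for u
      using G_mono[of u x] that x x' by (cases "u = x") auto
    show "0 \<le> G u" if "x \<le> u" "u \<le> pi" for u
      using G_mono[of x u] G_nonneg[of u] that x x' by (cases "u = x"; cases "u \<le> xi") auto
  qed
qed

lemma phit_ln: "0 < r \<Longrightarrow> phit k (ln r) = 2 * arctan (r ^ k)"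
  by (simp add: phit_def exp_of_nat_mult)

text \<open>The substitution r = exp t gives \<open>IG (phit k) t\<close> = 2 times the partial
  integral of f up to exp t. In the second claim, \<open>xi < phit k t\<close> places exp t beyond
  the radius where f becomes nonnegative.\<close>

lemma
  defines "f \<equiv> \<lambda>r. G (2 * arctan (r ^ k)) * r"
  shows IG_pos_if_ext_integral_pos: "0 < ext_integral {0..} f \<Longrightarrow> \<exists>t. 0 < IG (phit k) t"
    and ext_integral_pos_if_IG_pos: "xi < phit k t \<Longrightarrow> 0 < IG (phit k) t \<Longrightarrow> 0 < ext_integral {0..} f"
proof -
  obtain x where x: "0 < x" "x < xi" "\<And>u. 0 \<le> u \<Longrightarrow> u \<le> x \<Longrightarrow> G u \<le> 0" "\<And>u. x \<le> u \<Longrightarrow> u \<le> pi \<Longrightarrow> 0 \<le> G u"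
    using G_sign_change by blast
  define tx where "tx = ln (tan (x / 2)) / k"
  have tx: "phit k tx = x" unfolding tx_def by (rule phit_surj) (use x xi in auto)
  have range: "0 \<le> 2 * arctan (r ^ k)" "2 * arctan (r ^ k) \<le> pi" if "0 \<le> r" for r
    using that arctan_ubound[of "r ^ k"] by auto
  have mono: "2 * arctan (r ^ k) \<le> 2 * arctan (r' ^ k)" if "0 \<le> r" "r \<le> r'" for r r'
    using that by (simp add: arctan_monotone' power_mono)
  have at_tx: "2 * arctan (exp tx ^ k) = x" using phit_ln[of "exp tx"] tx by simp
  have cont: "continuous_on {0..} f"
    unfolding f_def
    by (intro continuous_intros continuous_on_compose2[OF G_cont]) (use range in auto)
  have iff: "0 < ext_integral {0..} f \<longleftrightarrow> (\<exists>R\<ge>exp tx. 0 < integral {0..R} f)"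
  proof (rule ext_integral_pos_iff[OF cont exp_gt_zero])
    show "f r \<le> 0" if "0 \<le> r" "r \<le> exp tx" for r
      unfolding f_def using x(3)[OF range(1)[OF that(1)]] mono[OF that] that at_tx by (simp add: mult_nonpos_nonneg)
    show "0 \<le> f r" if "exp tx \<le> r" for r
    proof -
      have "0 \<le> r" using that exp_gt_zero[of tx] by linarith
      then show ?thesis
        unfolding f_def using x(4)[OF _ range(2)] mono[OF _ that] at_tx by simp
    qed
  qed
  have IG: "IG (phit k) t = 2 * integral {0..exp t} f" for t
  proof -
    have "IG (phit k) t = integral {0..exp t} (\<lambda>r. 2 * f r)"
      unfolding IG_def f_def
    proof (rule integral_cong)
      fix r assume "r \<in> {0..exp t}"
      then show "2 * r * G (phit k (ln r)) = 2 * (G (2 * arctan (r ^ k)) * r)"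
        using phit_ln[of r] by (cases "r = 0") auto
    qed
    then show ?thesis by simp
  qed
  show "\<exists>t. 0 < IG (phit k) t" if pos: "0 < ext_integral {0..} f"
  proof -
    have "\<exists>R\<ge>exp tx. 0 < integral {0..R} f" using pos by (rule iffD1[OF iff])
    then obtain R where R: "exp tx \<le> R" "0 < integral {0..R} f" by blast
    have "0 < R" using R(1) exp_gt_zero[of tx] by linarith
    then have "0 < IG (phit k) (ln R)" using R(2) by (simp add: IG)
    then show ?thesis by blast
  qed
  show "0 < ext_integral {0..} f" if t: "xi < phit k t" "0 < IG (phit k) t"
  proof -
    have "tx \<le> t" using phit_mono[of t tx] tx x t(1) by (meson less_asym not_le order.strict_trans)
    then show ?thesis using iff t(2) by (auto simp: IG)
  qed
qed

section \<open>Passage between the variables r and t = ln r\<close>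

lemma orbit_of_solution:
  assumes cont: "continuous_on {0..} H" and H0: "H 0 = 0" and bounds: "\<And>r. 0 < r \<Longrightarrow> 0 < H r \<and> H r < pi"
    and d1: "\<And>r. 0 < r \<Longrightarrow> (H has_real_derivative H' r) (at r)"
    and d2: "\<And>r. 0 < r \<Longrightarrow> (H' has_real_derivative H'' r) (at r)"
    and ode: "\<And>r. 0 < r \<Longrightarrow> H'' r + 1 / r * H' r - (real k)\<^sup>2 * sin (H r) * cos (H r) / r\<^sup>2 = g (H r)"
  shows "orbit k g G xi L 1 (\<lambda>t. H (exp t)) (\<lambda>t. exp t * H' (exp t))"
proof (intro orbit.intro orbit_axioms.intro profile_axioms)
  fix t :: real
  have h: "((\<lambda>t. H (exp t)) has_real_derivative H' (exp t) * exp t) (at t)"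
    by (rule DERIV_chain2[OF d1 DERIV_exp]) simp
  then show "((\<lambda>t. H (exp t)) has_real_derivative exp t * H' (exp t)) (at t)" by (simp add: mult.commute)
  have "((\<lambda>t. exp t * H' (exp t)) has_real_derivative exp t * H' (exp t) + H'' (exp t) * exp t * exp t) (at t)"
    by (rule DERIV_mult[OF DERIV_exp DERIV_chain2[OF d2 DERIV_exp]]) simp
  moreover have "exp t * H' (exp t) + H'' (exp t) * exp t * exp t
    = (real k)\<^sup>2 * sin (H (exp t)) * cos (H (exp t)) + 1 * exp (2 * t) * g (H (exp t))"
  proof -
    have e: "H'' (exp t) = g (H (exp t)) + (real k)\<^sup>2 * sin (H (exp t)) * cos (H (exp t)) / (exp t)\<^sup>2 - 1 / exp t * H' (exp t)"
      using ode[of "exp t"] by simp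
    show ?thesis unfolding e exp_double by (simp add: field_simps power2_eq_square)
  qed
  ultimately show "((\<lambda>t. exp t * H' (exp t)) has_real_derivative
     (real k)\<^sup>2 * sin (H (exp t)) * cos (H (exp t)) + 1 * exp (2 * t) * g (H (exp t))) (at t)" by metis
next
  have "((\<lambda>t. H (exp t)) \<longlongrightarrow> H 0) at_bot"
    by (rule continuous_on_tendsto_compose[OF cont exp_at_bot]) auto
  then show "((\<lambda>t. H (exp t)) \<longlongrightarrow> 0) at_bot" by (simp add: H0)
  show "\<forall>\<^sub>F t in at_bot. 0 < H (exp t)" using bounds by (intro always_eventually) simp
qed simp

end

context orbit
begin

text \<open>The translation by a normalises the parameter to 1: with t = ln r - a one has lam * exp
  (2 t) = r^2. Likewise sqrt lam * exp t = r, so the decay found for the orbit is exponential in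
  r.\<close>

lemma solution_of_orbit:
  assumes forever: "\<And>t. good t"
  defines "a \<equiv> ln lam / 2"
  defines "H \<equiv> \<lambda>r. if r \<le> 0 then 0 else h (ln r - a)"
    and "H' \<equiv> \<lambda>r. y (ln r - a) / r"
  shows "continuous_on {0..} H" "(H \<longlongrightarrow> pi) at_top"
    and "0 < r \<Longrightarrow> 0 < H r \<and> H r < pi"
    and "0 < r \<Longrightarrow> 0 < H' r"
    and "0 < r \<Longrightarrow> (H has_real_derivative H' r) (at r)"
    and "0 < r \<Longrightarrow> (H' has_real_derivative
      ((real k)\<^sup>2 * sin (H r) * cos (H r) / r\<^sup>2 + g (H r) - 1 / r * H' r)) (at r)"
    and "converges_exponentially_to_pi H"
proof -
  show bounds: "0 < H r \<and> H r < pi" if "0 < r" for r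
    using forever[of "ln r - a"] that by (simp add: H_def good_def)
  show "0 < H' r" if "0 < r" for r
    using good_y[OF forever[of "ln r - a"]] that by (simp add: H'_def)
  have ln': "((\<lambda>r. ln r - a) has_real_derivative 1 / r) (at r)" if "0 < r" for r
    using that by (auto intro!: derivative_eq_intros)
  show d1: "(H has_real_derivative H' r) (at r)" if "0 < r" for r
  proof (rule has_field_derivative_transform_within_open)
    show "((\<lambda>r. h (ln r - a)) has_real_derivative H' r) (at r)"
      using DERIV_chain2[OF h_deriv ln'[OF that]] by (simp add: H'_def)
    show "open {0::real<..}" "r \<in> {0<..}" using that by auto
  qed (simp add: H_def)
  show "(H' has_real_derivative
      ((real k)\<^sup>2 * sin (H r) * cos (H r) / r\<^sup>2 + g (H r) - 1 / r * H' r)) (at r)" if "0 < r" for r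
  proof -
    let ?t = "ln r - a"
    have "lam = exp (2 * a)" using lam by (simp add: a_def)
    then have "lam * exp (2 * ?t) = (exp (ln r))\<^sup>2"
      unfolding exp_double[symmetric] by (simp add: right_diff_distrib flip: exp_add)
    then have e: "lam * exp (2 * ?t) = r\<^sup>2" using that by simp
    have "(H' has_real_derivative
      (((real k)\<^sup>2 * sin (h ?t) * cos (h ?t) + lam * exp (2 * ?t) * g (h ?t)) * (1 / r) * r - y ?t * 1) / (r * r)) (at r)"
      unfolding H'_def using that by (intro DERIV_divide DERIV_chain2[OF y_deriv ln'] DERIV_ident) auto
    moreover have "(((real k)\<^sup>2 * sin (h ?t) * cos (h ?t) + lam * exp (2 * ?t) * g (h ?t)) * (1 / r) * r - y ?t * 1) / (r * r)
      = (real k)\<^sup>2 * sin (H r) * cos (H r) / r\<^sup>2 + g (H r) - 1 / r * H' r"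
      unfolding e using that by (simp add: H_def H'_def field_simps power2_eq_square)
    ultimately show ?thesis by simp
  qed
  have lim: "filterlim (\<lambda>r. ln r - a) at_top at_top"
  proof -
    have "filterlim (\<lambda>r. - a + ln r) at_top at_top"
      by (rule filterlim_tendsto_add_at_top[OF tendsto_const ln_at_top])
    then show ?thesis by simp
  qed
  have H_eq: "\<forall>\<^sub>F r in at_top. h (ln r - a) = H r"
    by (rule eventually_at_top_linorderI[of 1]) (simp add: H_def)
  show "(H \<longlongrightarrow> pi) at_top"
    using filterlim_compose[OF forever_h_tendsto[OF forever] lim] tendsto_cong[OF H_eq] by simp
  show "continuous_on {0..} H"
    unfolding continuous_on_eq_continuous_within
  proof
    fix r :: real assume "r \<in> {0..}"
    show "continuous (at r within {0..}) H"
    proof (cases "r = 0")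
      case False
      then have "0 < r" using \<open>r \<in> {0..}\<close> by simp
      then show ?thesis by (rule continuous_at_imp_continuous_at_within[OF DERIV_isCont[OF d1]])
    next
      case True
      have "filterlim (\<lambda>r. ln r - a) at_bot (at_right 0)"
        unfolding filterlim_at_bot
      proof
        fix Z :: real
        have "\<forall>\<^sub>F r in at_right 0. ln r \<le> Z + a"
          using ln_at_0 by (simp add: filterlim_at_bot)
        then show "\<forall>\<^sub>F r in at_right 0. ln r - a \<le> Z" by eventually_elim simp
      qed
      then have "((\<lambda>r. h (ln r - a)) \<longlongrightarrow> 0) (at_right 0)" by (rule filterlim_compose[OF h_at_bot])
      moreover have "\<forall>\<^sub>F r in at_right 0. h (ln r - a) = H r"
        by (simp add: H_def eventually_at_filter)
      ultimately have "(H \<longlongrightarrow> 0) (at_right 0)" using tendsto_cong by force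
      moreover have "at 0 within {0..} = at_right (0::real)"
        by (rule at_within_Ici_at_right)
      ultimately show ?thesis using True by (simp add: continuous_within H_def)
    qed
  qed
  obtain C c where C: "0 < C" "0 < c" and conv: "\<forall>\<^sub>F t in at_top. pi - h t \<le> C * exp (- c * (sqrt lam * exp t))"
    using forever_exponential[OF forever] by blast
  have "\<forall>\<^sub>F r in at_top. pi - h (ln r - a) \<le> C * exp (- c * (sqrt lam * exp (ln r - a)))"
    using lim conv by (rule filterlim_iff[THEN iffD1, rule_format])
  moreover have "\<forall>\<^sub>F r in at_top. (0::real) < r" by (rule eventually_gt_at_top)
  ultimately have "\<forall>\<^sub>F r in at_top. \<bar>pi - H r\<bar> \<le> C * exp (- c * r)"
  proof eventually_elim
    case (elim r)
    have "exp a = sqrt lam" using lam by (simp add: a_def ln_sqrt[symmetric])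
    then have "sqrt lam * exp (ln r - a) = r" using elim lam by (simp add: exp_diff)
    then show ?case using elim bounds[of r] by (simp add: H_def)
  qed
  then show "converges_exponentially_to_pi H"
    unfolding converges_exponentially_to_pi_def using C by blast
qed

end

theorem theorem1p1:
  fixes m :: int and g :: "real \<Rightarrow> real"
  assumes "m \<noteq> 0"
    and "smooth_on_interval g 0 pi"
    and "cond_i g" and "cond_ii g" and "cond_iii g"
  shows "let I = ext_integral {0..} (\<lambda>r. Gpot g (phi1 m r) * r) in
           ((\<exists>h. bvp_solution m g h) \<longleftrightarrow> (0 < I \<and> I \<le> \<infinity>)) \<and>
           (0 < I \<and> I \<le> \<infinity> \<longrightarrow>
             (\<exists>h. bvp_solution m g h \<and> (\<forall>r>0. deriv h r > 0) \<and> converges_exponentially_to_pi h))"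
proof -
  define k where "k = nat \<bar>m\<bar>"
  have k: "0 < k" "(real k)\<^sup>2 = (real_of_int m)\<^sup>2" using assms(1) by (auto simp: k_def)
  define I where "I = ext_integral {0..} (\<lambda>r. Gpot g (phi1 m r) * r)"
  have I: "I = ext_integral {0..} (\<lambda>r. Gpot g (2 * arctan (r ^ k)) * r)"
    by (simp add: I_def phi1_def k_def)
  \<comment> \<open>The solutions in question take values in (0, pi) for r > 0, where the continued
    function agrees with g; so the two equations coincide for them.\<close>
  define gg where "gg x = g (max 0 (min pi x))" for x
  have gg: "gg x = g x" if "0 < x" "x < pi" for x using that by (simp add: gg_def)
  obtain xi L where "profile k gg (Gpot g) xi L"
    using profile_of_conditions[OF assms(2-5) k(1)] unfolding gg_def[abs_def] by blast
  then interpret profile k gg "Gpot g" xi L .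
  have nec: "0 < I" if "bvp_solution m g h" for h
  proof -
    have sol: "continuous_on {0..} h" "solves_ode m g h" "h 0 = 0" "(h \<longlongrightarrow> pi) at_top"
      "\<And>r. 0 < r \<Longrightarrow> 0 < h r \<and> h r < pi"
      using that by (auto simp: bvp_solution_def)
    have ode: "h differentiable (at r)" "deriv h differentiable (at r)"
      "deriv (deriv h) r + (1 / r) * deriv h r - (real_of_int m)\<^sup>2 * sin (h r) * cos (h r) / r\<^sup>2 = g (h r)"
      if "0 < r" for r
      using sol(2) that unfolding solves_ode_def by blast+
    have "orbit k gg (Gpot g) xi L 1 (\<lambda>t. h (exp t)) (\<lambda>t. exp t * deriv h (exp t))"
    proof (rule orbit_of_solution[OF sol(1,3,5)])
      fix r :: real assume r: "0 < r"
      show "(h has_real_derivative deriv h r) (at r)" "(deriv h has_real_derivative deriv (deriv h) r) (at r)"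
        using ode(1,2)[OF r] by (simp_all add: DERIV_deriv_iff_real_differentiable)
      show "deriv (deriv h) r + 1 / r * deriv h r - (real k)\<^sup>2 * sin (h r) * cos (h r) / r\<^sup>2 = gg (h r)"
        using ode(3)[OF r] gg[of "h r"] sol(5)[OF r] by (simp add: k(2))
    qed
    then interpret orbit k gg "Gpot g" xi L 1 "\<lambda>t. h (exp t)" "\<lambda>t. exp t * deriv h (exp t)" .
    obtain t where "xi < phit k t" "0 < IG (phit k) t"
      using necessity sol(5) filterlim_compose[OF sol(4) exp_at_top] by auto
    then show ?thesis unfolding I by (rule ext_integral_pos_if_IG_pos)
  qed
  have suf: "\<exists>h. bvp_solution m g h \<and> (\<forall>r>0. deriv h r > 0) \<and> converges_exponentially_to_pi h" if "0 < I"
  proof -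
    have "\<exists>t. 0 < IG (phit k) t" by (rule IG_pos_if_ext_integral_pos) (use \<open>0 < I\<close> in \<open>simp add: I\<close>)
    then obtain t where "0 < IG (phit k) t" by blast
    then obtain lam u v where o: "orbit k gg (Gpot g) xi L lam u v" and good: "\<And>t. orbit.good k u v t"
      by (rule shooting) blast
    interpret orbit k gg "Gpot g" xi L lam u v by fact
    define h where "h r = (if r \<le> 0 then 0 else u (ln r - ln lam / 2))" for r
    define h' where "h' r = v (ln r - ln lam / 2) / r" for r
    have h_eq: "(\<lambda>r. if r \<le> 0 then 0 else u (ln r - ln lam / 2)) = h"
      and h'_eq: "(\<lambda>r. v (ln r - ln lam / 2) / r) = h'"
      by (simp_all add: fun_eq_iff h_def h'_def)
    have sol: "continuous_on {0..} h" "(h \<longlongrightarrow> pi) at_top"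
      "0 < r \<Longrightarrow> 0 < h r \<and> h r < pi" "0 < r \<Longrightarrow> 0 < h' r"
      "0 < r \<Longrightarrow> (h has_real_derivative h' r) (at r)"
      "0 < r \<Longrightarrow> (h' has_real_derivative
        ((real k)\<^sup>2 * sin (h r) * cos (h r) / r\<^sup>2 + gg (h r) - 1 / r * h' r)) (at r)"
      "converges_exponentially_to_pi h" for r
      unfolding h_eq[symmetric] h'_eq[symmetric] using solution_of_orbit[OF good] by blast+
    have d1: "deriv h r = h' r" if "0 < r" for r using sol(5)[OF that] by (rule DERIV_imp_deriv)
    have d2: "(deriv h has_real_derivative
       ((real k)\<^sup>2 * sin (h r) * cos (h r) / r\<^sup>2 + gg (h r) - 1 / r * h' r)) (at r)" if "0 < r" for r
      by (rule has_field_derivative_transform_within_open[OF sol(6)[OF that], of "{0<..}"]) (use d1 that in auto)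
    have "solves_ode m g h"
      unfolding solves_ode_def
    proof (intro allI impI conjI)
      fix r :: real assume r: "0 < r"
      show "h differentiable (at r)" using sol(5)[OF r] real_differentiable_def by blast
      show "deriv h differentiable (at r)" using d2[OF r] real_differentiable_def by blast
      show "deriv (deriv h) r + 1 / r * deriv h r - (real_of_int m)\<^sup>2 * sin (h r) * cos (h r) / r\<^sup>2 = g (h r)"
        using DERIV_imp_deriv[OF d2[OF r]] d1[OF r] gg[of "h r"] sol(3)[OF r] k(2) by simp
    qed
    then have "bvp_solution m g h"
      unfolding bvp_solution_def using sol(1-3) by (simp add: h_def)
    then show ?thesis using sol(4,7) d1 by auto
  qed
  show ?thesis
    unfolding Let_def I_def[symmetric] using nec suf by auto
qed

end
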